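(* Let $G=(V,E)$ be a graph with maximum degree $\Delta$ and $|V|=n$. (i) If $G$ is a connected nonregular graph, then $$\lambda(G)\le\sqrt{\Delta^2-\frac4{n^2}}<\Delta-\frac{2}{\Delta n^2}.$$ (ii) If $G$ is a tree with $\Delta\ge2$, then $$\lambda(G)\le2\sqrt{\Big(1-\frac1n\Big)\Big(\Delta-1+\frac1n\Big)}<\sqrt{\Delta-1}\,\Big(2-\frac{\Delta-2}{(\Delta-1)n}\Big).$$ If $G$ is a tree with $\Delta=2$, then $\lambda(G)<2-1/n^2$, and if $G$ is a tree with $\Delta<2$, then $\lambda(G)=\Delta$. (iii) If $G$ is a graph with tree-width at most $t$ and $\Delta\ge2t$, then $$\lambda(G)\le2\sqrt{\Big(t-\frac{t(t+1)}{2n}\Big)\Big(\Delta-t+\frac{t(t+1)}{2n}\Big)}<\sqrt{t(\Delta-t)}\,\Big(2-\frac{(t+1)(\Delta-2t)}{2(\Delta-t)n}\Big).$$ If moreover $\Delta=2t$, then $\lambda(G)<2t-t(t+1)^2/(4n^2)$. (iv) If $G$ is a planar graph with $\Delta\ge6$, then $$\lambda(G)\le2\sqrt{(3-6/n)(\Delta-3+6/n)}<2\sqrt{3(\Delta-3)}\,\Big(1-\frac{\Delta-6}{(\Delta-3)n}\Big).$$ If $G$ is planar with $\Delta=6$, then $\lambda(G)\le6-12/n^2$. If $G$ is planar with $\Delta\le5$, then the bound $\lambda(G)\le\Delta$ is best possible. (v) If $G$ is a graph of genus $g>0$, let $k_g=\frac72+\sqrt{12g+\frac14}$ and $\kappa_g=\max\{(\lfloor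 k_g\rfloor-1)/2,\ 3+6(g-1)/\lceil k_g\rceil\}$. If $\Delta\ge2\kappa_g$, then $$\lambda(G)\le\sqrt{\kappa_g(\Delta-\kappa_g)}.$$
   Context: Graphs are finite, simple and undirected. $\lambda(G)$ denotes the largest eigenvalue of the $0$–$1$ adjacency matrix of $G$. A graph has genus $g$ if it can be embedded in a surface of genus $g$ (not necessarily the smallest such $g$); thus planar graphs have genus $0$, and any graph embeddable in the torus has genus $1$. Tree-width is the standard graph parameter.
   Formalization: In (v) the bound is proved as 2√(κ_g(Δ−κ_g)); as printed it is false (K_7 on the torus: κ_1=3, Δ=λ=6). In (iii) the strict inequalities are stated for t≥1, since for t=0 the graph is edgeless and they read 0/0 or 0<0. *)

theory Defs
  imports "HOL-Homology.Homology"
begin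

definition simple_graph :: "'a set \<Rightarrow> 'a set set \<Rightarrow> bool" where
  "simple_graph V E \<longleftrightarrow> finite V \<and> V \<noteq> {} \<and> (\<forall>e\<in>E. e \<subseteq> V \<and> card e = 2)"

definition degree :: "'a set set \<Rightarrow> 'a \<Rightarrow> nat" where
  "degree E v = card {e \<in> E. v \<in> e}"

definition max_degree :: "'a set \<Rightarrow> 'a set set \<Rightarrow> nat" where
  "max_degree V E = Max (degree E ` V)"

definition regular :: "'a set \<Rightarrow> 'a set set \<Rightarrow> bool" where
  "regular V E \<longleftrightarrow> (\<exists>d. \<forall>v\<in>V. degree E v = d)"

definition connected_graph :: "'a set \<Rightarrow> 'a set set \<Rightarrow> bool" where
  "connected_graph V E \<longleftrightarrow> V \<noteq> {} \<and> (\<forall>u\<in>V. \<forall>v\<in>V. (u, v) \<in> {(a, b). {a, b} \<in> E}\<^sup>*)"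

definition is_cycle :: "'a set set \<Rightarrow> 'a list \<Rightarrow> bool" where
  "is_cycle E vs \<longleftrightarrow> 3 \<le> length vs \<and> distinct vs \<and>
     (\<forall>i<length vs. {vs ! i, vs ! (Suc i mod length vs)} \<in> E)"

definition tree :: "'a set \<Rightarrow> 'a set set \<Rightarrow> bool" where
  "tree V E \<longleftrightarrow> simple_graph V E \<and> connected_graph V E \<and> (\<nexists>vs. is_cycle E vs)"


definition adj_entry :: "'a set set \<Rightarrow> 'a \<Rightarrow> 'a \<Rightarrow> real" where
  "adj_entry E u v = (if {u, v} \<in> E then 1 else 0)"

text \<open>Vectors indexed by \<open>V\<close> are functions on the whole type of which only the values
  on \<open>V\<close> matter. The adjacency matrix is symmetric, so all its eigenvalues are real.\<close>

definition adj_eigenvalue :: "'a set \<Rightarrow> 'a set set \<Rightarrow> real \<Rightarrow> bool" where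
  "adj_eigenvalue V E \<mu> \<longleftrightarrow>
     (\<exists>x :: 'a \<Rightarrow> real. (\<exists>v\<in>V. x v \<noteq> 0) \<and>
        (\<forall>u\<in>V. (\<Sum>v\<in>V. adj_entry E u v * x v) = \<mu> * x u))"

definition max_eigenvalue :: "'a set \<Rightarrow> 'a set set \<Rightarrow> real" where
  "max_eigenvalue V E = Max {\<mu>. adj_eigenvalue V E \<mu>}"


text \<open>The nodes of the decomposition tree are natural numbers; as that tree is finite, this
  is no restriction.\<close>

definition tree_decomposition ::
    "'a set \<Rightarrow> 'a set set \<Rightarrow> nat set \<Rightarrow> nat set set \<Rightarrow> (nat \<Rightarrow> 'a set) \<Rightarrow> bool" where
  "tree_decomposition V E I F B \<longleftrightarrow> tree I F \<and> (\<Union>i\<in>I. B i) = V \<and>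
     (\<forall>e\<in>E. \<exists>i\<in>I. e \<subseteq> B i) \<and>
     (\<forall>v\<in>V. connected_graph {i \<in> I. v \<in> B i} {e \<in> F. e \<subseteq> {i \<in> I. v \<in> B i}})"

definition tree_width :: "'a set \<Rightarrow> 'a set set \<Rightarrow> nat" where
  "tree_width V E =
     (LEAST w. \<exists>I F B. tree_decomposition V E I F B \<and> (\<forall>i\<in>I. card (B i) \<le> w + 1))"


text \<open>Vertices go to distinct points and edges to simple arcs between the images of their
  ends; the interior of an arc meets neither a vertex nor the interior of another arc.\<close>

definition embeds_in :: "'a set \<Rightarrow> 'a set set \<Rightarrow> 'b topology \<Rightarrow> bool" where
  "embeds_in V E S \<longleftrightarrow>
     (\<exists>(p :: 'a \<Rightarrow> 'b) (\<gamma> :: 'a set \<Rightarrow> real \<Rightarrow> 'b).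
        inj_on p V \<and> p ` V \<subseteq> topspace S \<and>
        (\<forall>e\<in>E. pathin S (\<gamma> e) \<and> inj_on (\<gamma> e) {0..1} \<and> {\<gamma> e 0, \<gamma> e 1} = p ` e \<and>
           \<gamma> e ` {0<..<1} \<inter> p ` V = {} \<and>
           (\<forall>e'\<in>E. e' \<noteq> e \<longrightarrow> \<gamma> e ` {0<..<1} \<inter> \<gamma> e' ` {0<..<1} = {})))"

definition planar :: "'a set \<Rightarrow> 'a set set \<Rightarrow> bool" where
  "planar V E \<longleftrightarrow> embeds_in V E (euclidean :: complex topology)"

definition closed_surface :: "'b topology \<Rightarrow> bool" where
  "closed_surface S \<longleftrightarrow> topspace S \<noteq> {} \<and> compact_space S \<and> connected_space S \<and> Hausdorff_space S \<and>
     (\<forall>x\<in>topspace S. \<exists>U. openin S U \<and> x \<in> U \<and>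
        subtopology S U homeomorphic_space (euclidean :: complex topology))"

text \<open>Orientability by a fundamental class: an element of \<open>H\<^sub>2(S)\<close> whose image generates
  the local homology \<open>H\<^sub>2(S, S - x)\<close> at every point \<open>x\<close>.\<close>

definition orientable_surface :: "'b topology \<Rightarrow> bool" where
  "orientable_surface S \<longleftrightarrow> closed_surface S \<and>
     (\<exists>c \<in> carrier (homology_group 2 S). \<forall>x\<in>topspace S.
        carrier (subgroup_generated (relative_homology_group 2 S (topspace S - {x}))
                   {hom_induced 2 S {} S (topspace S - {x}) id c})
        = carrier (relative_homology_group 2 S (topspace S - {x})))"

text \<open>The genus (number of handles) of a closed orientable surface is half the rank of its
  first homology group, which is free.\<close>

definition surface_of_genus :: "nat \<Rightarrow> 'b topology \<Rightarrow> bool" where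
  "surface_of_genus g S \<longleftrightarrow> orientable_surface S \<and>
     homology_group 1 S \<cong> free_Abelian_group {..<2 * g}"

definition heawood :: "nat \<Rightarrow> real" where
  "heawood g = 7 / 2 + sqrt (12 * real g + 1 / 4)"

text \<open>In terms of this quantity \<open>\<kappa>\<close> the bound for genus \<open>g\<close> reads
  \<open>2 * sqrt (\<kappa> * (\<Delta> - \<kappa>))\<close>. The factor 2 is needed: \<open>K\<^sub>7\<close> embeds in the torus,
  and there \<open>\<kappa> = 3\<close>, \<open>\<Delta> = 6\<close> and the largest eigenvalue is 6.\<close>

definition genus_kappa :: "nat \<Rightarrow> real" where
  "genus_kappa g = max ((real_of_int \<lfloor>heawood g\<rfloor> - 1) / 2)
                       (3 + 6 * (real g - 1) / real_of_int \<lceil>heawood g\<rceil>)"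

end

(* Spectral part. If every vertex set H of G spans at most k |H| edges and k <= \<Delta>/2, then
   \<lambda>(G) <= 2 sqrt(k (\<Delta> - k)). For an eigenvector x put y u = x(u)^2 and bound each term of the
   quadratic form by 2 |x(u)| |x(v)| = 2 sqrt(min max) <= a min + max / a, where min and max refer
   to y u and y v. By the layer-cake formula the sum of min(y u, y v) over the edges is at most
   k times the sum of y, while min + max sums to at most \<Delta> times the sum of y; then optimise a.
   All parts are instances, except that a nonregular graph with \<Delta> >= 3 is handled by estimating
   \<Delta> - \<lambda> from below along a path from a vertex of smaller degree to a maximal entry of x.

   Surface part. An embedded graph with e edges and n >= 3 vertices has e <= 3 n - 6 + 3 b, where
   b is the rank of H_1. This is proved without Euler's formula. An even edge set z defines a
   double cover of the surface whose sheets are exchanged across the edges of z. Its monodromy is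
   a homomorphism from H_1 to Z/2, for which there are 2^b possibilities, whereas there are at least
   2^(e - n + 1) even sets. If z and z' have the same monodromy, then the cover for their
   symmetric difference is trivial, which yields a two-colouring of the faces with colour changes
   exactly across that difference. So there are at least e - n + 2 - b faces. Every face is
   bordered by at least three edges, because the complement of at most two edges is connected,
   and every edge borders at most two faces. *)

theory Submission
  imports Defs "HOL-Analysis.Jordan_Curve" "HOL-Analysis.Smooth_Paths"
begin

section \<open>Sides of arcs\<close>

text \<open>The edges are merely continuous arcs, so no collars or triangulations are at hand. All
  local information comes from the plane through charts: an arc has exactly two sides at an interior
  point and one at a free end. Coverings are never built as spaces. A sheet over an open set is a
  Boolean function that jumps exactly across the chosen edges; exchanging the sheets is negation,
  and adding edge sets is exclusive or. Nothing is demanded of such a function at a vertex, because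
  deleting finitely many points does not disconnect a surface; the parity condition enters only
  through the existence of sheets near a vertex. A two-colouring of the faces and its complement
  give the same edge set, and this factor 2 turns e - n + 1 into e - n + 2. With 3 f <= 2 e for f
  faces this gives e <= 3 n - 6 + 3 b, where b = 0 for the plane and b = 2 g for genus g. On the
  spectral side k is an upper bound for the edge density of all vertex sets H; the corrections in
  1/n arise because a fixed deficit of edges is spread over at most n vertices.\<close>

definition join_within :: "'b topology \<Rightarrow> 'b set \<Rightarrow> 'b \<Rightarrow> 'b \<Rightarrow> bool" where
  "join_within S A x y \<longleftrightarrow> (\<exists>C. connectedin S C \<and> C \<subseteq> A \<and> x \<in> C \<and> y \<in> C)"

text \<open>Near each point of \<open>D \<inter> A\<close> the complement of \<open>A\<close> has exactly two local sides, told apart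
  by \<open>h\<close>.\<close>
definition two_sided :: "'b topology \<Rightarrow> 'b set \<Rightarrow> 'b set \<Rightarrow> ('b \<Rightarrow> bool) \<Rightarrow> bool" where
  "two_sided S A D h \<longleftrightarrow> openin S D \<and>
     (\<forall>r\<in>D - A. \<exists>W b. openin S W \<and> r \<in> W \<and> (\<forall>x\<in>W - A. h x = b)) \<and>
     (\<forall>r\<in>D \<inter> A. \<forall>W. openin S W \<and> r \<in> W \<longrightarrow>
        (\<exists>W'. openin S W' \<and> r \<in> W' \<and> W' \<subseteq> W \<and> (\<exists>x\<in>W' - A. h x) \<and> (\<exists>x\<in>W' - A. \<not> h x) \<and>
           (\<forall>x\<in>W' - A. \<forall>y\<in>W' - A. h x = h y \<longrightarrow> join_within S (W - A) x y)))"

text \<open>The situation at a free end of an arc. As in \<open>two_sided\<close>, points of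
  \<open>W'\<close> are joined only within the larger \<open>W\<close>; Janiszewski's theorem yields
  exactly this, without a neighbourhood that the arc cuts neatly.\<close>

definition one_sided :: "'b topology \<Rightarrow> 'b set \<Rightarrow> 'b \<Rightarrow> bool" where
  "one_sided S A r \<longleftrightarrow> (\<forall>W. openin S W \<and> r \<in> W \<longrightarrow>
     (\<exists>W'. openin S W' \<and> r \<in> W' \<and> W' \<subseteq> W \<and> (\<forall>x\<in>W' - A. \<forall>y\<in>W' - A. join_within S (W - A) x y)))"

lemma two_sidedI:
  assumes "openin S D"
    and "\<And>r. r \<in> D - A \<Longrightarrow> \<exists>W b. openin S W \<and> r \<in> W \<and> (\<forall>x\<in>W - A. h x = b)"
    and "\<And>r W. r \<in> D \<inter> A \<Longrightarrow> openin S W \<Longrightarrow> r \<in> W \<Longrightarrow>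
        \<exists>W'. openin S W' \<and> r \<in> W' \<and> W' \<subseteq> W \<and> (\<exists>x\<in>W' - A. h x) \<and> (\<exists>x\<in>W' - A. \<not> h x) \<and>
           (\<forall>x\<in>W' - A. \<forall>y\<in>W' - A. h x = h y \<longrightarrow> join_within S (W - A) x y)"
  shows "two_sided S A D h"
  unfolding two_sided_def
proof (intro conjI ballI allI impI)
  fix r assume "r \<in> D - A"
  then show "\<exists>W b. openin S W \<and> r \<in> W \<and> (\<forall>x\<in>W - A. h x = b)" by (rule assms(2))
next
  fix r W assume "r \<in> D \<inter> A" "openin S W \<and> r \<in> W"
  then show "\<exists>W'. openin S W' \<and> r \<in> W' \<and> W' \<subseteq> W \<and> (\<exists>x\<in>W' - A. h x) \<and> (\<exists>x\<in>W' - A. \<not> h x) \<and>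
           (\<forall>x\<in>W' - A. \<forall>y\<in>W' - A. h x = h y \<longrightarrow> join_within S (W - A) x y)"
    using assms(3)[of r W] by (elim conjE)
qed (rule assms(1))

lemma two_sidedD:
  assumes "two_sided S A D h"
  shows "openin S D"
    and "r \<in> D - A \<Longrightarrow> \<exists>W b. openin S W \<and> r \<in> W \<and> (\<forall>x\<in>W - A. h x = b)"
    and "r \<in> D \<inter> A \<Longrightarrow> openin S W \<Longrightarrow> r \<in> W \<Longrightarrow>
        \<exists>W'. openin S W' \<and> r \<in> W' \<and> W' \<subseteq> W \<and> (\<exists>x\<in>W' - A. h x) \<and> (\<exists>x\<in>W' - A. \<not> h x) \<and>
           (\<forall>x\<in>W' - A. \<forall>y\<in>W' - A. h x = h y \<longrightarrow> join_within S (W - A) x y)"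
proof -
  note conjs = assms[unfolded two_sided_def]
  show "openin S D" by (rule conjs[THEN conjunct1])
  show "r \<in> D - A \<Longrightarrow> \<exists>W b. openin S W \<and> r \<in> W \<and> (\<forall>x\<in>W - A. h x = b)"
    by (rule conjs[THEN conjunct2, THEN conjunct1, THEN bspec])
  show "r \<in> D \<inter> A \<Longrightarrow> openin S W \<Longrightarrow> r \<in> W \<Longrightarrow>
        \<exists>W'. openin S W' \<and> r \<in> W' \<and> W' \<subseteq> W \<and> (\<exists>x\<in>W' - A. h x) \<and> (\<exists>x\<in>W' - A. \<not> h x) \<and>
           (\<forall>x\<in>W' - A. \<forall>y\<in>W' - A. h x = h y \<longrightarrow> join_within S (W - A) x y)"
    by (rule conjs[THEN conjunct2, THEN conjunct2, THEN bspec, THEN spec, THEN mp, OF _ conjI])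
qed

lemma join_within_mono: "join_within S A x y \<Longrightarrow> A \<subseteq> B \<Longrightarrow> join_within S B x y"
  unfolding join_within_def by blast

lemma join_within_euclidean:
  "connected_component A x y \<Longrightarrow> join_within euclidean A x y"
  unfolding join_within_def connected_component_def by auto

text \<open>Sidedness depends only on the trace of the set near the point. In this way a statement
  about a subarc inside a chart passes to the whole arc and then to the whole drawing.\<close>

lemma two_sided_cong:
  assumes "two_sided S A D h" "openin S D'" "D' \<subseteq> D" "D' \<inter> X = D' \<inter> A"
  shows "two_sided S X D' h"
  unfolding two_sided_def
proof (intro conjI ballI allI impI)
  show "openin S D'" by fact
next
  fix r assume r: "r \<in> D' - X"
  then have "r \<in> D - A" using assms(3,4) by blast
  with assms(1) obtain W b where W: "openin S W" "r \<in> W" "\<forall>x\<in>W - A. h x = b"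
    unfolding two_sided_def by blast
  have "openin S (W \<inter> D')" "r \<in> W \<inter> D'" using W assms(2) r by auto
  moreover have "\<forall>x\<in>W \<inter> D' - X. h x = b"
    using W(3) assms(4) by blast
  ultimately show "\<exists>W b. openin S W \<and> r \<in> W \<and> (\<forall>x\<in>W - X. h x = b)" by blast
next
  fix r W assume r: "r \<in> D' \<inter> X" and W: "openin S W \<and> r \<in> W"
  have r': "r \<in> D \<inter> A" using r assms(3,4) by blast
  have W1: "openin S (W \<inter> D') \<and> r \<in> W \<inter> D'" using W r assms(2) by auto
  have "\<forall>r\<in>D \<inter> A. \<forall>W. openin S W \<and> r \<in> W \<longrightarrow>
        (\<exists>W'. openin S W' \<and> r \<in> W' \<and> W' \<subseteq> W \<and> (\<exists>x\<in>W' - A. h x) \<and> (\<exists>x\<in>W' - A. \<not> h x) \<and>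
           (\<forall>x\<in>W' - A. \<forall>y\<in>W' - A. h x = h y \<longrightarrow> join_within S (W - A) x y))"
    using assms(1) unfolding two_sided_def by blast
  from this[rule_format, OF r', OF W1]
  obtain W' where W': "openin S W'" "r \<in> W'" "W' \<subseteq> W \<inter> D'" "\<exists>x\<in>W' - A. h x" "\<exists>x\<in>W' - A. \<not> h x"
      "\<forall>x\<in>W' - A. \<forall>y\<in>W' - A. h x = h y \<longrightarrow> join_within S (W \<inter> D' - A) x y"
    by blast
  have eq: "W' - X = W' - A" using W'(3) assms(4) by blast
  have "W \<inter> D' - A \<subseteq> W - X" using assms(4) by blast
  then have "\<forall>x\<in>W' - X. \<forall>y\<in>W' - X. h x = h y \<longrightarrow> join_within S (W - X) x y"
    using W'(6) join_within_mono[OF _ \<open>W \<inter> D' - A \<subseteq> W - X\<close>] unfolding eq by simp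
  then show "\<exists>W'. openin S W' \<and> r \<in> W' \<and> W' \<subseteq> W \<and> (\<exists>x\<in>W' - X. h x) \<and> (\<exists>x\<in>W' - X. \<not> h x) \<and>
           (\<forall>x\<in>W' - X. \<forall>y\<in>W' - X. h x = h y \<longrightarrow> join_within S (W - X) x y)"
    using W' eq by (intro exI[of _ W']) auto
qed

lemma one_sided_cong:
  assumes "one_sided S A r" "openin S D" "r \<in> D" "D \<inter> X = D \<inter> A"
  shows "one_sided S X r"
  unfolding one_sided_def
proof (intro allI impI)
  fix W assume W: "openin S W \<and> r \<in> W"
  then have "openin S (W \<inter> D) \<and> r \<in> W \<inter> D" using assms by auto
  then obtain W' where W': "openin S W'" "r \<in> W'" "W' \<subseteq> W \<inter> D"
     "\<forall>x\<in>W' - A. \<forall>y\<in>W' - A. join_within S (W \<inter> D - A) x y"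
    using assms(1) unfolding one_sided_def by meson
  have eq: "W' - X = W' - A" and sub: "W \<inter> D - A \<subseteq> W - X" using W'(3) assms(4) by blast+
  have "\<forall>x\<in>W' - X. \<forall>y\<in>W' - X. join_within S (W - X) x y"
    using W'(4) join_within_mono[OF _ sub] unfolding eq by simp
  then show "\<exists>W'. openin S W' \<and> r \<in> W' \<and> W' \<subseteq> W \<and> (\<forall>x\<in>W' - X. \<forall>y\<in>W' - X. join_within S (W - X) x y)"
    using W' by blast
qed

section \<open>Transport of sides through a chart\<close>

context
  fixes S :: "'b topology" and T :: "'c topology" and U f f'
  assumes hom: "homeomorphic_maps (subtopology S U) T f f'" and U: "openin S U"
begin

lemma chart_open: "openin T Q \<Longrightarrow> openin S (f' ` Q)"
proof -
  assume Q: "openin T Q"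
  have "homeomorphic_map T (subtopology S U) f'"
    using hom homeomorphic_maps_map homeomorphic_maps_sym by blast
  then have "openin (subtopology S U) (f' ` Q)"
    using Q homeomorphic_map_openness_eq by metis
  then show ?thesis using U openin_trans_full by blast
qed

lemma chart_open':
  assumes "openin S Q" "Q \<subseteq> U"
  shows "openin T (f ` Q)"
proof -
  have "homeomorphic_map (subtopology S U) T f"
    using hom homeomorphic_maps_map by blast
  moreover have "openin (subtopology S U) Q"
    using assms U openin_open_subtopology by blast
  ultimately show ?thesis using homeomorphic_map_openness_eq by metis
qed

lemma chart_U: "U \<subseteq> topspace S" using U openin_subset by blast

lemma chart_inv: "x \<in> topspace T \<Longrightarrow> f (f' x) = x" "x \<in> topspace T \<Longrightarrow> f' x \<in> U"
  "y \<in> U \<Longrightarrow> f' (f y) = y" "y \<in> U \<Longrightarrow> f y \<in> topspace T"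
  using hom chart_U unfolding homeomorphic_maps_def continuous_map_def by auto

lemma chart_nbhd:
  assumes "openin S W" "f' q \<in> W" "q \<in> topspace T"
  shows "openin T (f ` (W \<inter> U)) \<and> q \<in> f ` (W \<inter> U)"
proof
  show "openin T (f ` (W \<inter> U))" using chart_open'[of "W \<inter> U"] assms(1) U by auto
  have "f' q \<in> W \<inter> U" using assms chart_inv(2) by simp
  then have "f (f' q) \<in> f ` (W \<inter> U)" by (rule imageI)
  then show "q \<in> f ` (W \<inter> U)" using chart_inv(1)[OF assms(3)] by simp
qed

lemma chart_join:
  assumes "join_within T A x y" shows "join_within S (f' ` A) (f' x) (f' y)"
proof -
  obtain C where C: "connectedin T C" "C \<subseteq> A" "x \<in> C" "y \<in> C"
    using assms unfolding join_within_def by blast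
  have "continuous_map T (subtopology S U) f'" using hom homeomorphic_maps_def by blast
  then have "connectedin S (f' ` C)"
    using C(1) connectedin_continuous_map_image connectedin_subtopology by blast
  then show ?thesis unfolding join_within_def using C by blast
qed

lemma chart_diff:
  assumes W: "W \<subseteq> U" and A: "A \<subseteq> topspace T"
  shows "f' ` (f ` W - A) \<subseteq> W - f' ` A"
proof
  fix z assume "z \<in> f' ` (f ` W - A)"
  then obtain w where w: "w \<in> W" "f w \<notin> A" "z = f' (f w)" by auto
  then have z: "z = w" using chart_inv(3) W by auto
  have "z \<noteq> f' a" if "a \<in> A" for a
  proof
    assume "z = f' a"
    then have "f w = a" using z chart_inv(1) that A by auto
    then show False using that w by simp
  qed
  then show "z \<in> W - f' ` A" using w z by auto
qed

lemma two_sided_chart_on: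
  assumes q: "q \<in> topspace T" and A: "A \<subseteq> topspace T"
    and ts: "\<And>W. openin T W \<Longrightarrow> q \<in> W \<Longrightarrow>
        (\<exists>W'. openin T W' \<and> q \<in> W' \<and> W' \<subseteq> W \<and> (\<exists>x\<in>W' - A. h x) \<and> (\<exists>x\<in>W' - A. \<not> h x) \<and>
           (\<forall>x\<in>W' - A. \<forall>y\<in>W' - A. h x = h y \<longrightarrow> join_within T (W - A) x y))"
    and W0: "openin S W" "f' q \<in> W"
  shows "\<exists>W'. openin S W' \<and> f' q \<in> W' \<and> W' \<subseteq> W \<and>
            (\<exists>x\<in>W' - f' ` A. h (f x)) \<and> (\<exists>x\<in>W' - f' ` A. \<not> h (f x)) \<and>
            (\<forall>x\<in>W' - f' ` A. \<forall>y\<in>W' - f' ` A. h (f x) = h (f y) \<longrightarrow> join_within S (W - f' ` A) x y)"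
proof -
  have W: "openin T (f ` (W \<inter> U))" "q \<in> f ` (W \<inter> U)"
    using chart_nbhd[OF W0 q] by auto
  from ts[OF W]
  obtain W' where W': "openin T W'" "q \<in> W'" "W' \<subseteq> f ` (W \<inter> U)" "\<exists>x\<in>W' - A. h x" "\<exists>x\<in>W' - A. \<not> h x"
    and J: "\<forall>x\<in>W' - A. \<forall>y\<in>W' - A. h x = h y \<longrightarrow> join_within T (f ` (W \<inter> U) - A) x y"
    by auto
  have W't: "W' \<subseteq> topspace T" using W'(1) by (rule openin_subset)
  have sub: "f' ` (f ` (W \<inter> U) - A) \<subseteq> W - f' ` A"
    using chart_diff[of "W \<inter> U" A] A by auto
  have J': "join_within S (W - f' ` A) x y"
    if xy: "x \<in> f' ` W' - f' ` A" "y \<in> f' ` W' - f' ` A" "h (f x) = h (f y)" for x y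
  proof -
    obtain x' where x': "x' \<in> W' - A" "x = f' x'" using xy(1) by auto
    obtain y' where y': "y' \<in> W' - A" "y = f' y'" using xy(2) by auto
    have "h x' = h y'" using xy(3) chart_inv(1) W't x' y' by (auto simp: subset_iff)
    then have "join_within T (f ` (W \<inter> U) - A) x' y'" using J x' y' by auto
    from join_within_mono[OF chart_join[OF this] sub] show ?thesis using x' y' by simp
  qed
  have in1: "f' x \<in> f' ` W' - f' ` A" if "x \<in> W' - A" for x
  proof -
    have xt: "x \<in> topspace T" using that W't by auto
    have "f' x \<noteq> f' a" if "a \<in> A" for a
    proof
      assume "f' x = f' a"
      then have "f (f' x) = f (f' a)" by simp
      then have "x = a" using chart_inv(1)[of x] chart_inv(1)[of a] xt that A by auto
      then show False using \<open>x \<in> W' - A\<close> that by simp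
    qed
    then show ?thesis using that by auto
  qed
  have in2: "f (f' x) = x" if "x \<in> W' - A" for x
    using that W't chart_inv(1) by auto
  obtain x1 where x1: "x1 \<in> W' - A" "h x1" using W'(4) by auto
  obtain x2 where x2: "x2 \<in> W' - A" "\<not> h x2" using W'(5) by auto
  have ex1: "\<exists>x\<in>f' ` W' - f' ` A. h (f x)"
    by (rule bexI[of _ "f' x1"]) (use x1 in1 in2 in auto)
  have ex2: "\<exists>x\<in>f' ` W' - f' ` A. \<not> h (f x)"
    by (rule bexI[of _ "f' x2"]) (use x2 in1 in2 in auto)
  have "f' ` W' \<subseteq> W"
  proof
    fix z assume "z \<in> f' ` W'"
    then obtain w where "w \<in> W \<inter> U" "z = f' (f w)" using W'(3) by auto
    then show "z \<in> W" using chart_inv(3) by auto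
  qed
  then show ?thesis
    using W'(2) ex1 ex2 J' chart_open[OF W'(1)] by (intro exI[of _ "f' ` W'"]) auto
qed

lemma two_sided_chart:
  assumes ts: "two_sided T A D h" and A: "A \<subseteq> topspace T"
  shows "two_sided S (f' ` A) (f' ` D) (\<lambda>x. h (f x))"
proof -
  have D: "openin T D" by (rule two_sidedD(1)[OF ts])
  then have Dt: "D \<subseteq> topspace T" by (rule openin_subset)
  have 1: "\<exists>W b. openin S W \<and> r \<in> W \<and> (\<forall>x\<in>W - f' ` A. h (f x) = b)"
    if r: "r \<in> f' ` D - f' ` A" for r
  proof -
    obtain q where qD: "r = f' q" "q \<in> D" using DiffD1[OF r] by (rule imageE)
    have "q \<notin> A" using DiffD2[OF r, unfolded qD(1)] imageI[of q A f'] by argo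
    with qD(2) have q: "q \<in> D - A" by (rule DiffI)
    from two_sidedD(2)[OF ts q] obtain W b where W: "openin T W" "q \<in> W" "\<forall>x\<in>W - A. h x = b"
      by (elim exE conjE) (rule that)
    have Wt: "W \<subseteq> topspace T" using W(1) by (rule openin_subset)
    have Wf: "h (f x) = b" if x: "x \<in> f' ` W - f' ` A" for x
    proof -
      obtain w where w: "x = f' w" "w \<in> W" using DiffD1[OF x] by (rule imageE)
      have "w \<notin> A" using DiffD2[OF x, unfolded w(1)] imageI[of w A f'] by argo
      with w(2) have "w \<in> W - A" by (rule DiffI)
      with W(3) have "h w = b" by (rule bspec)
      then show ?thesis unfolding w(1) chart_inv(1)[OF subsetD[OF Wt w(2)]] .
    qed
    have "r \<in> f' ` W" unfolding qD(1) using W(2) by (rule imageI)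
    then show ?thesis using chart_open[OF W(1)] Wf by (intro exI conjI ballI)
  qed
  have 2: "\<exists>W'. openin S W' \<and> r \<in> W' \<and> W' \<subseteq> W \<and>
            (\<exists>x\<in>W' - f' ` A. h (f x)) \<and> (\<exists>x\<in>W' - f' ` A. \<not> h (f x)) \<and>
            (\<forall>x\<in>W' - f' ` A. \<forall>y\<in>W' - f' ` A. h (f x) = h (f y) \<longrightarrow> join_within S (W - f' ` A) x y)"
    if r: "r \<in> f' ` D \<inter> f' ` A" and W0: "openin S W" "r \<in> W" for r W
  proof -
    obtain q where q: "r = f' q" "q \<in> D" using IntD1[OF r] by (rule imageE)
    obtain q' where q': "r = f' q'" "q' \<in> A" using IntD2[OF r] by (rule imageE)
    have "f (f' q) = f (f' q')" unfolding q(1)[symmetric] q'(1)[symmetric] by (rule refl)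
    then have "q = q'"
      unfolding chart_inv(1)[OF subsetD[OF A q'(2)]] chart_inv(1)[OF subsetD[OF Dt q(2)]] .
    with q(2) q'(2) have qDA: "q \<in> D \<inter> A" by simp
    have "q \<in> topspace T" by (rule subsetD[OF Dt q(2)])
    from W0(2) have W0': "f' q \<in> W" unfolding q(1) .
    show ?thesis
      unfolding \<open>r = f' q\<close>
      by (rule two_sided_chart_on[OF \<open>q \<in> topspace T\<close> A two_sidedD(3)[OF ts qDA] W0(1) W0'])
  qed
  show ?thesis
    by (rule two_sidedI[OF chart_open[OF D] 1 2])
qed

lemma one_sided_chart:
  assumes os: "one_sided T A q" and A: "A \<subseteq> topspace T" and q: "q \<in> topspace T"
  shows "one_sided S (f' ` A) (f' q)"
  unfolding one_sided_def
proof (intro allI impI)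
  fix W assume W0: "openin S W \<and> f' q \<in> W"
  then have "openin T (f ` (W \<inter> U)) \<and> q \<in> f ` (W \<inter> U)"
    using chart_nbhd[OF _ _ q] by auto
  then obtain W' where W': "openin T W'" "q \<in> W'" "W' \<subseteq> f ` (W \<inter> U)"
    and J: "\<And>x y. x \<in> W' - A \<Longrightarrow> y\<in>W' - A \<Longrightarrow> join_within T (f ` (W \<inter> U) - A) x y"
    using os unfolding one_sided_def by meson
  have sub: "f' ` (f ` (W \<inter> U) - A) \<subseteq> W - f' ` A"
    using chart_diff[of "W \<inter> U" A] A by blast
  have "join_within S (W - f' ` A) x y" if xy: "x \<in> f' ` W' - f' ` A" "y \<in> f' ` W' - f' ` A" for x y
  proof -
    obtain x' y' where *: "x' \<in> W' - A" "x = f' x'" "y' \<in> W' - A" "y = f' y'" using xy by auto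
    show ?thesis using join_within_mono[OF chart_join[OF J[OF *(1,3)]] sub] * by simp
  qed
  moreover have "f' ` W' \<subseteq> W"
  proof
    fix z assume "z \<in> f' ` W'"
    then obtain w where "w \<in> W \<inter> U" "z = f' (f w)" using W'(3) by auto
    then show "z \<in> W" using chart_inv(3) by auto
  qed
  ultimately show "\<exists>W'. openin S W' \<and> f' q \<in> W' \<and> W' \<subseteq> W \<and>
      (\<forall>x\<in>W' - f' ` A. \<forall>y\<in>W' - f' ` A. join_within S (W - f' ` A) x y)"
    using W' chart_open[OF W'(1)] by (intro exI[of _ "f' ` W'"]) blast
qed

end

text \<open>Janiszewski's theorem, applied to \<open>C\<close> and the union of \<open>\<beta>\<close> with the complement of \<open>W\<close>,
  gives local connectivity of the complement of a curve at its points.\<close>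
lemma locally_connected_off_curve:
  fixes C \<beta> W :: "complex set"
  assumes C: "compact C" and \<beta>: "closed \<beta>" "connected \<beta>" "\<beta> \<subseteq> C" and W: "open W" "C - \<beta> \<subseteq> W"
    and r: "r \<in> W" "r \<notin> \<beta>"
  obtains W' where "open W'" "r \<in> W'" "W' \<subseteq> W"
    "\<And>x y. x \<in> W' - C \<Longrightarrow> y \<in> W' - C \<Longrightarrow> connected_component (- C) x y \<Longrightarrow> connected_component (W - C) x y"
proof -
  have "open (W - \<beta>)" "r \<in> W - \<beta>" using W \<beta> r by auto
  then obtain e where e: "e > 0" "ball r e \<subseteq> W - \<beta>" by (meson open_contains_ball)
  show thesis
  proof (rule that[of "ball r e"])
    show "open (ball r e)" "r \<in> ball r e" "ball r e \<subseteq> W" using e by auto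
    fix x y assume xy: "x \<in> ball r e - C" "y \<in> ball r e - C" and cc: "connected_component (- C) x y"
    \<comment> \<open>With the complement of \<open>W\<close> included, a connection that avoids
      \<open>C\<close> and \<open>?T\<close> automatically stays in \<open>W\<close>. The
      intersection with \<open>C\<close> is still the connected set \<beta>, as Janiszewski's
      theorem demands.\<close>
    let ?T = "\<beta> \<union> - W"
    have "closed_segment x y \<subseteq> ball r e"
      using xy by (simp add: closed_segment_subset)
    then have "closed_segment x y \<subseteq> - ?T" using e by auto
    then have "connected_component (- ?T) x y"
      unfolding connected_component_def using connected_segment by (metis ends_in_segment)
    moreover have "C \<inter> ?T = \<beta>" using \<beta> W by auto
    moreover have "closed ?T" using \<beta> W by auto
    ultimately have "connected_component (- (C \<union> ?T)) x y"
      using Janiszewski[OF C, of ?T x y] \<beta> cc by auto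
    then show "connected_component (W - C) x y"
      by (rule connected_component_of_subset) auto
  qed
qed

section \<open>Arcs in the plane\<close>

lemma arc_interval_nbhd:
  fixes g :: "real \<Rightarrow> 'a::t2_space"
  assumes g: "continuous_on {0..1} g" and s: "s \<in> {0..1}" "g s \<in> W" "open W"
  obtains d where "d > 0" "\<And>u. u \<in> {0..1} \<Longrightarrow> \<bar>u - s\<bar> < d \<Longrightarrow> g u \<in> W"
proof -
  have "openin (top_of_set {0..1}) ({0..1} \<inter> g -` W)"
    using g s continuous_openin_preimage_gen by blast
  then have "\<exists>d>0. ball s d \<inter> {0..1} \<subseteq> {0..1} \<inter> g -` W"
    using s by (auto simp: openin_contains_ball)
  then obtain d where "d > 0" "ball s d \<inter> {0..1} \<subseteq> {0..1} \<inter> g -` W" by blast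
  then show thesis using that[of d] by (auto simp: dist_real_def subset_iff abs_minus_commute)
qed

text \<open>A disc inside the arc stays connected when a point \<open>g m\<close> is deleted. But
  the deletion splits the arc into two relatively closed pieces, and both meet the disc if
  \<open>m\<close> lies strictly between the parameters of two of its points.\<close>

lemma interior_arc_image:
  fixes g :: "real \<Rightarrow> complex"
  assumes "arc g"
  shows "interior (path_image g) = {}"
proof (rule ccontr)
  assume "interior (path_image g) \<noteq> {}"
  then obtain q where "q \<in> interior (path_image g)" by blast
  then obtain e where e: "e > 0" "ball q e \<subseteq> path_image g" using mem_interior by blast
  have cg: "continuous_on {0..1} g" and inj: "inj_on g {0..1}"
    using assms unfolding arc_def path_def by auto
  obtain s where s: "s \<in> {0..1}" "g s = q" proof -
    have "q \<in> path_image g" using e by auto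
    then show ?thesis using that by (auto simp: path_image_def)
  qed
  obtain d where d: "d > 0" "\<And>u. u \<in> {0..1} \<Longrightarrow> \<bar>u - s\<bar> < d \<Longrightarrow> g u \<in> ball q e"
    using arc_interval_nbhd[OF cg s(1), of "ball q e"] s e by auto
  \<comment> \<open>The parameter \<open>s\<close> may be an end of the unit interval, so the
    subinterval is taken on a side where there is room.\<close>
  obtain a b where ab: "a < b" "{a..b} \<subseteq> {0..1}" "\<And>u. u \<in> {a..b} \<Longrightarrow> \<bar>u - s\<bar> < d"
  proof (cases "s < 1")
    case True
    then show ?thesis using that[of s "min 1 (s + d/2)"] d s by (auto simp: min_def split: if_splits)
  next
    case False
    then show ?thesis using that[of "max 0 (s - d/2)" s] d s by (auto simp: max_def split: if_splits)
  qed
  define m where "m = (a + b) / 2"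
  have m: "a < m" "m < b" using ab unfolding m_def by auto
  have m01: "m \<in> {0..1}" using ab(2) m by (auto intro!: subsetD[OF ab(2)])
  then have m: "a < m" "m < b" "m \<in> {0..1}" using m by auto
  have ab01: "a \<in> {0..1}" "b \<in> {0..1}" using ab(1,2) by auto
  have gin: "g a \<in> ball q e" "g b \<in> ball q e"
    using d(2)[OF ab01(1) ab(3)] d(2)[OF ab01(2) ab(3)] ab(1) by auto
  have con: "connected (ball q e - {g m})"
    by (rule connected_open_delete) auto
  have c1: "closed (g ` {0..m})" "closed (g ` {m..1})"
    using m by (auto intro!: compact_imp_closed compact_continuous_image continuous_on_subset[OF cg])
  have "g ` {0..m} \<inter> g ` {m..1} \<inter> (ball q e - {g m}) = {}"
  proof -
    have "z = g m" if z: "z \<in> g ` {0..m}" "z \<in> g ` {m..1}" for z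
    proof -
      obtain x y where xy: "z = g x" "x \<in> {0..m}" "z = g y" "y \<in> {m..1}" using z by (elim imageE)
      then have "x \<in> {0..1}" "y \<in> {0..1}" using m by auto
      with xy have "x = y" using inj_onD[OF inj] by metis
      then have "x = m" using xy by simp
      then show ?thesis using xy(1) by simp
    qed
    then show ?thesis by blast
  qed
  moreover have "ball q e - {g m} \<subseteq> g ` {0..m} \<union> g ` {m..1}"
  proof -
    have "{0..1} \<subseteq> {0..m} \<union> {m..1}" by auto
    then have "path_image g \<subseteq> g ` {0..m} \<union> g ` {m..1}"
      unfolding path_image_def by blast
    then show ?thesis using e(2) by blast
  qed
  ultimately have "g ` {0..m} \<inter> (ball q e - {g m}) = {} \<or> g ` {m..1} \<inter> (ball q e - {g m}) = {}"
    by (rule connected_closedD[OF con _ _ c1])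
  moreover have "g a \<in> g ` {0..m}" "g b \<in> g ` {m..1}" using m ab01 by auto
  moreover have "g a \<noteq> g m" "g b \<noteq> g m"
    using inj_onD[OF inj _ ab01(1) m(3)] inj_onD[OF inj _ ab01(2) m(3)] m by auto
  ultimately show False using gin by blast
qed


text \<open>A cross-cut \<beta> in the complement, from a point before \<open>g t\<close> to a point
  after it, closes the subarc in between to a Jordan curve, whose inside and outside are the two
  sides. The cross-cut exists because the complement of an arc is connected and accessible points
  are dense in its frontier.\<close>

lemma two_sided_plane_arc:
  fixes g :: "real \<Rightarrow> complex"
  assumes g: "arc g" and t: "0 < t" "t < 1"
  obtains D h where "g t \<in> D" "two_sided euclidean (path_image g) D h" "D \<inter> path_image g \<subseteq> g ` {0<..<1}"
proof -
  let ?A = "path_image g"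
  have cg: "continuous_on {0..1} g" and inj: "inj_on g {0..1}"
    using g unfolding arc_def path_def by auto
  have injD: "\<And>x y. x \<in> {0..1} \<Longrightarrow> y \<in> {0..1} \<Longrightarrow> g x = g y \<Longrightarrow> x = y"
    using inj by (auto simp: inj_on_def)
  have clg: "closed (g ` {a..b})" if "0 \<le> a" "b \<le> 1" for a b
    using that by (auto intro!: compact_imp_closed compact_continuous_image continuous_on_subset[OF cg])
  have clA: "closed ?A" using g closed_arc_image by blast
  \<comment> \<open>Thus relatively open pieces of the arc are open in the frontier, and the
    cross-cut can be made to end in prescribed pieces on either side of \<open>t\<close>.\<close>
  have fr: "frontier (- ?A) = ?A"
    using interior_arc_image[OF g] clA by (auto simp: frontier_def closure_complement interior_complement)
  have opn: "openin (top_of_set (frontier (- ?A))) (g ` {a<..<b})" if "0 \<le> a" "b \<le> 1" "a < b" for a b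
  proof -
    have "g ` {a<..<b} = ?A - (g ` {0..a} \<union> g ` {b..1})"
    proof (intro equalityI subsetI)
      fix x assume "x \<in> g ` {a<..<b}"
      then obtain u where u: "u \<in> {a<..<b}" "x = g u" by blast
      have "x \<notin> g ` {0..a} \<union> g ` {b..1}"
      proof
        assume "x \<in> g ` {0..a} \<union> g ` {b..1}"
        then obtain v where "x = g v" "v \<in> {0..a} \<union> {b..1}" unfolding image_Un[symmetric] by (rule imageE)
        then have "v \<in> {0..a} \<union> {b..1}" "g u = g v" using u(2) by simp_all
        then show False using injD[of u v] u(1) that by auto
      qed
      then show "x \<in> ?A - (g ` {0..a} \<union> g ` {b..1})"
        using u that by (auto simp: path_image_def)
    next
      fix x assume x: "x \<in> ?A - (g ` {0..a} \<union> g ` {b..1})"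
      then obtain u where u: "x = g u" "u \<in> {0..1}" unfolding path_image_def by (elim DiffE imageE)
      have "u \<notin> {0..a}" "u \<notin> {b..1}" using x unfolding u(1) by blast+
      then have "u \<in> {a<..<b}" using u(2) by simp
      then show "x \<in> g ` {a<..<b}" unfolding u(1) by (rule imageI)
    qed
    moreover have "closed (g ` {0..a} \<union> g ` {b..1})" using that clg[of 0 a] clg[of b 1]
      by (intro closed_Un) auto
    ultimately show ?thesis unfolding fr
      by (metis Diff_eq open_Compl openin_open_Int)
  qed
  obtain \<beta> where \<beta>: "arc \<beta>" "pathstart \<beta> \<in> g ` {0<..<t}" "pathfinish \<beta> \<in> g ` {t<..<1}"
      "\<beta> ` {0<..<1} \<subseteq> - ?A"
  proof (rule dense_accessible_frontier_point_pairs[of "- ?A" "g ` {0<..<t}" "g ` {t<..<1}"])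
    show "open (- ?A)" using clA by auto
    show "connected (- ?A)" using connected_arc_complement[OF g] by simp
    show "openin (top_of_set (frontier (- ?A))) (g ` {0<..<t})" using opn t by auto
    show "openin (top_of_set (frontier (- ?A))) (g ` {t<..<1})" using opn t by auto
    have "g (t/2) \<in> g ` {0<..<t}" using t by (intro imageI) simp
    moreover have "g (t/2) \<notin> g ` {t<..<1}"
    proof
      assume "g (t/2) \<in> g ` {t<..<1}"
      then obtain v where "g (t/2) = g v" "v \<in> {t<..<1}" by (rule imageE)
      then show False using injD[of "t/2" v] t by auto
    qed
    ultimately    show "g ` {0<..<t} \<noteq> g ` {t<..<1}" by blast
  qed (use t in auto)
  obtain s1 s2 where s: "0 < s1" "s1 < t" "pathstart \<beta> = g s1" "t < s2" "s2 < 1" "pathfinish \<beta> = g s2"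
    using \<beta> by auto
  have \<beta>im: "path_image \<beta> = \<beta> ` {0<..<1} \<union> {g s1, g s2}"
  proof -
    have "{0..1::real} = {0<..<1} \<union> {0,1}" by auto
    then show ?thesis unfolding path_image_def using s by (auto simp: pathstart_def pathfinish_def)
  qed
  define c where "c = subpath s1 s2 g +++ reversepath \<beta>"
  have sub_im: "path_image (subpath s1 s2 g) = g ` {s1..s2}"
    using s by (simp add: path_image_subpath)
  have Cim: "path_image c = g ` {s1..s2} \<union> path_image \<beta>"
    unfolding c_def by (simp add: path_image_join s sub_im)
  have AC: "?A \<inter> path_image \<beta> = {g s1, g s2}"
    using \<beta>im \<beta>(4) s t by (auto simp: path_image_def)
  have sp: "simple_path c" "pathfinish c = pathstart c"
  proof -
    show "simple_path c" unfolding c_def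
    proof (rule simple_path_join_loop)
      show "arc (subpath s1 s2 g)"
        using g s t by (intro arc_subpath_arc) auto
      show "arc (reversepath \<beta>)" using \<beta> by (simp add: arc_reversepath)
      have "g ` {s1..s2} \<subseteq> ?A" using s t by (auto simp: path_image_def)
      then show "path_image (subpath s1 s2 g) \<inter> path_image (reversepath \<beta>) \<subseteq> {pathstart (subpath s1 s2 g), pathstart (reversepath \<beta>)}"
        using AC s sub_im by auto
    qed (use s in auto)
    show "pathfinish c = pathstart c" unfolding c_def using s by auto
  qed
  let ?C = "path_image c"
  note J = Jordan_inside_outside[OF sp]
  have Jop: "open (inside ?C)" "open (outside ?C)" and Jcon: "connected (inside ?C)" "connected (outside ?C)"
    and Jdis: "inside ?C \<inter> outside ?C = {}" and Jun: "inside ?C \<union> outside ?C = - ?C"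
    and Jfr: "frontier (inside ?C) = ?C" "frontier (outside ?C) = ?C"
    using J by argo+
  \<comment> \<open>On \<open>D\<close> the arc and the Jordan curve have the same trace, namely the
    open subarc between the ends of the cross-cut, so the sides of the curve are sides of the
    arc.\<close>
  define D where "D = - (path_image \<beta> \<union> g ` {0..s1} \<union> g ` {s2..1})"
  define h where "h = (\<lambda>x. x \<in> inside ?C)"
  have oD: "open D" unfolding D_def using clg[of 0 s1] clg[of s2 1] closed_arc_image[OF \<beta>(1)] s t by auto
  have DA: "D \<inter> ?A = g ` {s1<..<s2}"
  proof -
    have "g u \<notin> path_image \<beta>" if u: "u \<in> {s1<..<s2}" for u
    proof
      assume "g u \<in> path_image \<beta>"
      moreover have "g u \<in> ?A" using u s t by (auto simp: path_image_def)
      ultimately have "g u = g s1 \<or> g u = g s2" using AC by blast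
      then show False using injD[of u s1] injD[of u s2] u s t by auto
    qed
    moreover have "g u \<notin> g ` {0..s1} \<union> g ` {s2..1}" if u: "u \<in> {s1<..<s2}" for u
    proof
      assume "g u \<in> g ` {0..s1} \<union> g ` {s2..1}"
      then obtain v where "v \<in> {0..s1} \<union> {s2..1}" "g u = g v" by blast
      then show False using injD[of u v] u s t by auto
    qed
    moreover have "g u \<in> g ` {s1<..<s2}" if "u \<in> {0..1}" "g u \<notin> g ` {0..s1} \<union> g ` {s2..1}" for u
      using that by force
    moreover have "g ` {s1<..<s2} \<subseteq> ?A" using s t by (auto simp: path_image_def)
    moreover have "D \<inter> ?A \<subseteq> g ` {s1<..<s2}"
    proof
      fix x assume x: "x \<in> D \<inter> ?A"
      then obtain u where "x = g u" "u \<in> {0..1}" unfolding path_image_def by (elim IntE imageE)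
      moreover have "x \<notin> g ` {0..s1} \<union> g ` {s2..1}" using x unfolding D_def by simp
      ultimately show "x \<in> g ` {s1<..<s2}"
        using \<open>\<And>u. \<lbrakk>u \<in> {0..1}; g u \<notin> g ` {0..s1} \<union> g ` {s2..1}\<rbrakk> \<Longrightarrow> g u \<in> g ` {s1<..<s2}\<close> by simp
    qed
    moreover have "g ` {s1<..<s2} \<subseteq> D"
    proof
      fix x assume "x \<in> g ` {s1<..<s2}"
      then obtain u where u: "x = g u" "u \<in> {s1<..<s2}" by (rule imageE)
      show "x \<in> D" unfolding D_def u(1)
        using \<open>\<And>u. u \<in> {s1<..<s2} \<Longrightarrow> g u \<notin> path_image \<beta>\<close>[OF u(2)]
          \<open>\<And>u. u \<in> {s1<..<s2} \<Longrightarrow> g u \<notin> g ` {0..s1} \<union> g ` {s2..1}\<close>[OF u(2)] by simp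
    qed
    ultimately show ?thesis by (intro equalityI Int_greatest)
  qed
  have DC: "D \<inter> ?C = g ` {s1<..<s2}"
  proof -
    have "g ` {s1<..<s2} \<subseteq> ?C" using Cim by auto
    moreover have "D \<inter> ?C \<subseteq> ?A" using Cim s t unfolding D_def by (auto simp: path_image_def)
    ultimately show ?thesis using DA by blast
  qed
  have cC: "compact ?C" using sp compact_simple_path_image by blast
  have two: "two_sided euclidean ?A D h"
    unfolding two_sided_def
  proof (intro conjI ballI allI impI)
    show "openin euclidean D" using oD by simp
  next
    fix r assume "r \<in> D - ?A"
    then have "r \<in> D - ?C" using DA DC by blast
    then have "r \<in> inside ?C \<or> r \<in> outside ?C" using Jun by blast
    then show "\<exists>W b. openin euclidean W \<and> r \<in> W \<and> (\<forall>x\<in>W - ?A. h x = b)"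
    proof
      assume "r \<in> inside ?C"
      then show ?thesis using Jop by (intro exI[of _ "inside ?C"] exI[of _ True]) (simp add: h_def)
    next
      assume "r \<in> outside ?C"
      then show ?thesis using Jop Jdis by (intro exI[of _ "outside ?C"] exI[of _ False]) (unfold h_def, intro conjI, simp, assumption, blast)
    qed
  next
    fix r W assume "r \<in> D \<inter> ?A" and W: "openin euclidean W \<and> r \<in> W"
    then obtain u where u: "u \<in> {s1<..<s2}" "r = g u" using DA by auto
    define W0 where "W0 = W \<inter> D"
    have W0: "open W0" "r \<in> W0" "W0 \<subseteq> W" "W0 \<subseteq> D" using W \<open>r \<in> D \<inter> ?A\<close> oD unfolding W0_def by auto
    obtain d where d: "d > 0" "\<And>v. v \<in> {0..1} \<Longrightarrow> \<bar>v - u\<bar> < d \<Longrightarrow> g v \<in> W0"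
      using arc_interval_nbhd[OF cg, of u W0] u W0 s t by auto
    define a where "a = max s1 (u - d/2)"
    define b where "b = min s2 (u + d/2)"
    have ab: "s1 \<le> a" "a < u" "u < b" "b \<le> s2" and gab: "\<And>v. v \<in> {a<..<b} \<Longrightarrow> g v \<in> W0"
      using u d s t unfolding a_def b_def by (auto simp: max_def min_def split: if_splits)
    \<comment> \<open>The Jordan curve without a small subarc around \<open>r\<close>. It is
      connected because it runs through the cross-cut, and the omitted part lies in
      \<open>W0\<close>; so the localisation by Janiszewski's theorem applies.\<close>
    let ?B = "g ` {s1..a} \<union> path_image \<beta> \<union> g ` {b..s2}"
    have B: "closed ?B" using clg[of s1 a] clg[of b s2] closed_arc_image[OF \<beta>(1)] ab s t by auto
    have conB: "connected ?B"
    proof -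
      have "connected (g ` {s1..a})" "connected (g ` {b..s2})"
        using ab s t by (auto intro!: connected_continuous_image continuous_on_subset[OF cg])
      moreover have "connected (path_image \<beta>)" using \<beta> connected_arc_image by blast
      moreover have "g s1 \<in> g ` {s1..a} \<inter> path_image \<beta>" using ab \<beta>im by auto
      moreover have "g s2 \<in> (g ` {s1..a} \<union> path_image \<beta>) \<inter> g ` {b..s2}" using ab \<beta>im by auto
      ultimately show ?thesis by (metis connected_Un empty_iff)
    qed
    have BC: "?B \<subseteq> ?C" using Cim ab by auto
    have CB: "?C - ?B \<subseteq> W0" 
    proof
      fix x assume x: "x \<in> ?C - ?B"
      then obtain v where v: "v \<in> {s1..s2}" "x = g v" using Cim by auto
      then have "v \<in> {a<..<b}" using x by force
      then show "x \<in> W0" using gab v by blast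
    qed
    have rB: "r \<notin> ?B"
    proof
      assume "r \<in> ?B"
      moreover have "r \<notin> path_image \<beta>" using W0 unfolding D_def by auto
      ultimately have "r \<in> g ` ({s1..a} \<union> {b..s2})" unfolding image_Un by blast
      then obtain v where "r = g v" "v \<in> {s1..a} \<union> {b..s2}" by (rule imageE)
      then have "v \<in> {s1..a} \<union> {b..s2}" "g u = g v" using u by simp_all
      then show False using injD[of u v] u ab s t by auto
    qed
    obtain W' where W': "open W'" "r \<in> W'" "W' \<subseteq> W0" and
      cc: "\<And>x y. x \<in> W' - ?C \<Longrightarrow> y \<in> W' - ?C \<Longrightarrow> connected_component (- ?C) x y \<Longrightarrow> connected_component (W0 - ?C) x y"
      by (rule locally_connected_off_curve[OF cC B conB BC W0(1) CB W0(2) rB]) (rule that)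
    have rC: "r \<in> ?C" using DC u by auto
    have "D \<inter> ?A = D \<inter> ?C" using DA DC by simp
    then have "W' - ?A = W' - ?C" "W0 - ?C \<subseteq> W - ?A" using W'(3) W0(3,4) by blast+
    have join: "join_within euclidean (W - ?A) x y" if "x \<in> W' - ?A" "y \<in> W' - ?A" "h x = h y" for x y
    proof -
      have xy: "x \<in> W' - ?C" "y \<in> W' - ?C" using that \<open>W' - ?A = W' - ?C\<close> by auto
      have io: "inside ?C \<subseteq> - ?C" "outside ?C \<subseteq> - ?C" using Jun by blast+
      have "connected_component (- ?C) x y"
      proof (cases "h x")
        case True
        then have "x \<in> inside ?C" "y \<in> inside ?C" using that h_def by auto
        then show ?thesis unfolding connected_component_def using Jcon io by blast
      next
        case False
        then have "x \<in> outside ?C" "y \<in> outside ?C" using that(3) Jun xy unfolding h_def by blast+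
        then show ?thesis unfolding connected_component_def using Jcon io by blast
      qed
      then show ?thesis using cc xy \<open>W0 - ?C \<subseteq> W - ?A\<close> join_within_euclidean join_within_mono by metis
    qed
    have "r \<in> closure (inside ?C)" "r \<in> closure (outside ?C)"
      using Jfr rC unfolding frontier_def by blast+
    then have "W' \<inter> inside ?C \<noteq> {}" "W' \<inter> outside ?C \<noteq> {}"
      using W' open_Int_closure_eq_empty by blast+
    then have "(\<exists>x\<in>W' - ?C. h x) \<and> (\<exists>x\<in>W' - ?C. \<not> h x)"
      using Jun Jdis unfolding h_def by blast
    then show "\<exists>W'. openin euclidean W' \<and> r \<in> W' \<and> W' \<subseteq> W \<and> (\<exists>x\<in>W' - ?A. h x) \<and>
         (\<exists>x\<in>W' - ?A. \<not> h x) \<and>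
         (\<forall>x\<in>W' - ?A. \<forall>y\<in>W' - ?A. h x = h y \<longrightarrow> join_within euclidean (W - ?A) x y)"
      using W' W0 join \<open>W' - ?A = W' - ?C\<close> by (intro exI[of _ W']) auto
  qed
  show thesis
  proof (rule that[OF _ two])
    have "g t \<in> g ` {s1<..<s2}" using s by auto
    then show "g t \<in> D" using DA by blast
    show "D \<inter> ?A \<subseteq> g ` {0<..<1}" using DA s t by auto
  qed
qed

text \<open>An arc does not separate the plane, so any two points off it can be joined globally.
  Without a short initial piece the arc is still connected, and the joining can be localised near
  \<open>g 0\<close>.\<close>

lemma one_sided_plane_arc:
  fixes g :: "real \<Rightarrow> complex"
  assumes g: "arc g"
  shows "one_sided euclidean (path_image g) (g 0)"
  unfolding one_sided_def
proof (intro allI impI)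
  let ?A = "path_image g"
  have cg: "continuous_on {0..1} g" and inj: "inj_on g {0..1}"
    using g unfolding arc_def path_def by auto
  have injD: "\<And>x y. x \<in> {0..1} \<Longrightarrow> y \<in> {0..1} \<Longrightarrow> g x = g y \<Longrightarrow> x = y"
    using inj by (auto simp: inj_on_def)
  fix W assume W: "openin euclidean W \<and> g 0 \<in> W"
  then have oW: "open W" by simp
  obtain d where d: "d > 0" "\<And>v. v \<in> {0..1} \<Longrightarrow> \<bar>v - 0\<bar> < d \<Longrightarrow> g v \<in> W"
    using arc_interval_nbhd[OF cg, of 0 W] W by auto
  define b where "b = min 1 (d/2)"
  have b: "0 < b" "b \<le> 1" and gb: "\<And>v. v \<in> {0..<b} \<Longrightarrow> g v \<in> W"
    using d unfolding b_def by (auto simp: min_def split: if_splits)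
  let ?B = "g ` {b..1}"
  have cA: "compact ?A" using g compact_arc_image by blast
  have clB: "closed ?B" "connected ?B"
    using b by (auto intro!: connected_continuous_image compact_imp_closed compact_continuous_image continuous_on_subset[OF cg])
  have BA: "?B \<subseteq> ?A" using b by (auto simp: path_image_def)
  have AB: "?A - ?B \<subseteq> W" unfolding path_image_def using gb by force
  have gW: "g 0 \<in> W" using W by auto
  have gB: "g 0 \<notin> ?B"
  proof
    assume "g 0 \<in> ?B"
    then obtain v where "v \<in> {b..1}" "g 0 = g v" by blast
    then show False using injD[of 0 v] b by auto
  qed
  obtain W' where W': "open W'" "g 0 \<in> W'" "W' \<subseteq> W" and
      cc: "\<And>x y. x \<in> W' - ?A \<Longrightarrow> y \<in> W' - ?A \<Longrightarrow> connected_component (- ?A) x y \<Longrightarrow> connected_component (W - ?A) x y"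
    by (rule locally_connected_off_curve[OF cA clB BA oW AB gW gB]) (rule that)
  have "connected_component (- ?A) x y" if "x \<notin> ?A" "y \<notin> ?A" for x y
    using connected_arc_complement[OF g] that unfolding connected_component_def by (metis ComplI DIM_complex order_refl)
  then have "\<forall>x\<in>W' - ?A. \<forall>y\<in>W' - ?A. join_within euclidean (W - ?A) x y"
    using cc join_within_euclidean by (metis Diff_iff)
  then show "\<exists>W'. openin euclidean W' \<and> g 0 \<in> W' \<and> W' \<subseteq> W \<and>
      (\<forall>x\<in>W' - ?A. \<forall>y\<in>W' - ?A. join_within euclidean (W - ?A) x y)"
    using W' by auto
qed

section \<open>Surfaces\<close>

text \<open>General enough to contain the plane besides the closed surfaces, so that planar graphs
  become the case of trivial first homology.\<close>

locale surface =
  fixes S :: "'b topology"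
  assumes connected_S: "connected_space S" and Hausdorff_S: "Hausdorff_space S"
    and charts: "x \<in> topspace S \<Longrightarrow>
      \<exists>U. openin S U \<and> x \<in> U \<and> subtopology S U homeomorphic_space (euclidean :: complex topology)"
begin

lemma chart:
  assumes "x \<in> topspace S"
  obtains U f f' where "openin S U" "x \<in> U"
    "homeomorphic_maps (subtopology S U) (euclidean :: complex topology) f f'"
  using charts[OF assms] unfolding homeomorphic_space_def by blast

text \<open>The disc is the image of a round ball under a chart. Connectedness of the punctured disc
  is what makes vertices harmless later on.\<close>

lemma disc_nbhd:
  assumes W: "openin S W" "x \<in> W"
  obtains D where "openin S D" "x \<in> D" "D \<subseteq> W" "connectedin S D" "path_connectedin S D"
    "connectedin S (D - {x})" "D - {x} \<noteq> {}"
proof -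
  have xS: "x \<in> topspace S" using W openin_subset by blast
  obtain U and f :: "'b \<Rightarrow> complex" and f' where U: "openin S U" "x \<in> U"
    and h: "homeomorphic_maps (subtopology S U) euclidean f f'" using chart[OF xS] by blast
  note inv = chart_inv[OF h U(1)]
  have "openin euclidean (f ` (W \<inter> U))"
    by (rule chart_open'[OF h U(1)]) (use W U in auto)
  moreover have "f x \<in> f ` (W \<inter> U)" using W U by simp
  ultimately obtain e where e: "e > 0" "ball (f x) e \<subseteq> f ` (W \<inter> U)"
    by (metis open_contains_ball open_openin)
  let ?B = "ball (f x) e"
  have f'c: "continuous_map euclidean S f'"
    using h unfolding homeomorphic_maps_def by (metis continuous_map_in_subtopology)
  have f'x: "f' (f x) = x" using inv(3) U by blast
  have f'inj: "inj f'" by (metis UNIV_I inj_on_def inv(1) topspace_euclidean)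
  have eq: "f' ` ?B - {x} = f' ` (?B - {f x})"
    using f'x image_set_diff[OF f'inj, of ?B "{f x}"] by simp
  show thesis
  proof (rule that[of "f' ` ?B"])
    show "openin S (f' ` ?B)" by (rule chart_open[OF h U(1)]) auto
    show "x \<in> f' ` ?B" using e f'x by (metis centre_in_ball image_eqI)
    show "f' ` ?B \<subseteq> W"
    proof
      fix z assume "z \<in> f' ` ?B"
      then obtain w where "w \<in> W \<inter> U" "z = f' (f w)" using e(2) by auto
      then show "z \<in> W" using inv(3) by auto
    qed
    show "connectedin S (f' ` ?B)"
      by (rule connectedin_continuous_map_image[OF f'c]) simp
    show "path_connectedin S (f' ` ?B)"
      by (rule path_connectedin_continuous_map_image[OF f'c]) (simp add: path_connectedin_iff_path_connected_real convex_imp_path_connected)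
    show "connectedin S (f' ` ?B - {x})"
      unfolding eq by (rule connectedin_continuous_map_image[OF f'c]) (simp add: connected_open_delete)
    have "f x + of_real (e/2) \<in> ?B - {f x}" using e by (simp add: dist_norm)
    then show "f' ` ?B - {x} \<noteq> {}" unfolding eq by blast
  qed
qed

lemma open_Diff_finite:
  assumes "openin S W" "finite F"
  shows "openin S (W - F)"
proof -
  have "closedin S (F \<inter> topspace S)"
    using assms(2) Hausdorff_S Hausdorff_imp_t1_space t1_space_closedin_finite by blast
  moreover have "W - F = W - F \<inter> topspace S" using assms(1) openin_subset by blast
  ultimately show ?thesis using assms(1) by (metis openin_diff)
qed

lemma open_Diff_finite_nonempty:
  assumes "finite F" "openin S W" "W \<noteq> {}"
  shows "W - F \<noteq> {}"
  using assms
proof (induction F arbitrary: W)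
  case empty
  then show ?case by simp
next
  case (insert p F)
  have "W - {p} \<noteq> {}"
  proof (cases "p \<in> W")
    case True
    then obtain D where "p \<in> D" "D \<subseteq> W" "D - {p} \<noteq> {}" using disc_nbhd[OF insert.prems(1)] by metis
    then show ?thesis by blast
  next
    case False
    then show ?thesis using insert.prems by blast
  qed
  moreover have "openin S (W - {p})" using open_Diff_finite insert.prems by blast
  ultimately have "W - {p} - F \<noteq> {}" using insert.IH by blast
  then show ?case by blast
qed

text \<open>If \<open>W\<close> fell apart after deleting \<open>p\<close>, a punctured disc around
  \<open>p\<close> would lie in one of the two parts, being connected. Adding the whole disc to that
  part would then separate \<open>W\<close> itself.\<close>

lemma connectedin_delete:
  assumes W: "openin S W" "connectedin S W"
  shows "connectedin S (W - {p})"
proof (cases "p \<in> W")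
  case True
  obtain D where D: "openin S D" "p \<in> D" "D \<subseteq> W" "connectedin S (D - {p})"
    using disc_nbhd[OF W(1) True] by metis
  show ?thesis
  proof (rule ccontr)
    assume "\<not> ?thesis"
    then obtain E1 E2 where E: "openin S E1" "openin S E2" "W - {p} \<subseteq> E1 \<union> E2"
      "E1 \<inter> E2 \<inter> (W - {p}) = {}" "E1 \<inter> (W - {p}) \<noteq> {}" "E2 \<inter> (W - {p}) \<noteq> {}"
      unfolding connectedin using W openin_subset by blast
    have *: False if E: "openin S E1" "openin S E2" "W - {p} \<subseteq> E1 \<union> E2"
      "E1 \<inter> E2 \<inter> (W - {p}) = {}" "E1 \<inter> (W - {p}) \<noteq> {}" "E2 \<inter> (W - {p}) \<noteq> {}"
      and DE: "E2 \<inter> (D - {p}) = {}" for E1 E2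
    proof -
      let ?A = "(E1 \<inter> W - {p}) \<union> D" and ?B = "E2 \<inter> W - {p}"
      have "openin S ?A" "openin S ?B"
        using open_Diff_finite[of _ "{p}"] E W D by (simp_all add: openin_Int openin_Un)
      moreover have "W \<subseteq> ?A \<union> ?B" using E(3) D(2) by blast
      moreover have "?A \<inter> ?B \<inter> W = {}" using E(4) DE by blast
      moreover have "?A \<inter> W \<noteq> {}" "?B \<inter> W \<noteq> {}" using D E by blast+
      ultimately show False using connectedinD[OF W(2), of ?A ?B] by blast
    qed
    have "E1 \<inter> (D - {p}) = {} \<or> E2 \<inter> (D - {p}) = {}"
      using connectedinD[OF D(4) E(1,2)] E(3,4) D(3) by blast
    then show False
    proof
      assume "E2 \<inter> (D - {p}) = {}" then show False using *[OF E] by blast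
    next
      assume "E1 \<inter> (D - {p}) = {}" 
      then show False using *[OF E(2,1) _ _ E(6,5)] E(3,4) by (metis Int_commute Un_commute)
    qed
  qed
next
  case False
  then show ?thesis using W by simp
qed

lemma connectedin_Diff_finite:
  assumes "finite F" "openin S W" "connectedin S W"
  shows "connectedin S (W - F)"
  using assms
proof (induction F arbitrary: W)
  case empty
  then show ?case by simp
next
  case (insert p F)
  have "openin S (W - {p})" using open_Diff_finite insert.prems by blast
  moreover have "connectedin S (W - {p})" using connectedin_delete insert.prems by blast
  ultimately have "connectedin S (W - {p} - F)" by (rule insert.IH)
  then show ?case by (simp only: Diff_insert2[of W p F])
qed

lemma pathin_compactin:
  assumes "pathin S g" "a \<ge> 0" "b \<le> 1"
  shows "compactin S (g ` {a..b})"
proof (rule image_compactin)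
  show "continuous_map (subtopology euclideanreal {0..1}) S g" using assms(1) pathin_def by blast
  show "compactin (subtopology euclideanreal {0..1}) {a..b}"
    using assms by (auto simp: compactin_subtopology)
qed

lemma pathin_closedin:
  assumes "pathin S g" "a \<ge> 0" "b \<le> 1"
  shows "closedin S (g ` {a..b})"
  using compactin_imp_closedin[OF Hausdorff_S pathin_compactin[OF assms]] .

lemma pathin_connectedin:
  assumes "pathin S g" "T \<subseteq> {0..1}" "connected T"
  shows "connectedin S (g ` T)"
proof (rule connectedin_continuous_map_image)
  show "continuous_map (subtopology euclideanreal {0..1}) S g" using assms(1) pathin_def by blast
  show "connectedin (subtopology euclideanreal {0..1}) T"
    using assms by (auto simp: connectedin_subtopology)
qed

lemma pathin_nbhd:
  assumes g: "pathin S g" and t: "t \<in> {0..1}" "g t \<in> W" "openin S W"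
  obtains d where "d > 0" "\<And>u. u \<in> {0..1} \<Longrightarrow> \<bar>u - t\<bar> < d \<Longrightarrow> g u \<in> W"
proof -
  have "openin (top_of_set {0..1}) {u \<in> {0..1}. g u \<in> W}"
    using openin_continuous_map_preimage[of "top_of_set {0..1}" S g W] g t(3) unfolding pathin_def by simp
  then have "\<exists>d>0. ball t d \<inter> {0..1} \<subseteq> {u \<in> {0..1}. g u \<in> W}"
    using t unfolding openin_contains_ball by blast
  then obtain d where "d > 0" "ball t d \<inter> {0..1} \<subseteq> {u \<in> {0..1}. g u \<in> W}" by blast
  then show thesis using that[of d] by (auto simp: dist_real_def subset_iff abs_minus_commute)
qed

text \<open>By continuity an interval of parameters around \<open>t\<close> is mapped into a single
  chart; rescaled to the unit interval it gives a plane arc. The strict inequalities are conditional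
  so that the ends of the arc are covered as well.\<close>

lemma subarc_in_chart:
  assumes g: "pathin S g" "inj_on g {0..1}" and t: "t \<in> {0..1}"
  obtains a b U f f' where "0 \<le> a" "a \<le> t" "t \<le> b" "b \<le> 1" "a < b" "0 < t \<Longrightarrow> a < t" "t < 1 \<Longrightarrow> t < b"
    "openin S U" "homeomorphic_maps (subtopology S U) (euclidean :: complex topology) f f'"
    "arc (\<lambda>s. f (g (a + (b - a) * s)))"
    "f' ` path_image (\<lambda>s. f (g (a + (b - a) * s))) = g ` {a..b}"
    "\<And>s. s \<in> {0..1} \<Longrightarrow> f' (f (g (a + (b - a) * s))) = g (a + (b - a) * s)"
proof -
  have gt: "g t \<in> topspace S"
    using g t by (metis continuous_map_image_subset_topspace image_subset_iff pathin_def topspace_euclidean_subtopology)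
  obtain U and f :: "'b \<Rightarrow> complex" and f' where U: "openin S U" "g t \<in> U"
    and h: "homeomorphic_maps (subtopology S U) euclidean f f'" using chart[OF gt] by blast
  note inv = chart_inv[OF h U(1)]
  obtain d where d: "d > 0" "\<And>u. u \<in> {0..1} \<Longrightarrow> \<bar>u - t\<bar> < d \<Longrightarrow> g u \<in> U"
    using pathin_nbhd[OF g(1) t U(2) U(1)] by blast
  define a where "a = max 0 (t - d/2)"
  define b where "b = min 1 (t + d/2)"
  have ab: "0 \<le> a" "a \<le> t" "t \<le> b" "b \<le> 1" "a < b" "0 < t \<Longrightarrow> a < t" "t < 1 \<Longrightarrow> t < b"
    using d t unfolding a_def b_def by (auto simp: max_def min_def)
  have gU: "g u \<in> U" if "u \<in> {a..b}" for u
  proof (rule d(2))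
    show "u \<in> {0..1}" using that ab by auto
    show "\<bar>u - t\<bar> < d" using that d(1) unfolding a_def b_def by (auto simp: max_def min_def abs_if split: if_splits)
  qed
  define k where "k = (\<lambda>s. f (g (a + (b - a) * s)))"
  have im: "(\<lambda>s. a + (b - a) * s) ` {0..1} = {a..b}"
    using image_affinity_atLeastAtMost[of "b - a" a 0 1] ab by (simp add: add.commute)
  have mem: "a + (b - a) * s \<in> {a..b}" if "s \<in> {0..1}" for s
    unfolding im[symmetric] by (rule imageI[OF that])
  have fk: "f' (k s) = g (a + (b - a) * s)" if "s \<in> {0..1}" for s
    unfolding k_def using inv(3) gU im that by blast
  have "continuous_map (top_of_set {0..1}) (subtopology S U) (\<lambda>s. g (a + (b - a) * s))"
  proof (intro continuous_map_into_subtopology)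
    have "continuous_map (top_of_set {0..1}) (top_of_set {0..1}) (\<lambda>s. a + (b - a) * s)"
    proof (intro continuous_map_into_subtopology)
      have sub: "{a..b} \<subseteq> {0..1}" using ab by auto
      show "(\<lambda>s. a + (b - a) * s) \<in> topspace (top_of_set {0..1}) \<rightarrow> {0..1}"
      proof (rule Pi_I)
        fix s :: real assume "s \<in> topspace (top_of_set {0..1})"
        then have "s \<in> {0..1}" by simp
        from subsetD[OF sub mem[OF this]] show "a + (b - a) * s \<in> {0..1}" .
      qed
    qed (auto intro!: continuous_intros)
    from continuous_map_compose[OF this g(1)[unfolded pathin_def]]
    show "continuous_map (top_of_set {0..1}) S (\<lambda>s. g (a + (b - a) * s))" by (simp add: o_def)
    show "(\<lambda>s. g (a + (b - a) * s)) \<in> topspace (top_of_set {0..1}) \<rightarrow> U"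
      unfolding topspace_euclidean_subtopology by (intro Pi_I gU mem)
  qed
  then have "continuous_map (top_of_set {0..1}) euclidean k"
    using h continuous_map_compose[of _ _ _ _ f] unfolding k_def homeomorphic_maps_def o_def by blast
  then have "continuous_on {0..1} k" by simp
  moreover have "inj_on k {0..1}"
  proof (rule inj_onI)
    fix x y assume xy: "x \<in> {0..1}" "y \<in> {0..1}" "k x = k y"
    then have "g (a + (b - a) * x) = g (a + (b - a) * y)" using fk by metis
    moreover have "a + (b - a) * x \<in> {0..1}" "a + (b - a) * y \<in> {0..1}"
      using im xy ab by (metis atLeastatMost_subset_iff image_eqI subsetD)+
    ultimately have "a + (b - a) * x = a + (b - a) * y" using g(2) by (meson inj_onD)
    then show "x = y" using ab by simp
  qed
  ultimately have "arc k" unfolding arc_def path_def by blast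
  moreover have "f' ` path_image k = g ` {a..b}"
  proof -
    have "f' ` path_image k = (\<lambda>s. f' (k s)) ` {0..1}" unfolding path_image_def by (simp add: image_image)
    also have "\<dots> = (\<lambda>s. g (a + (b - a) * s)) ` {0..1}" using fk by (rule image_cong[OF refl])
    also have "\<dots> = g ` {a..b}" unfolding im[symmetric] by (simp add: image_image)
    finally show ?thesis .
  qed
  ultimately show thesis
    using that[OF ab U(1) h] fk unfolding k_def by blast
qed

lemma two_sided_arc:
  assumes g: "pathin S g" "inj_on g {0..1}" and t: "0 < t" "t < 1"
  obtains D h where "g t \<in> D" "two_sided S (g ` {0..1}) D h" "D \<inter> g ` {0..1} \<subseteq> g ` {0<..<1}"
proof -
  have t01: "t \<in> {0..1}" using t by auto
  obtain a b U and f :: "'b \<Rightarrow> complex" and f' where ab: "0 \<le> a" "b \<le> 1" "a < b" "a < t" "t < b"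
    and U: "openin S U" and h: "homeomorphic_maps (subtopology S U) euclidean f f'"
    and arc: "arc (\<lambda>s. f (g (a + (b - a) * s)))"
    and im: "f' ` path_image (\<lambda>s. f (g (a + (b - a) * s))) = g ` {a..b}"
    and inv: "\<And>s. s \<in> {0..1} \<Longrightarrow> f' (f (g (a + (b - a) * s))) = g (a + (b - a) * s)"
    using subarc_in_chart[OF g t01] t by metis
  let ?k = "\<lambda>s. f (g (a + (b - a) * s))"
  define s where "s = (t - a) / (b - a)"
  have s: "0 < s" "s < 1" "a + (b - a) * s = t" using ab unfolding s_def by auto
  obtain D h where D: "?k s \<in> D" "two_sided euclidean (path_image ?k) D h"
    by (rule two_sided_plane_arc[OF arc s(1,2)])
  have ts: "two_sided S (g ` {a..b}) (f' ` D) (\<lambda>x. h (f x))"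
    unfolding im[symmetric] by (rule two_sided_chart[OF _ U D(2)]) (use h in auto)
  \<comment> \<open>The parts of the arc beyond the subarc are closed and miss \<open>g t\<close>.
    Removing them makes the whole arc look like the subarc, and it also removes both end points of
    the arc.\<close>
  define D' where "D' = f' ` D - (g ` {0..a} \<union> g ` {b..1})"
  have gin: "g t \<in> f' ` D" using D(1) inv[of s] s by (metis atLeastAtMost_iff imageI less_imp_le)
  have injD: "\<And>u v. u \<in> {0..1} \<Longrightarrow> v \<in> {0..1} \<Longrightarrow> g u = g v \<Longrightarrow> u = v" using g(2) by (meson inj_onD)
  have "g t \<notin> g ` ({0..a} \<union> {b..1})"
  proof
    assume "g t \<in> g ` ({0..a} \<union> {b..1})"
    then obtain v where "g t = g v" "v \<in> {0..a} \<union> {b..1}" by (rule imageE)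
    then show False using injD[of t v] ab t01 by auto
  qed
  then have gD': "g t \<in> D'" using gin unfolding D'_def image_Un by simp
  have "openin S D'"
    unfolding D'_def using two_sidedD(1)[OF ts] pathin_closedin[OF g(1)] ab t by (intro openin_diff closedin_Un) auto
  moreover have "D' \<subseteq> f' ` D" unfolding D'_def by blast
  moreover have "{0..1} = {0..a} \<union> {a..b} \<union> {b..1}" using ab t by auto
  then have g01: "g ` {0..1} = g ` {0..a} \<union> g ` {a..b} \<union> g ` {b..1}" by (metis image_Un)
  then have "D' \<inter> g ` {0..1} = D' \<inter> g ` {a..b}" unfolding D'_def by blast
  ultimately have "two_sided S (g ` {0..1}) D' (\<lambda>x. h (f x))" by (rule two_sided_cong[OF ts])
  moreover have "D' \<inter> g ` {0..1} \<subseteq> g ` {0<..<1}"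
  proof -
    have "{0::real, 1} \<subseteq> {0..a} \<union> {b..1}" using ab by auto
    then have "g ` {0,1} \<subseteq> g ` {0..a} \<union> g ` {b..1}" by (metis image_Un image_mono)
    moreover have "{0..1} = {0<..<1} \<union> {0::real, 1}" by auto
    then have "g ` {0..1} = g ` {0<..<1} \<union> g ` {0,1}" by (metis image_Un)
    moreover have "(A - B) \<inter> C \<subseteq> I" if "F \<subseteq> B" "C = I \<union> F" for A B C F I :: "'b set"
      using that by blast
    ultimately show ?thesis unfolding D'_def by metis
  qed
  ultimately show thesis using that gD' by blast
qed

lemma one_sided_arc:
  assumes g: "pathin S g" "inj_on g {0..1}"
  shows "one_sided S (g ` {0..1}) (g 0)"
proof -
  obtain a b U and f :: "'b \<Rightarrow> complex" and f' where ab: "0 \<le> a" "a \<le> 0" "b \<le> 1" "a < b"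
    and U: "openin S U" and h: "homeomorphic_maps (subtopology S U) euclidean f f'"
    and arc: "arc (\<lambda>s. f (g (a + (b - a) * s)))"
    and im: "f' ` path_image (\<lambda>s. f (g (a + (b - a) * s))) = g ` {a..b}"
    and inv: "\<And>s. s \<in> {0..1} \<Longrightarrow> f' (f (g (a + (b - a) * s))) = g (a + (b - a) * s)"
    by (rule subarc_in_chart[OF g, of 0]) auto
  let ?k = "\<lambda>s. f (g (a + (b - a) * s))"
  have a: "a = 0" using ab by simp
  have "one_sided S (g ` {a..b}) (f' (?k 0))"
    unfolding im[symmetric] by (rule one_sided_chart[OF h U one_sided_plane_arc[OF arc]]) auto
  then have os: "one_sided S (g ` {0..b}) (g 0)" using inv[of 0] a by simp
  let ?D = "topspace S - g ` {b..1}"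
  have "g 0 \<in> topspace S" using g(1) path_start_in_topspace by blast
  moreover have "g 0 \<notin> g ` {b..1}"
  proof
    assume "g 0 \<in> g ` {b..1}"
    then obtain v where "g 0 = g v" "v \<in> {b..1}" by (rule imageE)
    then show False using inj_onD[OF g(2), of 0 v] ab a by auto
  qed
  ultimately have "g 0 \<in> ?D" by simp
  moreover have "openin S ?D" using pathin_closedin[OF g(1), of b 1] ab a by (simp add: openin_diff)
  moreover have "{0..1} = {0..b} \<union> {b..1}" using ab a by auto
  then have "g ` {0..1} = g ` {0..b} \<union> g ` {b..1}" by (metis image_Un)
  then have "?D \<inter> g ` {0..1} = ?D \<inter> g ` {0..b}" by blast
  ultimately show ?thesis using one_sided_cong[OF os] by blast
qed

end

section \<open>Embedded graphs\<close>

locale surface_graph = surface S for S :: "'b topology" +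
  fixes V :: "'a set" and E :: "'a set set" and p :: "'a \<Rightarrow> 'b" and \<gamma> :: "'a set \<Rightarrow> real \<Rightarrow> 'b"
  assumes graph: "simple_graph V E"
    and inj_p: "inj_on p V" and p_S: "p ` V \<subseteq> topspace S"
    and path_\<gamma>: "e \<in> E \<Longrightarrow> pathin S (\<gamma> e)" and inj_\<gamma>: "e \<in> E \<Longrightarrow> inj_on (\<gamma> e) {0..1}"
    and ends_\<gamma>: "e \<in> E \<Longrightarrow> {\<gamma> e 0, \<gamma> e 1} = p ` e"
    and inner_p: "e \<in> E \<Longrightarrow> \<gamma> e ` {0<..<1} \<inter> p ` V = {}"
    and inner_disjoint: "e \<in> E \<Longrightarrow> e' \<in> E \<Longrightarrow> e' \<noteq> e \<Longrightarrow> \<gamma> e ` {0<..<1} \<inter> \<gamma> e' ` {0<..<1} = {}"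
begin

definition inner :: "'a set \<Rightarrow> 'b set" where "inner e = \<gamma> e ` {0<..<1}"
definition X :: "'b set" where "X = p ` V \<union> (\<Union>e\<in>E. inner e)"

lemma finite_V: "finite V" and edge_sub: "e \<in> E \<Longrightarrow> e \<subseteq> V" and edge_card: "e \<in> E \<Longrightarrow> card e = 2"
  using graph unfolding simple_graph_def by blast+

lemma finite_E: "finite E"
proof -
  have "E \<subseteq> Pow V" using edge_sub by blast
  then show ?thesis using finite_V by (meson finite_Pow_iff finite_subset)
qed

lemma image_split: "e \<in> E \<Longrightarrow> \<gamma> e ` {0..1} = inner e \<union> p ` e"
proof -
  assume e: "e \<in> E"
  have "{0..1} = {0<..<1} \<union> {0::real, 1}" by auto
  then have "\<gamma> e ` {0..1} = \<gamma> e ` {0<..<1} \<union> \<gamma> e ` {0, 1}" by (metis image_Un)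
  then show ?thesis unfolding inner_def using ends_\<gamma>[OF e] by simp
qed

lemma closedin_arc: "e \<in> E \<Longrightarrow> closedin S (inner e \<union> p ` e)"
  using image_split pathin_closedin[OF path_\<gamma>, of e 0 1] by simp

lemma closedin_p: "F \<subseteq> V \<Longrightarrow> closedin S (p ` F)"
proof -
  assume "F \<subseteq> V"
  then have "finite (p ` F)" "p ` F \<subseteq> topspace S" using finite_V p_S by (auto intro: finite_subset)
  then show ?thesis
    using Hausdorff_S Hausdorff_imp_t1_space t1_space_closedin_finite by blast
qed

lemma closedin_subgraph:
  assumes "F \<subseteq> V" "z \<subseteq> E"
  shows "closedin S (p ` F \<union> (\<Union>e\<in>z. inner e \<union> p ` e))"
  using assms finite_E closedin_arc
  by (intro closedin_Un closedin_p closedin_Union) (auto intro: finite_subset)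

lemma X_eq: "X = p ` V \<union> (\<Union>e\<in>E. inner e \<union> p ` e)"
  unfolding X_def using edge_sub by blast

lemma closedin_X: "closedin S X"
  unfolding X_eq using closedin_subgraph[of V E] by simp

lemma inner_S: "e \<in> E \<Longrightarrow> inner e \<subseteq> topspace S"
  using closedin_arc closedin_subset by blast

lemma inner_X: "e \<in> E \<Longrightarrow> inner e \<subseteq> X" unfolding X_def by blast
lemma inner_not_p: "e \<in> E \<Longrightarrow> r \<in> inner e \<Longrightarrow> r \<notin> p ` V"
  unfolding inner_def using inner_p by blast
lemma inner_unique: "e \<in> E \<Longrightarrow> e' \<in> E \<Longrightarrow> r \<in> inner e \<Longrightarrow> r \<in> inner e' \<Longrightarrow> e = e'"
  unfolding inner_def using inner_disjoint by blast
lemma X_cases: "r \<in> X \<Longrightarrow> r \<notin> p ` V \<Longrightarrow> \<exists>e\<in>E. r \<in> inner e" unfolding X_def by blast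

lemma openin_avoid:
  assumes "F \<subseteq> V" "z \<subseteq> E" "openin S W"
  shows "openin S (W - (p ` F \<union> (\<Union>e\<in>z. inner e \<union> p ` e)))"
  using closedin_subgraph[OF assms(1,2)] assms(3) by (rule openin_diff[rotated])

text \<open>The vertices and the other closed edges form a closed set that misses \<open>r\<close>,
  so near \<open>r\<close> the drawing is just the arc of \<open>e\<close>.\<close>

lemma edge_two_sided:
  assumes e: "e \<in> E" and r: "r \<in> inner e"
  obtains D h where "r \<in> D" "two_sided S X D h" "D \<inter> X \<subseteq> inner e"
proof -
  obtain t where t: "r = \<gamma> e t" "0 < t" "t < 1" using r unfolding inner_def by auto
  obtain D h where D: "r \<in> D" "two_sided S (\<gamma> e ` {0..1}) D h" "D \<inter> \<gamma> e ` {0..1} \<subseteq> inner e"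
    using two_sided_arc[OF path_\<gamma>[OF e] inj_\<gamma>[OF e] t(2,3)] unfolding t(1) inner_def by metis
  define D' where "D' = D - (p ` V \<union> (\<Union>e\<in>E - {e}. inner e \<union> p ` e))"
  have "openin S D'" unfolding D'_def using two_sidedD(1)[OF D(2)] by (intro openin_avoid) auto
  moreover have "D' \<subseteq> D" unfolding D'_def by blast
  moreover have "D' \<inter> X \<subseteq> inner e" unfolding D'_def X_def by blast
  moreover have "D' \<inter> \<gamma> e ` {0..1} \<subseteq> inner e" using D(3) \<open>D' \<subseteq> D\<close> by blast
  moreover have "inner e \<subseteq> \<gamma> e ` {0..1}" "inner e \<subseteq> X" using image_split[OF e] inner_X[OF e] by blast+
  ultimately have "two_sided S X D' h" by (intro two_sided_cong[OF D(2)]) blast+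
  moreover have "r \<in> D'" unfolding D'_def using D(1) inner_not_p[OF e r] inner_unique[OF e _ r] edge_sub by blast
  ultimately show thesis using that \<open>D' \<inter> X \<subseteq> inner e\<close> by blast
qed

text \<open>Values on \<open>X\<close> are ignored throughout: \<open>k\<close> stands for a
  function on the complement of the drawing, and \<open>b\<close> is its limit at \<open>q\<close>.
  This makes sense at points of \<open>X\<close> too.\<close>

definition const_at :: "('b \<Rightarrow> bool) \<Rightarrow> 'b \<Rightarrow> bool \<Rightarrow> bool" where
  "const_at k q b \<longleftrightarrow> (\<exists>W. openin S W \<and> q \<in> W \<and> (\<forall>x\<in>W - X. k x = b))"
definition flat :: "('b \<Rightarrow> bool) \<Rightarrow> 'b \<Rightarrow> bool" where "flat k q \<longleftrightarrow> (\<exists>b. const_at k q b)"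

text \<open>The complement of the drawing is dense, which makes the limits in
  \<open>const_at\<close> unique. Finitely many vertices cannot fill an open set, and near an
  interior point of an edge both sides are inhabited.\<close>

lemma nonempty_off_X:
  assumes "openin S W" "q \<in> W"
  shows "W - X \<noteq> {}"
proof -
  have "W - p ` V \<noteq> {}" using open_Diff_finite_nonempty assms finite_V by blast
  then obtain r where r: "r \<in> W" "r \<notin> p ` V" by blast
  show ?thesis
  proof (cases "r \<in> X")
    case True
    then obtain e where e: "e \<in> E" "r \<in> inner e" using X_cases r by blast
    obtain D h where "r \<in> D" "two_sided S X D h" by (rule edge_two_sided[OF e])
    with True have "r \<in> D \<inter> X" by simp
    from two_sidedD(3)[OF \<open>two_sided S X D h\<close> this assms(1) r(1)]
    obtain W' where "W' \<subseteq> W" "\<exists>x\<in>W' - X. h x" by (elim exE conjE) (rule that)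
    then show ?thesis by blast
  next
    case False
    then show ?thesis using r by blast
  qed
qed

lemma const_at_unique: "const_at k q b \<Longrightarrow> const_at k q b' \<Longrightarrow> b = b'"
proof -
  assume "const_at k q b" "const_at k q b'"
  then obtain W W' where W: "openin S W" "q \<in> W" "\<forall>x\<in>W - X. k x = b"
    and W': "openin S W'" "q \<in> W'" "\<forall>x\<in>W' - X. k x = b'" unfolding const_at_def by blast
  have "W \<inter> W' - X \<noteq> {}" using nonempty_off_X[of "W \<inter> W'" q] W W' by blast
  then show ?thesis using W W' by blast
qed

lemma const_at_open: "const_at k q b \<Longrightarrow> \<exists>W. openin S W \<and> q \<in> W \<and> (\<forall>r\<in>W. const_at k r b)"
  unfolding const_at_def by blast

lemma const_at_val: "const_at k q b \<Longrightarrow> q \<notin> X \<Longrightarrow> k q = b" unfolding const_at_def by blast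

text \<open>The points with a given limit form an open set. Flatness makes the two such sets cover
  \<open>C\<close>, uniqueness of limits makes them disjoint, so connectedness leaves only
  one.\<close>

lemma const_at_connected:
  assumes C: "connectedin S C" and fl: "\<And>q. q \<in> C \<Longrightarrow> flat k q" and q: "q \<in> C" "r \<in> C" "const_at k q b"
  shows "const_at k r b"
proof (rule ccontr)
  assume nr: "\<not> const_at k r b"
  define A where "A c = \<Union>{W. openin S W \<and> (\<forall>r\<in>W. const_at k r c)}" for c
  have oA: "openin S (A c)" for c unfolding A_def by blast
  have mA: "s \<in> A c \<longleftrightarrow> const_at k s c" for s c
    unfolding A_def using const_at_open by blast
  have two: "const_at k s b \<or> const_at k s (\<not> b)" if s: "s \<in> C" for s
  proof -
    obtain c where "const_at k s c" using fl[OF s] unfolding flat_def by blast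
    then show ?thesis by (cases "c = b") auto
  qed
  have "const_at k r (\<not> b)" using two[OF q(2)] nr by blast
  then have "r \<in> A (\<not> b) \<inter> C" "q \<in> A b \<inter> C" unfolding Int_iff mA using q by simp_all
  then have "A b \<inter> C \<noteq> {}" "A (\<not> b) \<inter> C \<noteq> {}" by blast+
  moreover have "C \<subseteq> A b \<union> A (\<not> b)" using two unfolding subset_iff Un_iff mA by blast
  moreover have "s \<notin> A b \<inter> A (\<not> b)" for s
    unfolding Int_iff mA using const_at_unique[of k s b "\<not> b"] by blast
  then have "A b \<inter> A (\<not> b) \<inter> C = {}" by blast
  ultimately show False using connectedinD[OF C oA oA] by blast
qed

lemma const_connected_off_X:
  assumes C: "connectedin S C" "C \<inter> X = {}" and fl: "\<And>q. q \<in> C \<Longrightarrow> flat k q" and xy: "x \<in> C" "y \<in> C"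
  shows "k x = k y"
proof -
  obtain b where b: "const_at k x b" using fl[OF xy(1)] unfolding flat_def by blast
  have "const_at k y b" by (rule const_at_connected[OF C(1) fl xy b])
  then show ?thesis using const_at_val b C(2) xy by blast
qed

lemma join_within_const:
  assumes "join_within S (W - X) x y" and fl: "\<And>q. q \<in> W - X \<Longrightarrow> flat k q"
  shows "k x = k y"
proof -
  obtain C where C: "connectedin S C" "C \<subseteq> W - X" "x \<in> C" "y \<in> C"
    using assms(1) unfolding join_within_def by blast
  have "C \<inter> X = {}" using C(2) by blast
  moreover have "flat k q" if "q \<in> C" for q using fl that C(2) by blast
  ultimately show ?thesis using const_connected_off_X[OF C(1)] C(3,4) by blast
qed

lemma flat_cong: "openin S W \<Longrightarrow> q \<in> W \<Longrightarrow> (\<And>x. x \<in> W - X \<Longrightarrow> k x = k' x) \<Longrightarrow> flat k q = flat k' q"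
proof -
  assume W: "openin S W" "q \<in> W" and eq: "\<And>x. x \<in> W - X \<Longrightarrow> k x = k' x"
  have *: "const_at k' q b" if c: "const_at k q b" and "\<And>x. x \<in> W - X \<Longrightarrow> k x = k' x" for b k k'
  proof -
    obtain W' where W': "openin S W'" "q \<in> W'" "\<forall>x\<in>W' - X. k x = b" using c unfolding const_at_def by blast
    have "k' x = b" if "x \<in> W \<inter> W' - X" for x
      using \<open>\<And>x. x \<in> W - X \<Longrightarrow> k x = k' x\<close>[of x] W'(3) that by auto
    moreover have "openin S (W \<inter> W')" "q \<in> W \<inter> W'" using W W' by auto
    ultimately show ?thesis unfolding const_at_def by blast
  qed
  show ?thesis unfolding flat_def using *[of k _ k'] *[of k' _ k] eq by metis
qed

definition sides :: "('b \<Rightarrow> bool) \<Rightarrow> 'b \<Rightarrow> bool" where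
  "sides h r \<longleftrightarrow> (\<forall>W. openin S W \<and> r \<in> W \<longrightarrow> (\<exists>x\<in>W - X. h x) \<and> (\<exists>x\<in>W - X. \<not> h x))"

lemma two_sided_sides: "two_sided S X D h \<Longrightarrow> r \<in> D \<inter> X \<Longrightarrow> sides h r"
proof -
  assume "two_sided S X D h" "r \<in> D \<inter> X"
  show ?thesis unfolding sides_def
  proof (intro allI impI)
    fix W assume "openin S W \<and> r \<in> W"
    then obtain W' where "W' \<subseteq> W" "\<exists>x\<in>W' - X. h x" "\<exists>x\<in>W' - X. \<not> h x"
      using two_sidedD(3)[OF \<open>two_sided S X D h\<close> \<open>r \<in> D \<inter> X\<close>] by metis
    then show "(\<exists>x\<in>W - X. h x) \<and> (\<exists>x\<in>W - X. \<not> h x)" by blast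
  qed
qed

text \<open>Near a point of an edge, a function that is locally constant off the drawing can depend
  only on the side. It is thus described by two Boolean values, and all later questions about jumps
  become questions about these.\<close>

lemma two_sided_form:
  assumes ts: "two_sided S X D h" and r: "r \<in> D \<inter> X" and W: "openin S W" "r \<in> W"
    and fl: "\<And>q. q \<in> W - X \<Longrightarrow> flat k q"
  obtains W' c d where "openin S W'" "r \<in> W'" "W' \<subseteq> W \<inter> D" "\<And>x. x \<in> W' - X \<Longrightarrow> k x = (if h x then c else d)"
proof -
  have oW: "openin S (W \<inter> D)" "r \<in> W \<inter> D" using W two_sidedD(1)[OF ts] r by auto
  from two_sidedD(3)[OF ts r oW] obtain W' where W': "openin S W'" "r \<in> W'" "W' \<subseteq> W \<inter> D"
    and ex: "\<exists>x\<in>W' - X. h x" "\<exists>x\<in>W' - X. \<not> h x"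
    and j: "\<forall>x\<in>W' - X. \<forall>y\<in>W' - X. h x = h y \<longrightarrow> join_within S (W \<inter> D - X) x y"
    by (elim exE conjE) (rule that)
  obtain x1 where x1: "x1 \<in> W' - X" "h x1" using ex(1) by blast
  obtain x2 where x2: "x2 \<in> W' - X" "\<not> h x2" using ex(2) by blast
  have k: "k x = k y" if "x \<in> W' - X" "y \<in> W' - X" "h x = h y" for x y
    using j that join_within_const[of "W \<inter> D" x y k] fl by blast
  show thesis
  proof (rule that[OF W', of "k x1" "k x2"])
    fix x assume "x \<in> W' - X"
    then show "k x = (if h x then k x1 else k x2)" using k[of x x1] k[of x x2] x1 x2 by auto
  qed
qed

lemma form_flat:
  assumes "sides h r" "openin S W" "r \<in> W" "\<And>x. x \<in> W - X \<Longrightarrow> k x = (if h x then c else d)"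
  shows "flat k r \<longleftrightarrow> c = d"
proof
  assume "c = d"
  then have "const_at k r c" unfolding const_at_def using assms(2,3,4) by (intro exI[of _ W]) auto
  then show "flat k r" unfolding flat_def by blast
next
  assume "flat k r"
  then obtain b W' where W': "openin S W'" "r \<in> W'" "\<forall>x\<in>W' - X. k x = b" unfolding flat_def const_at_def by blast
  have W: "openin S (W \<inter> W') \<and> r \<in> W \<inter> W'" using W' assms by auto
  obtain x1 where x1: "x1 \<in> W \<inter> W' - X" "h x1" using assms(1) W unfolding sides_def by blast
  obtain x2 where x2: "x2 \<in> W \<inter> W' - X" "\<not> h x2" using assms(1) W unfolding sides_def by blast
  have "k x1 = c" "k x2 = d" "k x1 = b" "k x2 = b" using assms(4)[of x1] assms(4)[of x2] W' x1 x2 by auto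
  then show "c = d" by simp
qed

lemma connectedin_inner: "e \<in> E \<Longrightarrow> connectedin S (inner e)"
  unfolding inner_def by (rule pathin_connectedin[OF path_\<gamma>]) auto

text \<open>A jump across an edge occurs along its whole interior or nowhere: the pair of values on
  the two sides is locally the same along the edge, and the open edge is connected.\<close>

lemma edge_flat:
  assumes e: "e \<in> E" and k: "\<And>q. q \<in> topspace S - X \<Longrightarrow> flat k q"
    and r: "r \<in> inner e" "flat k r" and r': "r' \<in> inner e"
  shows "flat k r'"
proof (rule ccontr)
  assume nf: "\<not> flat k r'"
  define A where "A c = \<Union>{W. openin S W \<and> (\<forall>r\<in>W \<inter> inner e. flat k r = c)}" for c
  have oA: "openin S (A c)" for c unfolding A_def by blast
  have mA: "s \<in> A (flat k s)" if s: "s \<in> inner e" for s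
  proof -
    obtain D h where D: "s \<in> D" "two_sided S X D h" "D \<inter> X \<subseteq> inner e" by (rule edge_two_sided[OF e s])
    have sDX: "s \<in> D \<inter> X" using D(1) inner_X[OF e] s by blast
    have "s \<in> topspace S" using s inner_S[OF e] by blast
    obtain W' c d where W': "openin S W'" "s \<in> W'" "W' \<subseteq> topspace S \<inter> D" "\<And>x. x \<in> W' - X \<Longrightarrow> k x = (if h x then c else d)"
      by (rule two_sided_form[OF D(2) sDX openin_topspace \<open>s \<in> topspace S\<close> k]) (assumption, rule that)
    have "flat k r \<longleftrightarrow> c = d" if "r \<in> W' \<inter> inner e" for r
    proof (rule form_flat[OF _ W'(1) _ W'(4)])
      show "sides h r" using two_sided_sides[OF D(2)] that W'(3) inner_X[OF e] by blast
    qed (use that in auto)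
    then have "\<forall>r\<in>W' \<inter> inner e. flat k r = flat k s" using W'(2) s by blast
    then show ?thesis unfolding A_def using W'(1,2) by blast
  qed
  have nA: "flat k s = c" if "s \<in> A c" "s \<in> inner e" for s c using that unfolding A_def by blast
  have "inner e \<subseteq> A True \<union> A False" using mA by (metis (full_types) UnCI subsetI)
  moreover have "A True \<inter> A False \<inter> inner e = {}" using nA by blast
  moreover have "A True \<inter> inner e \<noteq> {}" "A False \<inter> inner e \<noteq> {}"
    using mA[OF r(1)] mA[OF r'] r nf r' by auto
  ultimately show False using connectedinD[OF connectedin_inner[OF e] oA oA] by blast
qed

text \<open>The functions valid for \<open>z\<close> jump across the edges in \<open>z\<close> and are locally constant off them:
  they are the local sheets of the double cover given by \<open>z\<close>. Nothing is required at the vertices.\<close>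
definition valid :: "'a set set \<Rightarrow> 'b set \<Rightarrow> ('b \<Rightarrow> bool) \<Rightarrow> bool" where
  "valid z U k \<longleftrightarrow> openin S U \<and> (\<forall>q\<in>U - p ` V. flat k q \<longleftrightarrow> q \<notin> (\<Union>e\<in>z. inner e))"

lemma valid_open: "valid z U k \<Longrightarrow> openin S U"
  unfolding valid_def by (rule conjunct1)

lemma valid_flat: "valid z U k \<Longrightarrow> q \<in> U \<Longrightarrow> q \<notin> p ` V \<Longrightarrow> flat k q \<longleftrightarrow> q \<notin> (\<Union>e\<in>z. inner e)"
  unfolding valid_def by simp

lemma valid_subset: "valid z U k \<Longrightarrow> openin S U' \<Longrightarrow> U' \<subseteq> U \<Longrightarrow> valid z U' k"
  unfolding valid_def by blast

lemma valid_flat_off: "valid z U k \<Longrightarrow> z \<subseteq> E \<Longrightarrow> q \<in> U - X \<Longrightarrow> flat k q"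
proof -
  assume a: "valid z U k" "z \<subseteq> E" "q \<in> U - X"
  then have "q \<notin> (\<Union>e\<in>z. inner e)" "q \<in> U - p ` V" using inner_X unfolding X_def by blast+
  then show ?thesis using a(1) unfolding valid_def by blast
qed

lemma flat_off_X:
  assumes "flat k q" "flat k' q"
  shows "flat (\<lambda>x. k x \<noteq> k' x) q"
proof -
  obtain b W b' W' where "openin S W" "q \<in> W" "\<forall>x\<in>W - X. k x = b" "openin S W'" "q \<in> W'" "\<forall>x\<in>W' - X. k' x = b'"
    using assms unfolding flat_def const_at_def by blast
  then show ?thesis unfolding flat_def const_at_def by (intro exI[of _ "b \<noteq> b'"] exI[of _ "W \<inter> W'"]) auto
qed

text \<open>At a point of an edge let the two functions have side values c, d and c', d'. Their
  exclusive or has side values that differ exactly if one of the pairs is unequal and the other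
  equal, so the jumps add modulo 2.\<close>

lemma valid_xor:
  assumes v: "valid z U k" "valid z' U k'" and z: "z \<subseteq> E" "z' \<subseteq> E"
  shows "valid (sym_diff z z') U (\<lambda>x. k x \<noteq> k' x)"
  unfolding valid_def
proof (intro conjI ballI)
  show U: "openin S U" using v unfolding valid_def by blast
  fix q assume q: "q \<in> U - p ` V"
  show "flat (\<lambda>x. k x \<noteq> k' x) q \<longleftrightarrow> q \<notin> (\<Union>e\<in>sym_diff z z'. inner e)"
  proof (cases "q \<in> X")
    case False
    then have "flat k q" "flat k' q" using valid_flat_off v z q by blast+
    moreover have "q \<notin> (\<Union>e\<in>sym_diff z z'. inner e)" using False z inner_X by blast
    ultimately show ?thesis using flat_off_X by blast
  next
    case True
    then obtain e where e: "e \<in> E" "q \<in> inner e" using X_cases q by blast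
    have mem: "q \<in> (\<Union>e\<in>y. inner e) \<longleftrightarrow> e \<in> y" if "y \<subseteq> E" for y
      using e inner_unique that by blast
    obtain D h where D: "q \<in> D" "two_sided S X D h" "D \<inter> X \<subseteq> inner e" by (rule edge_two_sided[OF e])
    have qDX: "q \<in> D \<inter> X" using D(1) True by blast
    have qU: "q \<in> U" using q by blast
    obtain W c d where W: "openin S W" "q \<in> W" "W \<subseteq> U \<inter> D" "\<And>x. x \<in> W - X \<Longrightarrow> k x = (if h x then c else d)"
      by (rule two_sided_form[OF D(2) qDX U qU valid_flat_off[OF v(1) z(1)]]) (assumption, rule that)
    obtain W' c' d' where W': "openin S W'" "q \<in> W'" "W' \<subseteq> U \<inter> D" "\<And>x. x \<in> W' - X \<Longrightarrow> k' x = (if h x then c' else d')"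
      by (rule two_sided_form[OF D(2) qDX U qU valid_flat_off[OF v(2) z(2)]]) (assumption, rule that)
    have s: "sides h q" by (rule two_sided_sides[OF D(2) qDX])
    have 1: "flat k q \<longleftrightarrow> c = d" by (rule form_flat[OF s W(1,2,4)])
    have 2: "flat k' q \<longleftrightarrow> c' = d'" by (rule form_flat[OF s W'(1,2,4)])
    have 3: "flat (\<lambda>x. k x \<noteq> k' x) q \<longleftrightarrow> ((c \<noteq> c') = (d \<noteq> d'))"
    proof (rule form_flat[OF s, of "W \<inter> W'"])
      show "openin S (W \<inter> W')" "q \<in> W \<inter> W'" using W W' by auto
      show "(k x \<noteq> k' x) = (if h x then c \<noteq> c' else d \<noteq> d')" if "x \<in> W \<inter> W' - X" for x
        using W(4)[of x] W'(4)[of x] that by auto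
    qed
    have 4: "flat k q \<longleftrightarrow> e \<notin> z" "flat k' q \<longleftrightarrow> e \<notin> z'" 
      using v q mem[OF z(1)] mem[OF z(2)] unfolding valid_def by blast+
    have "sym_diff z z' \<subseteq> E" using z by blast
    then show ?thesis unfolding mem[OF \<open>sym_diff z z' \<subseteq> E\<close>] using 1 2 3 4 by auto
  qed
qed

lemma valid_not: "valid z U k \<Longrightarrow> valid z U (\<lambda>x. \<not> k x)"
proof -
  have c: "const_at (\<lambda>x. \<not> k x) q (\<not> b)" if "const_at k q b" for q b k
    using that unfolding const_at_def by simp
  have "flat (\<lambda>x. \<not> k x) q = flat k q" for q
  proof
    show "flat k q \<Longrightarrow> flat (\<lambda>x. \<not> k x) q" unfolding flat_def using c[of k q] by blast
    assume "flat (\<lambda>x. \<not> k x) q"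
    then obtain b where "const_at (\<lambda>x. \<not> k x) q b" unfolding flat_def by blast
    from c[OF this] show "flat k q" unfolding flat_def by auto
  qed
  then show "valid z U k \<Longrightarrow> valid z U (\<lambda>x. \<not> k x)" unfolding valid_def by simp
qed

text \<open>At the vertices \<open>valid\<close> asserts nothing, but without these finitely many
  points \<open>U\<close> is still connected, and there the function has no jumps.\<close>

lemma valid_empty_const:
  assumes v: "valid {} U k" and U: "connectedin S U"
  shows "\<exists>b. \<forall>x\<in>U - X. k x = b"
proof (cases "U = {}")
  case False
  have oU: "openin S U" using v unfolding valid_def by blast
  have fl: "\<And>q. q \<in> U - p ` V \<Longrightarrow> flat k q" using v unfolding valid_def by blast
  have con: "connectedin S (U - p ` V)" using connectedin_Diff_finite oU U finite_V by blast
  obtain q where q: "q \<in> U - p ` V" using open_Diff_finite_nonempty[OF _ oU False] finite_V by blast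
  then obtain b where b: "const_at k q b" using fl unfolding flat_def by blast
  have "k x = b" if x: "x \<in> U - X" for x
  proof -
    have "x \<in> U - p ` V" using x unfolding X_def by blast
    then show ?thesis using const_at_val[OF const_at_connected[OF con fl q _ b]] x by blast
  qed
  then show ?thesis by blast
qed auto

end

section \<open>Existence of local sheets\<close>

context surface_graph
begin

text \<open>The direction in which \<open>\<gamma> e\<close> runs is unspecified; here the edge is
  reversed if necessary so as to start at \<open>v\<close>.\<close>

lemma oriented_edge:
  assumes e: "e \<in> E" and v: "v \<in> e"
  obtains \<alpha> w where "e = {v, w}" "v \<noteq> w" "pathin S \<alpha>" "inj_on \<alpha> {0..1}" "\<alpha> 0 = p v" "\<alpha> 1 = p w"
    "\<alpha> ` {0<..<1} = inner e"
proof -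
  obtain w where w: "e = {v, w}" "v \<noteq> w"
    using edge_card[OF e] v by (metis card_2_iff doubleton_eq_iff insertE singletonD)
  have "v \<in> V" "w \<in> V" using edge_sub[OF e] w by auto
  then have pvw: "p v \<noteq> p w" using inj_p w(2) by (meson inj_onD)
  have ends: "{\<gamma> e 0, \<gamma> e 1} = {p v, p w}" using ends_\<gamma>[OF e] w(1) by simp
  show thesis
  proof (cases "\<gamma> e 0 = p v")
    case True
    then have "\<gamma> e 1 = p w" using ends pvw by (metis doubleton_eq_iff)
    then show thesis using that[OF w path_\<gamma>[OF e] inj_\<gamma>[OF e] True] inner_def by blast
  next
    case False
    then have g: "\<gamma> e 0 = p w" "\<gamma> e 1 = p v" using ends pvw by (metis doubleton_eq_iff)+
    let ?\<alpha> = "\<lambda>t. \<gamma> e (1 - t)"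
    have "continuous_map (top_of_set {0..1::real}) (top_of_set {0..1}) (\<lambda>t. 1 - t)"
      by (intro continuous_map_into_subtopology) (auto intro!: continuous_intros)
    from continuous_map_compose[OF this path_\<gamma>[OF e, unfolded pathin_def]]
    have 1: "pathin S ?\<alpha>" unfolding pathin_def by (simp add: o_def)
    have 2: "inj_on ?\<alpha> {0..1}"
    proof (rule inj_onI)
      fix x y :: real assume "x \<in> {0..1}" "y \<in> {0..1}" "\<gamma> e (1 - x) = \<gamma> e (1 - y)"
      then have "1 - x = 1 - y" using inj_onD[OF inj_\<gamma>[OF e], of "1 - x" "1 - y"] by simp
      then show "x = y" by simp
    qed
    have "(\<lambda>t::real. 1 - t) ` {0<..<1} = {0<..<1}"
      by (auto simp: image_iff intro!: bexI[of _ "1 - x" for x])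
    then have "?\<alpha> ` {0<..<1} = inner e" unfolding inner_def by (metis image_image)
    then show thesis using that[OF w 1 2] g by simp
  qed
qed

text \<open>A constant serves off the drawing and near an edge outside \<open>z\<close>; near an
  edge in \<open>z\<close> the function telling its two sides apart is itself a sheet.\<close>

lemma local_valid_off_vertices:
  assumes z: "z \<subseteq> E" and q: "q \<in> topspace S" "q \<notin> p ` V"
  shows "\<exists>U k. q \<in> U \<and> valid z U k"
proof (cases "q \<in> X")
  case False
  let ?U = "topspace S - X"
  have U: "openin S ?U" using closedin_X by blast
  then have "const_at (\<lambda>x. True) r True" if "r \<in> ?U" for r
    unfolding const_at_def using that by (intro exI[of _ ?U]) auto
  moreover have "r \<notin> (\<Union>e\<in>z. inner e)" if "r \<in> ?U" for r using that z inner_X by blast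
  ultimately have "valid z ?U (\<lambda>x. True)" unfolding valid_def flat_def using U by blast
  then show ?thesis using q False by blast
next
  case True
  then obtain e where e: "e \<in> E" "q \<in> inner e" using X_cases q by blast
  obtain D h where D: "q \<in> D" "two_sided S X D h" "D \<inter> X \<subseteq> inner e" by (rule edge_two_sided[OF e])
  have oD: "openin S D" by (rule two_sidedD(1)[OF D(2)])
  have mem: "r \<in> (\<Union>e\<in>z. inner e) \<longleftrightarrow> e \<in> z \<and> r \<in> X" if "r \<in> D" for r
    using inner_unique[OF e(1)] D(3) z that inner_X by blast
  show ?thesis
  proof (cases "e \<in> z")
    case False
    have "const_at (\<lambda>x. True) r True" if "r \<in> D" for r
      unfolding const_at_def using that oD by (intro exI[of _ D]) auto
    then have "valid z D (\<lambda>x. True)" unfolding valid_def flat_def using oD mem False by blast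
    then show ?thesis using D(1) by blast
  next
    case True
    have "flat h r \<longleftrightarrow> r \<notin> X" if "r \<in> D" for r
    proof (cases "r \<in> X")
      case True
      then have "sides h r" using two_sided_sides[OF D(2)] that by blast
      then have "flat h r \<longleftrightarrow> True = False"
        by (rule form_flat[OF _ oD that]) simp
      then show ?thesis using True by simp
    next
      case False
      then have "r \<in> D - X" using that by blast
      from two_sidedD(2)[OF D(2) this] show ?thesis unfolding flat_def const_at_def using False by blast
    qed
    then have "valid z D h" unfolding valid_def using oD mem True by blast
    then show ?thesis using D(1) by blast
  qed
qed

text \<open>Meant for a curve \<open>A\<close> composed of several edges. At an interior point of
  one of them the sides of \<open>A\<close> are the sides of the drawing, so \<open>h\<close> jumps
  exactly along \<open>A\<close>, apart from the vertices.\<close>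

lemma flat_of_two_sided:
  assumes ts: "two_sided S A D h" and A: "A \<subseteq> X" and q: "q \<in> D - p ` V"
    and loc: "\<And>e. e \<in> E \<Longrightarrow> q \<in> inner e \<Longrightarrow> q \<in> A \<Longrightarrow> inner e \<subseteq> A"
  shows "flat h q \<longleftrightarrow> q \<notin> A"
proof (cases "q \<in> A")
  case False
  then have "q \<in> D - A" using q by blast
  from two_sidedD(2)[OF ts this] obtain W b where "openin S W" "q \<in> W" "\<forall>x\<in>W - A. h x = b" by blast
  then have "flat h q" unfolding flat_def const_at_def using A by blast
  then show ?thesis using False by simp
next
  case True
  then obtain e where e: "e \<in> E" "q \<in> inner e" using X_cases q A by blast
  obtain D1 h1 where D1: "q \<in> D1" "two_sided S X D1 h1" "D1 \<inter> X \<subseteq> inner e" by (rule edge_two_sided[OF e])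
  have sub: "inner e \<subseteq> A" by (rule loc[OF e True])
  have oD: "openin S (D \<inter> D1)" using two_sidedD(1) ts D1(2) by blast
  have "two_sided S X (D \<inter> D1) h"
    by (rule two_sided_cong[OF ts oD]) (use D1(3) sub A in blast)+
  then have "sides h q" by (rule two_sided_sides) (use q D1 A True in blast)
  then have "flat h q \<longleftrightarrow> True = False"
    by (rule form_flat[OF _ oD]) (use q D1 in auto)
  then show ?thesis using True by simp
qed

text \<open>Running along \<open>a\<close> towards \<open>v\<close> and then along \<open>b\<close>
  away from it gives one arc with \<open>p v\<close> in its interior. The function telling the sides
  of this arc apart is a sheet for the two edges near \<open>v\<close>.\<close>

lemma local_valid_pair:
  assumes ab: "a \<in> E" "b \<in> E" "a \<noteq> b" "v \<in> a" "v \<in> b"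
  shows "\<exists>U k. p v \<in> U \<and> valid {a, b} U k"
proof -
  obtain \<alpha> w where \<alpha>: "a = {v, w}" "v \<noteq> w" "pathin S \<alpha>" "inj_on \<alpha> {0..1}" "\<alpha> 0 = p v" "\<alpha> 1 = p w"
    "\<alpha> ` {0<..<1} = inner a" by (rule oriented_edge[OF ab(1,4)])
  obtain \<beta> w' where \<beta>: "b = {v, w'}" "v \<noteq> w'" "pathin S \<beta>" "inj_on \<beta> {0..1}" "\<beta> 0 = p v" "\<beta> 1 = p w'"
    "\<beta> ` {0<..<1} = inner b" by (rule oriented_edge[OF ab(2,5)])
  have vV: "v \<in> V" "w \<in> V" "w' \<in> V" "w \<noteq> w'" using ab edge_sub \<alpha>(1) \<beta>(1) by auto
  then have pv: "p v \<noteq> p w" "p v \<noteq> p w'" "p w \<noteq> p w'" using inj_p \<alpha>(2) \<beta>(2) by (meson inj_onD)+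
  define g where "g = (\<lambda>s::real. if s \<le> 1/2 then \<alpha> (1 - 2 * s) else \<beta> (2 * s - 1))"
  have "continuous_map (top_of_set {0..1}) S g"
    unfolding g_def
  proof (rule continuous_map_cases_le)
    have c1: "continuous_map (subtopology (top_of_set {0..1}) {x \<in> topspace (top_of_set {0..1}). x \<le> 1/2}) (top_of_set {0..1}) (\<lambda>s::real. 1 - 2 * s)"
      by (intro continuous_map_into_subtopology continuous_map_from_subtopology) (auto intro!: continuous_intros)
    show "continuous_map (subtopology (top_of_set {0..1}) {x \<in> topspace (top_of_set {0..1}). x \<le> 1/2}) S (\<lambda>s. \<alpha> (1 - 2 * s))"
      using continuous_map_compose[OF c1 \<alpha>(3)[unfolded pathin_def]] by (simp add: o_def)
    have c2: "continuous_map (subtopology (top_of_set {0..1}) {x \<in> topspace (top_of_set {0..1}). 1/2 \<le> x}) (top_of_set {0..1}) (\<lambda>s::real. 2 * s - 1)"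
      by (intro continuous_map_into_subtopology continuous_map_from_subtopology) (auto intro!: continuous_intros)
    show "continuous_map (subtopology (top_of_set {0..1}) {x \<in> topspace (top_of_set {0..1}). 1/2 \<le> x}) S (\<lambda>s. \<beta> (2 * s - 1))"
      using continuous_map_compose[OF c2 \<beta>(3)[unfolded pathin_def]] by (simp add: o_def)
    show "\<alpha> (1 - 2 * x) = \<beta> (2 * x - 1)" if x: "x = 1/2" for x
    proof -
      have "1 - 2 * x = 0" "2 * x - 1 = 0" using x by auto
      then show ?thesis using \<alpha>(5) \<beta>(5) by presburger
    qed
  qed auto
  then have path: "pathin S g" unfolding pathin_def .
  have split: "{0..1} = {0<..<1} \<union> {0::real, 1}" by auto
  have \<alpha>im: "\<alpha> ` {0..1} = inner a \<union> {p v, p w}" and \<beta>im: "\<beta> ` {0..1} = inner b \<union> {p v, p w'}"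
    unfolding split image_Un using \<alpha>(5-7) \<beta>(5-7) by auto
  have meet: "\<alpha> ` {0..1} \<inter> \<beta> ` {0..1} \<subseteq> {p v}"
    unfolding \<alpha>im \<beta>im using inner_unique[OF ab(1,2)] ab(3) inner_not_p ab(1,2) pv vV by blast
  have gl: "g s = \<alpha> (1 - 2 * s)" "1 - 2 * s \<in> {0..1}" if "s \<in> {0..1/2}" for s using that unfolding g_def by auto
  have gr: "g s = \<beta> (2 * s - 1)" "2 * s - 1 \<in> {0..1}" if "s \<in> {1/2<..1}" for s using that unfolding g_def by auto
  have inj: "inj_on g {0..1}"
  proof (rule linorder_inj_onI)
    fix x y :: real assume xy: "x < y" "x \<in> {0..1}" "y \<in> {0..1}"
    consider "y \<le> 1/2" | "x > 1/2" | "x \<le> 1/2" "y > 1/2" by linarith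
    then show "g x \<noteq> g y"
    proof cases
      case 1
      then have m: "x \<in> {0..1/2}" "y \<in> {0..1/2}" using xy by auto
      show ?thesis using inj_onD[OF \<alpha>(4) _ gl(2)[OF m(1)] gl(2)[OF m(2)]] xy(1) unfolding gl(1)[OF m(1)] gl(1)[OF m(2)] by auto
    next
      case 2
      then have m: "x \<in> {1/2<..1}" "y \<in> {1/2<..1}" using xy by auto
      show ?thesis using inj_onD[OF \<beta>(4) _ gr(2)[OF m(1)] gr(2)[OF m(2)]] xy(1) unfolding gr(1)[OF m(1)] gr(1)[OF m(2)] by auto
    next
      case 3
      then have m: "x \<in> {0..1/2}" "y \<in> {1/2<..1}" using xy by auto
      show ?thesis
      proof
        assume eq: "g x = g y"
        have "g x \<in> \<alpha> ` {0..1}" unfolding gl(1)[OF m(1)] using gl(2)[OF m(1)] by (rule imageI)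
        moreover have gy: "g y \<in> \<beta> ` {0..1}" unfolding gr(1)[OF m(2)] using gr(2)[OF m(2)] by (rule imageI)
        ultimately have "g y = \<beta> 0" using meet eq \<beta>(5) by auto
        then have "\<beta> (2 * y - 1) = \<beta> 0" using gr(1)[OF m(2)] by simp
        then have "2 * y - 1 = 0" using inj_onD[OF \<beta>(4) _ gr(2)[OF m(2)], of 0] by simp
        then show False using m(2) by simp
      qed
    qed
  qed (simp add: linear)
  have "g (1/2) = p v" unfolding g_def using \<alpha>(5) by simp
  have gim: "g ` {0..1} = inner a \<union> inner b \<union> {p v, p w, p w'}"
  proof -
    have "{0..1::real} = {0..1/2} \<union> {1/2..1}" by auto
    then have "g ` {0..1} = g ` {0..1/2} \<union> g ` {1/2..1}" by (metis image_Un)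
    moreover have "g ` {0..1/2} = \<alpha> ` {0..1}"
    proof -
      have i: "(\<lambda>s::real. 1 - 2 * s) ` {0..1/2} = {0..1}"
      proof (intro equalityI subsetI)
        fix x :: real assume "x \<in> {0..1}"
        then have "x = 1 - 2 * ((1 - x) / 2)" "(1 - x) / 2 \<in> {0..1/2}" by (auto simp: field_simps)
        then show "x \<in> (\<lambda>s. 1 - 2 * s) ` {0..1/2}" by (rule image_eqI)
      qed auto
      have "g ` {0..1/2} = (\<lambda>s. \<alpha> (1 - 2 * s)) ` {0..1/2}" using gl(1) by (rule image_cong[OF refl])
      then show ?thesis unfolding i[symmetric] by (simp add: image_image)
    qed
    moreover have "g ` {1/2..1} = \<beta> ` {0..1}"
    proof -
      have i: "(\<lambda>s::real. 2 * s - 1) ` {1/2..1} = {0..1}"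
      proof (intro equalityI subsetI)
        fix x :: real assume "x \<in> {0..1}"
        then have "x = 2 * ((x + 1) / 2) - 1" "(x + 1) / 2 \<in> {1/2..1}" by (auto simp: field_simps)
        then show "x \<in> (\<lambda>s. 2 * s - 1) ` {1/2..1}" by (rule image_eqI)
      qed auto
      have "g s = \<beta> (2 * s - 1)" if s: "s \<in> {1/2..1}" for s
      proof (cases "s = 1/2")
        case True
        then have "1 - 2 * s = 0" "2 * s - 1 = 0" "s \<le> 1/2" by auto
        then show ?thesis unfolding g_def using \<alpha>(5) \<beta>(5) by presburger
      next
        case False
        then show ?thesis using s unfolding g_def by simp
      qed
      then have "g ` {1/2..1} = (\<lambda>s. \<beta> (2 * s - 1)) ` {1/2..1}" by (rule image_cong[OF refl])
      then show ?thesis unfolding i[symmetric] by (simp add: image_image)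
    qed
    ultimately have "g ` {0..1} = (inner a \<union> {p v, p w}) \<union> (inner b \<union> {p v, p w'})"
      unfolding \<alpha>im \<beta>im by (simp only:)
    then show ?thesis by auto
  qed
  have half: "0 < (1/2 :: real)" "(1/2 :: real) < 1" by auto
  obtain D h where D: "g (1/2) \<in> D" "two_sided S (g ` {0..1}) D h"
    by (rule two_sided_arc[OF path inj half]) (rule that)
  have sub: "g ` {0..1} \<subseteq> X" unfolding gim X_def using ab vV by blast
  have "flat h q \<longleftrightarrow> q \<notin> (\<Union>e\<in>{a, b}. inner e)" if q: "q \<in> D - p ` V" for q
  proof -
    have "flat h q \<longleftrightarrow> q \<notin> g ` {0..1}"
    proof (rule flat_of_two_sided[OF D(2) sub q])
      fix e assume e: "e \<in> E" "q \<in> inner e" "q \<in> g ` {0..1}"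
      then have "q \<in> inner a \<or> q \<in> inner b" using q vV unfolding gim by blast
      then have "e = a \<or> e = b" using inner_unique e ab by blast
      then show "inner e \<subseteq> g ` {0..1}" unfolding gim by blast
    qed
    then show ?thesis using q vV unfolding gim by blast
  qed
  then have "valid {a, b} D h" unfolding valid_def using two_sidedD(1)[OF D(2)] by blast
  then show ?thesis using D(1) \<open>g (1/2) = p v\<close> by auto
qed

text \<open>The edges are split into pairs, and the sheets for the pairs are combined by exclusive
  or. This is where evenness is used.\<close>

lemma local_valid_star:
  assumes v: "v \<in> V" and y: "y \<subseteq> {e \<in> E. v \<in> e}" "even (card y)"
  shows "\<exists>U k. p v \<in> U \<and> valid y U k"
  using y
proof (induction "card y" arbitrary: y rule: less_induct)
  case less
  have fin: "finite y" using less.prems(1) finite_E by (auto intro: finite_subset)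
  show ?case
  proof (cases "y = {}")
    case True
    have "const_at (\<lambda>x. True) r True" if "r \<in> topspace S" for r
      unfolding const_at_def using that by (intro exI[of _ "topspace S"]) auto
    then have "valid {} (topspace S) (\<lambda>x. True)" unfolding valid_def flat_def by blast
    then show ?thesis using True v p_S by blast
  next
    case False
    then obtain a where a: "a \<in> y" by blast
    have ca: "Suc (card (y - {a})) = card y" by (rule card_Suc_Diff1[OF fin a])
    then have "card (y - {a}) \<noteq> 0" using less.prems(2) by (metis One_nat_def odd_one)
    then have "y - {a} \<noteq> {}" by (metis card.empty)
    then obtain b where b: "b \<in> y - {a}" by blast
    let ?y = "y - {a, b}"
    have "Suc (card (y - {a} - {b})) = card (y - {a})" using b fin by (intro card_Suc_Diff1) auto
    moreover have "y - {a} - {b} = ?y" by blast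
    ultimately have c: "card y = Suc (Suc (card ?y))" using ca by simp
    then have ev: "even (card ?y)" and lt: "card ?y < card y" using less.prems(2) by simp_all
    have sub: "?y \<subseteq> {e \<in> E. v \<in> e}" using less.prems(1) by blast
    obtain U k where U: "p v \<in> U" "valid ?y U k" using less.hyps[OF lt sub ev] by blast
    have "a \<in> {e \<in> E. v \<in> e}" "b \<in> {e \<in> E. v \<in> e}" "a \<noteq> b" using a b less.prems(1) by blast+
    then obtain U' k' where U': "p v \<in> U'" "valid {a, b} U' k'" using local_valid_pair[of a b v] by blast
    have o: "openin S (U \<inter> U')" by (intro openin_Int valid_open[OF U(2)] valid_open[OF U'(2)])
    have "valid (sym_diff ?y {a, b}) (U \<inter> U') (\<lambda>x. k x \<noteq> k' x)"
    proof (rule valid_xor)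
      show "valid ?y (U \<inter> U') k" by (rule valid_subset[OF U(2) o]) simp
      show "valid {a, b} (U \<inter> U') k'" by (rule valid_subset[OF U'(2) o]) simp
      show "?y \<subseteq> E" "{a, b} \<subseteq> E" using less.prems(1) a b by auto
    qed
    moreover have "sym_diff ?y {a, b} = y" using a b by blast
    moreover have "p v \<in> U \<inter> U'" using U(1) U'(1) by blast
    ultimately show ?thesis by metis
  qed
qed

text \<open>The cycle space of the graph over Z/2. Evenness at a vertex is what allows the jumps
  around it to close up.\<close>

definition even_set :: "'a set set \<Rightarrow> bool" where
  "even_set z \<longleftrightarrow> z \<subseteq> E \<and> (\<forall>v\<in>V. even (card {e \<in> z. v \<in> e}))"

text \<open>Every point lies under a sheet, so an even edge set really defines a double cover of the
  whole surface, vertices included.\<close>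

lemma local_valid:
  assumes z: "even_set z" and q: "q \<in> topspace S"
  shows "\<exists>U k. q \<in> U \<and> valid z U k"
proof (cases "q \<in> p ` V")
  case False
  then show ?thesis using local_valid_off_vertices z q unfolding even_set_def by blast
next
  case True
  then obtain v where v: "v \<in> V" "q = p v" by blast
  let ?y = "{e \<in> z. v \<in> e}" and ?z = "{e \<in> E. v \<notin> e}"
  have ev: "even (card ?y)" and sub: "?y \<subseteq> {e \<in> E. v \<in> e}" using z v unfolding even_set_def by auto
  obtain U k where U: "p v \<in> U" "valid ?y U k"
    using local_valid_star[OF v(1) sub ev] by (elim exE conjE) (rule that)
  \<comment> \<open>The closed edges that miss \<open>v\<close> stay away from \<open>p v\<close>
    and can be removed from the neighbourhood. On what remains, \<open>z\<close> and its star at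
    \<open>v\<close> have the same interior points.\<close>
  let ?U = "U - (p ` {} \<union> (\<Union>e\<in>?z. inner e \<union> p ` e))"
  have o: "openin S ?U" by (intro openin_avoid valid_open[OF U(2)]) auto
  have vU: "valid ?y ?U k" by (rule valid_subset[OF U(2) o]) blast
  have mem: "r \<in> (\<Union>e\<in>?y. inner e) \<longleftrightarrow> r \<in> (\<Union>e\<in>z. inner e)" if r: "r \<in> ?U" for r
  proof
    assume "r \<in> (\<Union>e\<in>z. inner e)"
    then obtain e where e: "e \<in> z" "r \<in> inner e" by blast
    then have "e \<in> E" using z unfolding even_set_def by blast
    moreover have "e \<notin> ?z"
    proof
      assume "e \<in> ?z"
      then have "r \<in> (\<Union>e\<in>?z. inner e \<union> p ` e)" using e(2) by blast
      then show False using r by simp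
    qed
    ultimately show "r \<in> (\<Union>e\<in>?y. inner e)" using e by blast
  next
    assume "r \<in> (\<Union>e\<in>?y. inner e)"
    then obtain e where "e \<in> ?y" "r \<in> inner e" by (rule UN_E)
    then show "r \<in> (\<Union>e\<in>z. inner e)" by (intro UN_I) simp_all
  qed
  have "valid z ?U k" unfolding valid_def
  proof (intro conjI ballI o)
    fix r assume "r \<in> ?U - p ` V"
    then have "r \<in> ?U" "r \<notin> p ` V" by blast+
    then show "flat k r \<longleftrightarrow> r \<notin> (\<Union>e\<in>z. inner e)" using valid_flat[OF vU, of r] mem[of r] by metis
  qed
  moreover have "p v \<notin> p ` e" "p v \<notin> inner e" if e: "e \<in> ?z" for e
  proof -
    have "e \<in> E" "v \<notin> e" using e by auto
    then show "p v \<notin> p ` e" using edge_sub v(1) inj_p by (meson inj_on_image_mem_iff)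
    show "p v \<notin> inner e" using inner_not_p[OF \<open>e \<in> E\<close>, of "p v"] v(1) by blast
  qed
  then have "p v \<notin> (\<Union>e\<in>?z. inner e \<union> p ` e)" by blast
  then have "q \<in> ?U" using U(1) v(2) by simp
  ultimately show ?thesis by meson
qed

text \<open>A vertex on a single edge is a free end of the drawing: all other vertices and edges are
  at a distance from it.\<close>

lemma one_sided_vertex:
  assumes e: "e \<in> E" and v: "v \<in> e" and free: "\<And>e'. e' \<in> E \<Longrightarrow> v \<in> e' \<Longrightarrow> e' = e"
  shows "one_sided S X (p v)"
proof -
  obtain \<alpha> w where \<alpha>: "e = {v, w}" "v \<noteq> w" "pathin S \<alpha>" "inj_on \<alpha> {0..1}" "\<alpha> 0 = p v" "\<alpha> 1 = p w"
    "\<alpha> ` {0<..<1} = inner e" by (rule oriented_edge[OF e v])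
  have split: "{0..1} = {0<..<1} \<union> {0::real, 1}" by auto
  have im: "\<alpha> ` {0..1} = inner e \<union> {p v, p w}" unfolding split image_Un using \<alpha>(5-7) by auto
  have os: "one_sided S (inner e \<union> {p v, p w}) (p v)"
    using one_sided_arc[OF \<alpha>(3,4)] unfolding im \<alpha>(5) .
  have vV: "v \<in> V" "w \<in> V" using edge_sub[OF e] \<alpha>(1) by auto
  let ?D = "topspace S - (p ` (V - {v}) \<union> (\<Union>e\<in>E - {e}. inner e \<union> p ` e))"
  show ?thesis
  proof (rule one_sided_cong[OF os, of ?D])
    show "openin S ?D" by (intro openin_avoid) auto
    have inj: "p v \<notin> p ` F" if "F \<subseteq> V" "v \<notin> F" for F
      using inj_p vV(1) that by (meson inj_on_image_mem_iff)
    have "p v \<notin> p ` e'" "p v \<notin> inner e'" if "e' \<in> E - {e}" for e'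
      using that free[of e'] inj[of e'] edge_sub[of e'] inner_not_p[of e' "p v"] vV(1) by auto
    then show "p v \<in> ?D" using p_S vV(1) inj[of "V - {v}"] by blast
    have "p w \<notin> ?D" using vV \<alpha>(2) by blast
    then show "?D \<inter> X = ?D \<inter> (inner e \<union> {p v, p w})"
      unfolding X_def using e vV by blast
  qed
qed

end

section \<open>Faces\<close>

lemma surface_graph_subset:
  assumes "surface_graph S V E p \<gamma>" "E' \<subseteq> E"
  shows "surface_graph S V E' p \<gamma>"
proof -
  interpret surface_graph S V E p \<gamma> by (rule assms(1))
  show ?thesis
  proof unfold_locales
    show "simple_graph V E'" using graph assms(2) unfolding simple_graph_def by blast
    show "inj_on p V" "p ` V \<subseteq> topspace S" by (rule inj_p, rule p_S)
    fix e assume "e \<in> E'"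
    then have e: "e \<in> E" using assms(2) by blast
    show "pathin S (\<gamma> e)" "inj_on (\<gamma> e) {0..1}" "{\<gamma> e 0, \<gamma> e 1} = p ` e" "\<gamma> e ` {0<..<1} \<inter> p ` V = {}"
      using path_\<gamma>[OF e] inj_\<gamma>[OF e] ends_\<gamma>[OF e] inner_p[OF e] by simp_all
    fix e' assume "e' \<in> E'" "e' \<noteq> e"
    then show "\<gamma> e ` {0<..<1} \<inter> \<gamma> e' ` {0<..<1} = {}" using inner_disjoint[OF e] assms(2) by blast
  qed
qed

context surface_graph
begin

lemma inner_nonempty: "\<gamma> e (1/2) \<in> inner e" unfolding inner_def by auto

text \<open>An edge with a free end borders the same face on both sides.\<close>
lemma connected_off_two_edges:
  assumes card: "card E \<le> 2" and fl: "\<And>q. q \<in> topspace S - X \<Longrightarrow> flat k q"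
  shows "\<exists>b. \<forall>x\<in>topspace S - X. k x = b"
proof (rule valid_empty_const)
  show "connectedin S (topspace S)" using connected_S by (simp add: connectedin_topspace)
  have inner_flat: "flat k r" if e: "e \<in> E" and r: "r \<in> inner e" for e r
  proof -
    \<comment> \<open>With at most two edges, each has an end that lies on no other edge, since two
      different sets of size 2 are not contained in each other.\<close>
    have "\<exists>v\<in>e. \<forall>e'\<in>E. v \<in> e' \<longrightarrow> e' = e"
    proof (cases "E = {e}")
      case True
      obtain v where "v \<in> e" using edge_card[OF e] by (metis card.empty ex_in_conv zero_neq_numeral)
      then show ?thesis using True by blast
    next
      case False
      then obtain e' where e': "e' \<in> E" "e' \<noteq> e" using e by blast
      have "card {e, e'} = 2" using e'(2) by auto
      then have E: "{e, e'} = E" using card_seteq[OF finite_E, of "{e, e'}"] e e' card by auto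
      have "finite e" "finite e'" using edge_card e e' by (metis card.infinite zero_neq_numeral)+
      then have "\<not> e \<subseteq> e'" using e'(2) edge_card[OF e] edge_card[OF e'(1)] by (metis card_subset_eq)
      then obtain v where "v \<in> e" "v \<notin> e'" by blast
      then show ?thesis using E by blast
    qed
    then obtain v where v: "v \<in> e" "\<And>e'. e' \<in> E \<Longrightarrow> v \<in> e' \<Longrightarrow> e' = e" by blast
    have os: "one_sided S X (p v)" by (rule one_sided_vertex[OF e v])
    have vS: "p v \<in> topspace S" using edge_sub[OF e] v(1) p_S by blast
    obtain W where W: "openin S W" "p v \<in> W" "\<And>x y. x \<in> W - X \<Longrightarrow> y \<in> W - X \<Longrightarrow> join_within S (topspace S - X) x y"
      using os vS unfolding one_sided_def by (metis openin_topspace)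
    obtain x where x: "x \<in> W - X" using nonempty_off_X[OF W(1,2)] by blast
    have "k y = k x" if "y \<in> W - X" for y by (rule join_within_const[OF W(3)[OF that x] fl])
    then have Wfl: "flat k s" if "s \<in> W" for s using that W(1) unfolding flat_def const_at_def by blast
    obtain \<alpha> w where \<alpha>: "pathin S \<alpha>" "inj_on \<alpha> {0..1}" "\<alpha> 0 = p v" "\<alpha> ` {0<..<1} = inner e"
      by (rule oriented_edge[OF e v(1)])
    obtain d where d: "d > 0" "\<And>u. u \<in> {0..1} \<Longrightarrow> \<bar>u - 0\<bar> < d \<Longrightarrow> \<alpha> u \<in> W"
      by (rule pathin_nbhd[OF \<alpha>(1) _ _ W(1), of 0]) (use \<alpha>(3) W(2) in auto)
    define u where "u = min (1/2) (d/2)"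
    have u: "u \<in> {0<..<1}" "u \<in> {0..1}" "\<bar>u - 0\<bar> < d" using d(1) unfolding u_def by (auto simp: min_def)
    have "\<alpha> u \<in> inner e" unfolding \<alpha>(4)[symmetric] using u(1) by (rule imageI)
    then show ?thesis using edge_flat[OF e fl _ Wfl[OF d(2)[OF u(2,3)]] r] by blast
  qed
  \<comment> \<open>A function constant around the free end is flat at nearby points of the edge,
    hence along the whole edge. So \<open>k\<close> has no jumps at all on the surface.\<close>
  show "valid {} (topspace S) k"
    unfolding valid_def
  proof (intro conjI ballI openin_topspace)
    fix q assume q: "q \<in> topspace S - p ` V"
    have "flat k q"
    proof (cases "q \<in> X")
      case True
      then show ?thesis using X_cases inner_flat q by blast
    next
      case False
      then show ?thesis using fl q by blast
    qed
    then show "flat k q \<longleftrightarrow> q \<notin> (\<Union>e\<in>{}. inner e)" by simp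
  qed
qed

definition face :: "'b \<Rightarrow> 'b set" where "face x = {y. join_within S (topspace S - X) x y}"
definition faces :: "'b set set" where "faces = face ` (topspace S - X)"
text \<open>As faces avoid the drawing, this says that some interior point of \<open>e\<close> lies
  in the closure of \<open>f\<close>.\<close>

definition touches :: "'b set \<Rightarrow> 'a set \<Rightarrow> bool" where
  "touches f e \<longleftrightarrow> (\<exists>r\<in>inner e. \<not> const_at (\<lambda>x. x \<in> f) r False)"

lemma join_sym: "join_within S A x y \<Longrightarrow> join_within S A y x" unfolding join_within_def by blast

lemma join_trans:
  assumes "join_within S A x y" "join_within S A y z" shows "join_within S A x z"
proof -
  obtain C C' where C: "connectedin S C" "C \<subseteq> A" "x \<in> C" "y \<in> C" "connectedin S C'" "C' \<subseteq> A" "y \<in> C'" "z \<in> C'"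
    using assms unfolding join_within_def by blast
  have "connectedin S (C \<union> C')" using C by (intro connectedin_Un) auto
  then show ?thesis unfolding join_within_def using C by blast
qed

lemma join_refl: "x \<in> topspace S \<Longrightarrow> x \<in> A \<Longrightarrow> join_within S A x x"
  unfolding join_within_def by (intro exI[of _ "{x}"]) auto

lemma face_sub: "face x \<subseteq> topspace S - X" unfolding face_def join_within_def by blast

lemma face_self: "x \<in> topspace S - X \<Longrightarrow> x \<in> face x"
  unfolding face_def using join_refl[of x] by simp

lemma face_eq: "y \<in> face x \<Longrightarrow> face y = face x"
  unfolding face_def using join_sym join_trans by blast

lemma faces_face: "f \<in> faces \<Longrightarrow> y \<in> f \<Longrightarrow> face y = f"
  unfolding faces_def using face_eq by blast

lemma open_off_X: "openin S (topspace S - X)" using closedin_X by blast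

lemma face_flat:
  assumes f: "f \<in> faces" and q: "q \<in> topspace S - X"
  shows "flat (\<lambda>x. x \<in> f) q"
proof -
  obtain D where D: "openin S D" "q \<in> D" "D \<subseteq> topspace S - X" "connectedin S D"
    by (rule disc_nbhd[OF open_off_X q]) (rule that)
  have "D \<subseteq> face q" unfolding face_def join_within_def using D by blast
  then have "(x \<in> f) = (q \<in> f)" if "x \<in> D" for x
    using faces_face[OF f] face_eq[of x q] face_self[of x] face_self[OF q] D(3) that by (metis subsetD)
  then show ?thesis unfolding flat_def const_at_def using D(1,2) by blast
qed

text \<open>Near a point of the edge, membership in \<open>f\<close> is given by one Boolean value
  per side, and \<open>f\<close> comes close exactly if one of them is true. This is locally
  constant along the connected open edge, so touching can be tested at any of its points.\<close>

lemma touches_everywhere: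
  assumes f: "f \<in> faces" and e: "e \<in> E" and t: "touches f e" and r: "r \<in> inner e"
  shows "\<not> const_at (\<lambda>x. x \<in> f) r False"
proof
  assume nf: "const_at (\<lambda>x. x \<in> f) r False"
  let ?k = "\<lambda>x. x \<in> f"
  obtain r' where r': "r' \<in> inner e" "\<not> const_at ?k r' False" using t unfolding touches_def by blast
  define A where "A c = \<Union>{W. openin S W \<and> (\<forall>r\<in>W \<inter> inner e. const_at ?k r False = c)}" for c
  have oA: "openin S (A c)" for c unfolding A_def by blast
  have nA: "const_at ?k s False = c" if "s \<in> A c" "s \<in> inner e" for s c using that unfolding A_def by blast
  have mA: "s \<in> A (const_at ?k s False)" if s: "s \<in> inner e" for s
  proof -
    obtain D h where D: "s \<in> D" "two_sided S X D h" "D \<inter> X \<subseteq> inner e" by (rule edge_two_sided[OF e s])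
    have sDX: "s \<in> D \<inter> X" using D(1) inner_X[OF e] s by blast
    have "s \<in> topspace S" using s inner_S[OF e] by blast
    obtain W' c d where W': "openin S W'" "s \<in> W'" "W' \<subseteq> topspace S \<inter> D" "\<And>x. x \<in> W' - X \<Longrightarrow> ?k x = (if h x then c else d)"
      by (rule two_sided_form[OF D(2) sDX openin_topspace \<open>s \<in> topspace S\<close> face_flat[OF f]]) (assumption, rule that)
    have "const_at ?k r False \<longleftrightarrow> \<not> c \<and> \<not> d" if r: "r \<in> W' \<inter> inner e" for r
    proof
      assume "const_at ?k r False"
      then obtain W where W: "openin S W" "r \<in> W" "\<forall>x\<in>W - X. ?k x = False" unfolding const_at_def by blast
      have "sides h r" using two_sided_sides[OF D(2)] r W'(3) inner_X[OF e] by blast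
      moreover have "openin S (W \<inter> W') \<and> r \<in> W \<inter> W'" using W W'(1) r by auto
      ultimately have "(\<exists>x\<in>W \<inter> W' - X. h x) \<and> (\<exists>x\<in>W \<inter> W' - X. \<not> h x)" unfolding sides_def by blast
      then obtain x1 x2 where x: "x1 \<in> W \<inter> W' - X" "h x1" "x2 \<in> W \<inter> W' - X" "\<not> h x2" by blast
      then have "?k x1 = c" "?k x2 = d" using W'(4)[of x1] W'(4)[of x2] by auto
      then show "\<not> c \<and> \<not> d" using W(3) x by blast
    next
      assume "\<not> c \<and> \<not> d"
      then have "\<forall>x\<in>W' - X. ?k x = False" using W'(4) by simp
      then show "const_at ?k r False" unfolding const_at_def using W'(1) r by blast
    qed
    then have "\<forall>r\<in>W' \<inter> inner e. const_at ?k r False = const_at ?k s False" using W'(2) s by blast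
    then show ?thesis unfolding A_def using W'(1,2) by blast
  qed
  have "inner e \<subseteq> A True \<union> A False" using mA by (metis (full_types) UnCI subsetI)
  moreover have "A True \<inter> A False \<inter> inner e = {}" using nA by blast
  moreover have "A True \<inter> inner e \<noteq> {}" "A False \<inter> inner e \<noteq> {}"
    using mA[OF r] mA[OF r'(1)] r nf r' by auto
  ultimately show False using connectedinD[OF connectedin_inner[OF e] oA oA] by blast
qed

text \<open>Every face that touches the edge comes close to its midpoint, and there the complement
  of the drawing has only two sides.\<close>

lemma edge_touches_two:
  assumes e: "e \<in> E"
  shows "finite {f \<in> faces. touches f e}" "card {f \<in> faces. touches f e} \<le> 2"
proof -
  let ?s = "\<gamma> e (1/2)"
  have s: "?s \<in> inner e" by (rule inner_nonempty)
  obtain D h where D: "?s \<in> D" "two_sided S X D h" "D \<inter> X \<subseteq> inner e" by (rule edge_two_sided[OF e s])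
  have sDX: "?s \<in> D \<inter> X" using D(1) inner_X[OF e] s by blast
  have "?s \<in> topspace S" using s inner_S[OF e] by blast
  from two_sidedD(3)[OF D(2) sDX openin_topspace this]
  obtain W where W: "openin S W" "?s \<in> W" and ex: "\<exists>x\<in>W - X. h x" "\<exists>x\<in>W - X. \<not> h x"
    and j: "\<forall>x\<in>W - X. \<forall>y\<in>W - X. h x = h y \<longrightarrow> join_within S (topspace S - X) x y"
    by (elim exE conjE) (rule that)
  obtain x1 where x1: "x1 \<in> W - X" "h x1" using ex(1) by blast
  obtain x2 where x2: "x2 \<in> W - X" "\<not> h x2" using ex(2) by blast
  have sub: "{f \<in> faces. touches f e} \<subseteq> {face x1, face x2}"
  proof
    fix f assume "f \<in> {f \<in> faces. touches f e}"
    then have f: "f \<in> faces" "touches f e" by auto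
    have "\<not> const_at (\<lambda>x. x \<in> f) ?s False" by (rule touches_everywhere[OF f(1) e f(2) s])
    then obtain x where x: "x \<in> W - X" "x \<in> f" unfolding const_at_def using W by blast
    have "join_within S (topspace S - X) x (if h x then x1 else x2)" using j x(1) x1 x2 by auto
    then have "(if h x then x1 else x2) \<in> face x" unfolding face_def by simp
    then have "face (if h x then x1 else x2) = f" using face_eq faces_face[OF f(1) x(2)] by blast
    then show "f \<in> {face x1, face x2}" by (auto split: if_splits)
  qed
  then show "finite {f \<in> faces. touches f e}" by (rule finite_subset) simp
  have "card {f \<in> faces. touches f e} \<le> card {face x1, face x2}" by (rule card_mono[OF _ sub]) simp
  also have "\<dots> \<le> 2" by (simp add: card_insert_if)
  finally show "card {f \<in> faces. touches f e} \<le> 2" .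
qed

text \<open>Delete the edges that \<open>f\<close> does not touch. The indicator of \<open>f\<close>
  is still locally constant off the remaining subgraph, because it is false near the deleted edges.
  With at most two edges left it would be constant, so \<open>f\<close> would be the entire
  complement of the subgraph.\<close>

lemma face_touches_three:
  assumes E3: "card E \<ge> 3" and f: "f \<in> faces"
  shows "card {e \<in> E. touches f e} \<ge> 3"
proof (rule ccontr)
  let ?E = "{e \<in> E. touches f e}"
  assume "\<not> card ?E \<ge> 3"
  then have c2: "card ?E \<le> 2" by simp
  interpret sub: surface_graph S V ?E p \<gamma>
    by (rule surface_graph_subset[OF surface_graph_axioms]) blast
  have XX: "sub.X \<subseteq> X" unfolding sub.X_def X_def by blast
  have "\<exists>b. \<forall>x\<in>topspace S - sub.X. (x \<in> f) = b"
  proof (rule sub.connected_off_two_edges[OF c2])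
    fix q assume q: "q \<in> topspace S - sub.X"
    have fX: "f \<inter> X = {}" using f face_sub unfolding faces_def by blast
    have ff: "\<exists>b'. sub.const_at (\<lambda>x. x \<in> f) q b'"
    proof (cases "q \<in> X")
      case False
      then have "q \<in> topspace S - X" using q by simp
      from face_flat[OF f this] obtain W b where W: "openin S W" "q \<in> W" "\<forall>x\<in>W - X. (x \<in> f) = b"
        unfolding flat_def const_at_def by (elim exE conjE) (rule that)
      have "openin S (W - X)" "q \<in> W - X" using W False closedin_X by auto
      moreover have "\<forall>x\<in>W - X - sub.X. (x \<in> f) = b" using W(3) by blast
      ultimately show ?thesis unfolding sub.const_at_def by blast
    next
      case True
      have "q \<notin> p ` V" using q unfolding sub.X_def by blast
      then obtain e where e: "e \<in> E" "q \<in> inner e" using X_cases True by blast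
      then have "e \<notin> ?E" using q unfolding sub.X_def by blast
      then have "const_at (\<lambda>x. x \<in> f) q False" using e unfolding touches_def by blast
      then obtain W' where W': "openin S W'" "q \<in> W'" "\<forall>x\<in>W' - X. x \<notin> f" unfolding const_at_def by blast
      then have "\<forall>x\<in>W' - sub.X. (x \<in> f) = False" using fX by blast
      then show ?thesis unfolding sub.const_at_def using W'(1,2) by blast
    qed
    then show "sub.flat (\<lambda>x. x \<in> f) q" unfolding sub.flat_def .
  qed
  then obtain b where b: "\<And>x. x \<in> topspace S - sub.X \<Longrightarrow> (x \<in> f) = b" by blast
  obtain x where x: "x \<in> topspace S - X" "f = face x" using f unfolding faces_def by blast
  then have "x \<in> f" "x \<in> topspace S - sub.X" using face_self XX by blast+
  then have b1: "b" using b by blast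
  \<comment> \<open>A deleted edge would now have interior points in \<open>f\<close>, although
    faces avoid the drawing. So nothing was deleted, against the assumption of three edges.\<close>
  have "?E = E"
  proof (rule ccontr)
    assume "?E \<noteq> E"
    then obtain e where e: "e \<in> E" "e \<notin> ?E" by blast
    let ?s = "\<gamma> e (1/2)"
    have s: "?s \<in> inner e" by (rule inner_nonempty)
    have "?s \<notin> sub.X" unfolding sub.X_def
      using s inner_not_p[OF e(1) s] inner_unique[OF e(1) _ s] e(2) by blast
    then have "?s \<in> f" using b b1 s inner_S[OF e(1)] by blast
    moreover have "f \<subseteq> topspace S - X" using x face_sub by blast
    ultimately show False using s inner_X[OF e(1)] by blast
  qed
  then show False using E3 c2 by simp
qed

lemma finite_faces:
  assumes "card E \<ge> 3"
  shows "finite faces"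
proof -
  have "faces \<subseteq> (\<Union>e\<in>E. {f \<in> faces. touches f e})"
  proof
    fix f assume f: "f \<in> faces"
    have "{e \<in> E. touches f e} \<noteq> {}" using face_touches_three[OF assms f] by (metis card.empty not_numeral_le_zero)
    then show "f \<in> (\<Union>e\<in>E. {f \<in> faces. touches f e})" using f by blast
  qed
  moreover have "finite (\<Union>e\<in>E. {f \<in> faces. touches f e})" using finite_E edge_touches_two(1) by blast
  ultimately show ?thesis by (rule finite_subset)
qed

lemma faces_edges:
  assumes "card E \<ge> 3"
  shows "3 * card faces \<le> 2 * card E"
proof -
  have "3 * card faces = (\<Sum>f\<in>faces. 3)" by simp
  also have "\<dots> \<le> (\<Sum>f\<in>faces. card {e \<in> E. touches f e})"
    using face_touches_three[OF assms] by (rule sum_mono)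
  also have "\<dots> = (\<Sum>e\<in>E. card {f \<in> faces. touches f e})"
    using sum.swap_restrict[OF finite_faces[OF assms] finite_E, of "\<lambda>_ _. 1::nat" touches] by simp
  also have "\<dots> \<le> (\<Sum>e\<in>E. 2)" using edge_touches_two(2) by (rule sum_mono)
  finally show ?thesis by simp
qed

text \<open>A sheet defined on the whole surface is therefore a colouring of the faces with two
  colours.\<close>

lemma valid_const_on_face:
  assumes v: "valid z (topspace S) k" and z: "z \<subseteq> E" and f: "f \<in> faces" and xy: "x \<in> f" "y \<in> f"
  shows "k x = k y"
proof -
  have "y \<in> face x" using faces_face[OF f xy(1)] xy(2) by simp
  then show ?thesis
    unfolding face_def using join_within_const[of "topspace S" x y k] valid_flat_off[OF v z] by blast
qed

end

section \<open>Double covers\<close>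

context surface_graph
begin

text \<open>Equality of germs at \<open>q\<close>. For an even edge set the points of the double
  cover above \<open>q\<close> are the two classes of valid functions under this relation, and
  negation interchanges them.\<close>

definition agree :: "('b \<Rightarrow> bool) \<Rightarrow> ('b \<Rightarrow> bool) \<Rightarrow> 'b \<Rightarrow> bool" where
  "agree j k q \<longleftrightarrow> (\<exists>W. openin S W \<and> q \<in> W \<and> (\<forall>x\<in>W - X. j x = k x))"

definition valid_at :: "'a set set \<Rightarrow> ('b \<Rightarrow> bool) \<Rightarrow> 'b \<Rightarrow> bool" where
  "valid_at z k q \<longleftrightarrow> (\<exists>U. q \<in> U \<and> valid z U k)"

lemma agree_refl: "q \<in> topspace S \<Longrightarrow> agree k k q"
  unfolding agree_def by blast

lemma agree_sym: "agree j k q \<Longrightarrow> agree k j q"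
  unfolding agree_def by metis

lemma agree_trans:
  assumes "agree j k q" "agree k l q" shows "agree j l q"
proof -
  obtain W W' where W: "openin S W" "q \<in> W" "\<forall>x\<in>W - X. j x = k x" "openin S W'" "q \<in> W'" "\<forall>x\<in>W' - X. k x = l x"
    using assms unfolding agree_def by blast
  have "\<forall>x\<in>W \<inter> W' - X. j x = l x" using W by simp
  moreover have "openin S (W \<inter> W')" "q \<in> W \<inter> W'" using W by auto
  ultimately show ?thesis unfolding agree_def by blast
qed

lemma agree_not: "agree j k q \<Longrightarrow> agree (\<lambda>x. \<not> j x) (\<lambda>x. \<not> k x) q"
  unfolding agree_def by simp

lemma agree_not2: "agree j (\<lambda>x. \<not> k x) q \<Longrightarrow> agree (\<lambda>x. \<not> j x) k q"
  using agree_not[of j "\<lambda>x. \<not> k x" q] by simp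

lemma not_agree_both: "agree j k q \<Longrightarrow> \<not> agree j (\<lambda>x. \<not> k x) q"
proof
  assume "agree j k q" "agree j (\<lambda>x. \<not> k x) q"
  from agree_trans[OF agree_sym[OF this(1)] this(2)]
  obtain W where W: "openin S W" "q \<in> W" "\<forall>x\<in>W - X. k x = (\<not> k x)" unfolding agree_def by blast
  then show False using nonempty_off_X[OF W(1,2)] by blast
qed

lemma agree_val: "agree j k q \<Longrightarrow> q \<notin> X \<Longrightarrow> j q = k q" unfolding agree_def by blast

text \<open>The exclusive or of two valid functions for the same edge set is valid for the empty
  set, hence constant on a disc. Over a disc there are thus only two sheets.\<close>

lemma valid_differ:
  assumes z: "z \<subseteq> E" and v: "valid z W j" "valid z W' k" and D: "openin S D" "connectedin S D" "D \<subseteq> W \<inter> W'"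
  obtains b where "\<And>x. x \<in> D - X \<Longrightarrow> (j x \<noteq> k x) = b"
proof -
  have "valid z D j" "valid z D k" using valid_subset v D by blast+
  then have "valid (sym_diff z z) D (\<lambda>x. j x \<noteq> k x)" by (rule valid_xor[OF _ _ z z])
  then have "valid {} D (\<lambda>x. j x \<noteq> k x)" by simp
  from valid_empty_const[OF this D(2)] show thesis using that by blast
qed

lemma valid_agree:
  assumes "valid_at z j q" "agree j k q" shows "valid_at z k q"
proof -
  obtain U where U: "q \<in> U" "valid z U j" using assms(1) unfolding valid_at_def by blast
  obtain W where W: "openin S W" "q \<in> W" "\<forall>x\<in>W - X. j x = k x" using assms(2) unfolding agree_def by blast
  have o: "openin S (U \<inter> W)" using valid_open[OF U(2)] W(1) by blast
  have "valid z (U \<inter> W) k"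
    unfolding valid_def
  proof (intro conjI ballI o)
    fix r assume r: "r \<in> U \<inter> W - p ` V"
    have "flat j r = flat k r" by (rule flat_cong[OF W(1)]) (use r W(3) in auto)
    moreover have "flat j r \<longleftrightarrow> r \<notin> (\<Union>e\<in>z. inner e)" by (rule valid_flat[OF U(2)]) (use r in auto)
    ultimately show "flat k r \<longleftrightarrow> r \<notin> (\<Union>e\<in>z. inner e)" by simp
  qed
  then show ?thesis unfolding valid_at_def using U W by blast
qed

lemma agree_or_not:
  assumes z: "z \<subseteq> E" and v: "valid_at z j q" "valid_at z k q"
  shows "agree j k q \<or> agree j (\<lambda>x. \<not> k x) q"
proof -
  obtain W W' where W: "q \<in> W" "valid z W j" "q \<in> W'" "valid z W' k" using v unfolding valid_at_def by blast
  have "openin S (W \<inter> W')" "q \<in> W \<inter> W'" using W valid_open by blast+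
  then obtain D where D: "openin S D" "q \<in> D" "D \<subseteq> W \<inter> W'" "connectedin S D" using disc_nbhd by metis
  obtain b where b: "\<And>x. x \<in> D - X \<Longrightarrow> (j x \<noteq> k x) = b" using valid_differ[OF z W(2,4) D(1,4,3)] by blast
  show ?thesis
  proof (cases b)
    case True
    then have "\<forall>x\<in>D - X. j x = (\<not> k x)" using b by blast
    then show ?thesis unfolding agree_def using D(1,2) by blast
  next
    case False
    then have "\<forall>x\<in>D - X. j x = k x" using b by blast
    then show ?thesis unfolding agree_def using D(1,2) by blast
  qed
qed

text \<open>A section along a map \<open>f\<close> is a continuous choice of germs of valid functions at the
  points \<open>f t\<close>, i.e. a lift of \<open>f\<close> to the double cover given by \<open>z\<close>.\<close>
definition section_on :: "'a set set \<Rightarrow> ('c::topological_space \<Rightarrow> 'b) \<Rightarrow> 'c set \<Rightarrow> ('c \<Rightarrow> 'b \<Rightarrow> bool) \<Rightarrow> bool" where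
  "section_on z f K k \<longleftrightarrow> (\<forall>t\<in>K. \<exists>N W j. open N \<and> t \<in> N \<and> valid z W j \<and>
     (\<forall>t'\<in>N \<inter> K. f t' \<in> W \<and> agree j (k t') (f t')))"

lemma section_onD:
  assumes "section_on z f K k" "t \<in> K"
  obtains N W j where "open N" "t \<in> N" "valid z W j" "\<And>t'. t' \<in> N \<Longrightarrow> t' \<in> K \<Longrightarrow> f t' \<in> W"
    "\<And>t'. t' \<in> N \<Longrightarrow> t' \<in> K \<Longrightarrow> agree j (k t') (f t')"
proof -
  from assms obtain N W j where "open N" "t \<in> N" "valid z W j" "\<forall>t'\<in>N \<inter> K. f t' \<in> W \<and> agree j (k t') (f t')"
    unfolding section_on_def by meson
  then show thesis by (intro that[of N W j]) auto
qed

lemma section_on_subset: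
  assumes "section_on z f K k" and sub: "K' \<subseteq> K"
  shows "section_on z f K' k"
  unfolding section_on_def
proof
  fix t assume "t \<in> K'"
  then have "t \<in> K" using sub by blast
  then obtain N W j where N: "open N" "t \<in> N" "valid z W j" "\<And>t'. t' \<in> N \<Longrightarrow> t' \<in> K \<Longrightarrow> f t' \<in> W"
    "\<And>t'. t' \<in> N \<Longrightarrow> t' \<in> K \<Longrightarrow> agree j (k t') (f t')" by (rule section_onD[OF assms(1)]) (rule that)
  then have "\<forall>t'\<in>N \<inter> K'. f t' \<in> W \<and> agree j (k t') (f t')" using sub by blast
  then show "\<exists>N W j. open N \<and> t \<in> N \<and> valid z W j \<and> (\<forall>t'\<in>N \<inter> K'. f t' \<in> W \<and> agree j (k t') (f t'))"
    using N(1-3) by blast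
qed

lemma section_on_cong:
  assumes "section_on z f K k" "\<And>t. t \<in> K \<Longrightarrow> f t = f' t"
  shows "section_on z f' K k"
  unfolding section_on_def
proof
  fix t assume "t \<in> K"
  then obtain N W j where N: "open N" "t \<in> N" "valid z W j" "\<And>t'. t' \<in> N \<Longrightarrow> t' \<in> K \<Longrightarrow> f t' \<in> W"
    "\<And>t'. t' \<in> N \<Longrightarrow> t' \<in> K \<Longrightarrow> agree j (k t') (f t')" by (rule section_onD[OF assms(1)]) (rule that)
  then have "\<forall>t'\<in>N \<inter> K. f' t' \<in> W \<and> agree j (k t') (f' t')" using assms(2) by auto
  then show "\<exists>N W j. open N \<and> t \<in> N \<and> valid z W j \<and> (\<forall>t'\<in>N \<inter> K. f' t' \<in> W \<and> agree j (k t') (f' t'))"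
    using N(1-3) by blast
qed

lemma section_on_not:
  assumes "section_on z f K k" shows "section_on z f K (\<lambda>t x. \<not> k t x)"
  unfolding section_on_def
proof
  fix t assume "t \<in> K"
  then obtain N W j where N: "open N" "t \<in> N" "valid z W j" "\<And>t'. t' \<in> N \<Longrightarrow> t' \<in> K \<Longrightarrow> f t' \<in> W"
    "\<And>t'. t' \<in> N \<Longrightarrow> t' \<in> K \<Longrightarrow> agree j (k t') (f t')" by (rule section_onD[OF assms]) (rule that)
  then have "\<forall>t'\<in>N \<inter> K. f t' \<in> W \<and> agree (\<lambda>x. \<not> j x) (\<lambda>x. \<not> k t' x) (f t')" using agree_not by blast
  then show "\<exists>N W j. open N \<and> t \<in> N \<and> valid z W j \<and> (\<forall>t'\<in>N \<inter> K. f t' \<in> W \<and> agree j (\<lambda>x. \<not> k t' x) (f t'))"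
    using N(1,2) valid_not[OF N(3)] by blast
qed

lemma section_on_const:
  assumes v: "valid z W j" and f: "\<And>t. t \<in> K \<Longrightarrow> f t \<in> W"
  shows "section_on z f K (\<lambda>t. j)"
proof -
  have "W \<subseteq> topspace S" using valid_open[OF v] openin_subset by blast
  then have "\<forall>t\<in>K. f t \<in> W \<and> agree j j (f t)" using f agree_refl by blast
  then show ?thesis unfolding section_on_def using v open_UNIV by blast
qed

lemma section_valid_at: "section_on z f K k \<Longrightarrow> t \<in> K \<Longrightarrow> valid_at z (k t) (f t)"
proof -
  assume "section_on z f K k" "t \<in> K"
  then obtain N W j where "open N" "t \<in> N" "valid z W j" "\<And>t'. t' \<in> N \<Longrightarrow> t' \<in> K \<Longrightarrow> f t' \<in> W"
    "\<And>t'. t' \<in> N \<Longrightarrow> t' \<in> K \<Longrightarrow> agree j (k t') (f t')" by (rule section_onD) (rule that)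
  then have "f t \<in> W" "agree j (k t) (f t)" using \<open>t \<in> K\<close> by simp_all
  with \<open>valid z W j\<close> have "valid_at z j (f t)" unfolding valid_at_def by blast
  from valid_agree[OF this \<open>agree j (k t) (f t)\<close>] show ?thesis .
qed

lemma continuous_nbhd:
  assumes "continuous_map (top_of_set K) S f" "t \<in> K" "openin S D" "f t \<in> D"
  obtains N where "open N" "t \<in> N" "\<And>t'. t' \<in> N \<Longrightarrow> t' \<in> K \<Longrightarrow> f t' \<in> D"
proof -
  have "openin (top_of_set K) {u \<in> topspace (top_of_set K). f u \<in> D}"
    by (rule openin_continuous_map_preimage[OF assms(1,3)])
  then obtain N where N: "open N" "{u \<in> K. f u \<in> D} = K \<inter> N" unfolding openin_open by auto
  have "t \<in> K \<inter> N" unfolding N(2)[symmetric] using assms by simp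
  moreover have "f t' \<in> D" if "t' \<in> N" "t' \<in> K" for t'
    using that N(2) by blast
  ultimately show thesis using that N(1) by blast
qed

text \<open>Near \<open>t\<close> both sections are compared with a single sheet \<open>j\<close>
  chosen to follow \<open>k\<close>; whether \<open>l\<close> follows it as well is decided at
  \<open>t\<close>. The sets \<open>K1\<close> and \<open>K2\<close> may coincide, for uniqueness of
  lifts, or be the two pieces of a glued domain.\<close>

lemma sections_compare:
  assumes z: "z \<subseteq> E" and f: "continuous_map (top_of_set K) S f"
    and k: "section_on z f K1 k" and l: "section_on z f K2 l" and t: "t \<in> K1" "t \<in> K2" "t \<in> K"
  obtains N W j where "open N" "t \<in> N" "valid z W j" "\<And>t'. t' \<in> N \<Longrightarrow> t' \<in> K \<Longrightarrow> f t' \<in> W"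
    "\<And>t'. t' \<in> N \<Longrightarrow> t' \<in> K1 \<Longrightarrow> t' \<in> K \<Longrightarrow> agree j (k t') (f t')"
    "\<And>t'. t' \<in> N \<Longrightarrow> t' \<in> K2 \<Longrightarrow> t' \<in> K \<Longrightarrow> agree j (l t') (f t') = agree (k t) (l t) (f t)"
proof -
  obtain N1 W1 j1 where 1: "open N1" "t \<in> N1" "valid z W1 j1" "\<And>t'. t' \<in> N1 \<Longrightarrow> t' \<in> K1 \<Longrightarrow> f t' \<in> W1"
    "\<And>t'. t' \<in> N1 \<Longrightarrow> t' \<in> K1 \<Longrightarrow> agree j1 (k t') (f t')" by (rule section_onD[OF k t(1)]) (rule that)
  obtain N2 W2 j2 where 2: "open N2" "t \<in> N2" "valid z W2 j2" "\<And>t'. t' \<in> N2 \<Longrightarrow> t' \<in> K2 \<Longrightarrow> f t' \<in> W2"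
    "\<And>t'. t' \<in> N2 \<Longrightarrow> t' \<in> K2 \<Longrightarrow> agree j2 (l t') (f t')" by (rule section_onD[OF l t(2)]) (rule that)
  have ft: "f t \<in> W1 \<inter> W2" using 1(2,4) 2(2,4) t by blast
  have "openin S (W1 \<inter> W2)" using valid_open 1(3) 2(3) by blast
  then obtain D where D: "openin S D" "f t \<in> D" "D \<subseteq> W1 \<inter> W2" "connectedin S D" using disc_nbhd ft by metis
  obtain b where b: "\<And>x. x \<in> D - X \<Longrightarrow> (j1 x \<noteq> j2 x) = b"
    by (rule valid_differ[OF z 1(3) 2(3) D(1,4,3)]) (rule that)
  have b1: "agree j1 j2 q \<longleftrightarrow> \<not> b" if q: "q \<in> D" for q
  proof (cases b)
    case True
    then have "\<forall>x\<in>D - X. j1 x = (\<not> j2 x)" using b by blast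
    then have "agree j1 (\<lambda>x. \<not> j2 x) q" unfolding agree_def using D(1) q by blast
    then show ?thesis using not_agree_both True by blast
  next
    case False
    then have "\<forall>x\<in>D - X. j1 x = j2 x" using b by blast
    then show ?thesis unfolding agree_def using D(1) q False by blast
  qed
  obtain N0 where N0: "open N0" "t \<in> N0" "\<And>t'. t' \<in> N0 \<Longrightarrow> t' \<in> K \<Longrightarrow> f t' \<in> D"
    by (rule continuous_nbhd[OF f t(3) D(1,2)]) (rule that)
  show thesis
  proof (rule that[of "N0 \<inter> N1 \<inter> N2" D j1])
    show "open (N0 \<inter> N1 \<inter> N2)" "t \<in> N0 \<inter> N1 \<inter> N2" using 1 2 N0 by auto
    show "valid z D j1" by (rule valid_subset[OF 1(3) D(1)]) (use D(3) in blast)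
    have l_iff: "agree j1 (l t') (f t') \<longleftrightarrow> \<not> b" if t': "t' \<in> N0 \<inter> N2" "t' \<in> K2" "t' \<in> K" for t'
    proof -
      have "agree j2 (l t') (f t')" using 2(5) t' by blast
      then have "agree j1 (l t') (f t') \<longleftrightarrow> agree j1 j2 (f t')" using agree_trans agree_sym by blast
      then show ?thesis using b1 N0(3) t' by blast
    qed
    have "agree j1 (k t) (f t)" using 1(2,5) t by blast
    then have "agree (k t) (l t) (f t) \<longleftrightarrow> agree j1 (l t) (f t)" using agree_trans agree_sym by blast
    then have tt: "agree (k t) (l t) (f t) \<longleftrightarrow> \<not> b" using l_iff N0(2) 2(2) t by blast
    fix t' assume t': "t' \<in> N0 \<inter> N1 \<inter> N2" "t' \<in> K"
    then show "f t' \<in> D" using N0(3) by blast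
    show "agree j1 (k t') (f t')" if "t' \<in> K1" using 1(5) t' that by blast
    show "agree j1 (l t') (f t') = agree (k t) (l t) (f t)" if "t' \<in> K2" using l_iff tt t' that by blast
  qed
qed

text \<open>Uniqueness of lifts to a covering: agreement of two sections is locally constant in the
  parameter.\<close>

lemma section_unique:
  assumes z: "z \<subseteq> E" and K: "connected K" and f: "continuous_map (top_of_set K) S f"
    and k: "section_on z f K k" and l: "section_on z f K l" and t: "t \<in> K" "u \<in> K"
  shows "agree (k t) (l t) (f t) = agree (k u) (l u) (f u)"
proof (rule connected_local_const[OF K t])
  show "\<forall>a\<in>K. \<forall>\<^sub>F b in at a within K. agree (k a) (l a) (f a) = agree (k b) (l b) (f b)"
  proof
    fix a assume a: "a \<in> K"
    obtain N W j where N: "open N" "a \<in> N" "\<And>t'. t' \<in> N \<Longrightarrow> t' \<in> K \<Longrightarrow> t' \<in> K \<Longrightarrow> agree j (k t') (f t')"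
      "\<And>t'. t' \<in> N \<Longrightarrow> t' \<in> K \<Longrightarrow> t' \<in> K \<Longrightarrow> agree j (l t') (f t') = agree (k a) (l a) (f a)"
      by (rule sections_compare[OF z f k l a a a]) (rule that)
    have "agree (k a) (l a) (f a) = agree (k b) (l b) (f b)" if b: "b \<in> N" "b \<in> K" for b
    proof -
      have "agree j (k b) (f b)" using N(3) b by blast
      then have "agree (k b) (l b) (f b) \<longleftrightarrow> agree j (l b) (f b)" using agree_trans agree_sym by blast
      then show ?thesis using N(4)[OF b b(2)] by simp
    qed
    then show "\<forall>\<^sub>F b in at a within K. agree (k a) (l a) (f a) = agree (k b) (l b) (f b)"
      unfolding eventually_at_topological using N(1,2) by blast
  qed
qed

lemma section_glue_agree:
  assumes z: "z \<subseteq> E" and K: "closed K1" "closed K2" and f: "continuous_map (top_of_set (K1 \<union> K2)) S f"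
    and k: "section_on z f K1 k" and l: "section_on z f K2 l"
    and ag: "\<And>t. t \<in> K1 \<inter> K2 \<Longrightarrow> agree (k t) (l t) (f t)"
  shows "section_on z f (K1 \<union> K2) (\<lambda>t. if t \<in> K1 then k t else l t)"
  unfolding section_on_def
proof
  fix t assume t: "t \<in> K1 \<union> K2"
  let ?m = "\<lambda>t. if t \<in> K1 then k t else l t"
  consider "t \<in> K1 \<inter> K2" | "t \<in> K1 - K2" | "t \<in> K2 - K1" using t by blast
  then show "\<exists>N W j. open N \<and> t \<in> N \<and> valid z W j \<and> (\<forall>t'\<in>N \<inter> (K1 \<union> K2). f t' \<in> W \<and> agree j (?m t') (f t'))"
  proof cases
    case 1
    then have tk: "t \<in> K1" "t \<in> K2" by auto
    obtain N W j where N: "open N" "t \<in> N" "valid z W j" "\<And>t'. t' \<in> N \<Longrightarrow> t' \<in> K1 \<union> K2 \<Longrightarrow> f t' \<in> W"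
      "\<And>t'. t' \<in> N \<Longrightarrow> t' \<in> K1 \<Longrightarrow> t' \<in> K1 \<union> K2 \<Longrightarrow> agree j (k t') (f t')"
      "\<And>t'. t' \<in> N \<Longrightarrow> t' \<in> K2 \<Longrightarrow> t' \<in> K1 \<union> K2 \<Longrightarrow> agree j (l t') (f t') = agree (k t) (l t) (f t)"
      by (rule sections_compare[OF z f k l tk t]) (rule that)
    have "agree j (?m t') (f t')" if "t' \<in> N" "t' \<in> K1 \<union> K2" for t'
      using N(5,6)[OF that(1) _ that(2)] ag[OF 1] that(2) by auto
    then show ?thesis using N(1-4) by blast
  next
    case 2
    then have "t \<in> K1" by blast
    then obtain N W j where N: "open N" "t \<in> N" "valid z W j" "\<And>t'. t' \<in> N \<Longrightarrow> t' \<in> K1 \<Longrightarrow> f t' \<in> W"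
      "\<And>t'. t' \<in> N \<Longrightarrow> t' \<in> K1 \<Longrightarrow> agree j (k t') (f t')" by (rule section_onD[OF k]) (rule that)
    have o: "open (N - K2)" "t \<in> N - K2" using N(1,2) K(2) 2 by (auto intro: open_Diff)
    have "\<forall>t'\<in>(N - K2) \<inter> (K1 \<union> K2). f t' \<in> W \<and> agree j (?m t') (f t')"
    proof
      fix t' assume "t' \<in> (N - K2) \<inter> (K1 \<union> K2)"
      then have "t' \<in> N" "t' \<in> K1" "t' \<notin> K2" by auto
      then show "f t' \<in> W \<and> agree j (?m t') (f t')" using N(4)[of t'] N(5)[of t'] by simp
    qed
    then show ?thesis using o N(3) by blast
  next
    case 3
    then have "t \<in> K2" by blast
    then obtain N W j where N: "open N" "t \<in> N" "valid z W j" "\<And>t'. t' \<in> N \<Longrightarrow> t' \<in> K2 \<Longrightarrow> f t' \<in> W"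
      "\<And>t'. t' \<in> N \<Longrightarrow> t' \<in> K2 \<Longrightarrow> agree j (l t') (f t')" by (rule section_onD[OF l]) (rule that)
    have o: "open (N - K1)" "t \<in> N - K1" using N(1,2) K(1) 3 by (auto intro: open_Diff)
    have "\<forall>t'\<in>(N - K1) \<inter> (K1 \<union> K2). f t' \<in> W \<and> agree j (?m t') (f t')"
    proof
      fix t' assume "t' \<in> (N - K1) \<inter> (K1 \<union> K2)"
      then have "t' \<in> N" "t' \<in> K2" "t' \<notin> K1" by auto
      then show "f t' \<in> W \<and> agree j (?m t') (f t')" using N(4)[of t'] N(5)[of t'] by simp
    qed
    then show ?thesis using o N(3) by blast
  qed
qed

text \<open>On the connected overlap two sections agree everywhere or nowhere. In the second case
  one of them is replaced by its negation, the lift to the other sheet.\<close>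

lemma section_glue:
  assumes z: "z \<subseteq> E" and K: "closed K1" "closed K2" "connected (K1 \<inter> K2)"
    and f: "continuous_map (top_of_set (K1 \<union> K2)) S f"
    and k: "section_on z f K1 k" and l: "section_on z f K2 l"
  shows "\<exists>m. section_on z f (K1 \<union> K2) m"
proof -
  have "\<exists>l'. section_on z f K2 l' \<and> (\<forall>t\<in>K1 \<inter> K2. agree (k t) (l' t) (f t))"
  proof (cases "K1 \<inter> K2 = {}")
    case True
    then show ?thesis using l by blast
  next
    case False
    then obtain t0 where t0: "t0 \<in> K1 \<inter> K2" by blast
    have "valid_at z (k t0) (f t0)" "valid_at z (l t0) (f t0)"
      using section_valid_at[OF k, of t0] section_valid_at[OF l, of t0] t0 by auto
    from agree_or_not[OF z this]
    obtain l' where l': "section_on z f K2 l'" "agree (k t0) (l' t0) (f t0)"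
    proof
      assume "agree (k t0) (l t0) (f t0)" then show thesis by (rule that[OF l])
    next
      assume "agree (k t0) (\<lambda>x. \<not> l t0 x) (f t0)" then show thesis by (rule that[OF section_on_not[OF l]])
    qed
    have f': "continuous_map (top_of_set (K1 \<inter> K2)) S f"
      by (rule continuous_map_from_subtopology_mono[OF f]) blast
    have "agree (k t) (l' t) (f t)" if "t \<in> K1 \<inter> K2" for t
      using section_unique[OF z K(3) f' section_on_subset[OF k] section_on_subset[OF l'(1)] t0 that] l'(2) by blast
    then show ?thesis using l'(1) by blast
  qed
  then obtain l' where l': "section_on z f K2 l'" "\<And>t. t \<in> K1 \<inter> K2 \<Longrightarrow> agree (k t) (l' t) (f t)" by blast
  show ?thesis using section_glue_agree[OF z K(1,2) f k l'] by blast
qed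

text \<open>Lifting of a map of the square, by two rounds of bisection. For fixed \<open>x\<close>,
  small rectangles are glued on top of each other into a thin vertical strip; then the strips are
  glued side by side. Adjacent rectangles meet in a convex set, so the overlaps are
  connected.\<close>

lemma section_on_square:
  fixes f :: "real \<times> real \<Rightarrow> 'b"
  assumes z: "even_set z" and f: "continuous_map (top_of_set ({0..1} \<times> {0..1})) S f"
  shows "\<exists>k. section_on z f ({0..1} \<times> {0..1}) k"
proof -
  let ?Q = "{0..1::real} \<times> {0..1::real}"
  have zE: "z \<subseteq> E" using z unfolding even_set_def by blast
  have cQ: "continuous_map (top_of_set K) S f" if "K \<subseteq> ?Q" for K
    by (rule continuous_map_from_subtopology_mono[OF f that])
  have glue: "\<exists>m. section_on z f ((A \<union> B) \<inter> ?Q) m"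
    if AB: "closed A" "closed B" "convex (A \<inter> B)" "\<exists>k. section_on z f (A \<inter> ?Q) k" "\<exists>k. section_on z f (B \<inter> ?Q) k" for A B
  proof -
    obtain k l where kl: "section_on z f (A \<inter> ?Q) k" "section_on z f (B \<inter> ?Q) l" using AB(4,5) by blast
    have "A \<inter> ?Q \<inter> (B \<inter> ?Q) = A \<inter> B \<inter> ?Q" by blast
    moreover have "convex (A \<inter> B \<inter> ?Q)" using AB(3) by (intro convex_Int[of "A \<inter> B"] convex_Times) auto
    ultimately have con: "connected (A \<inter> ?Q \<inter> (B \<inter> ?Q))" by (simp only: convex_connected)
    have "closed (A \<inter> ?Q)" "closed (B \<inter> ?Q)" using AB(1,2) by (auto intro!: closed_Int closed_Times)
    from section_glue[OF zE this con cQ kl] show ?thesis by (metis Int_Un_distrib2 Int_lower2 Un_least)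
  qed
  define R where "R x c d \<longleftrightarrow> (\<exists>\<delta>>0. \<forall>a b. a \<le> x \<and> x \<le> b \<and> b - a < \<delta> \<longrightarrow> (\<exists>k. section_on z f (({a..b} \<times> {c..d}) \<inter> ?Q) k))"
    for x c d :: real
  have R01: "R x 0 1" if x: "0 \<le> x" "x \<le> 1" for x
  proof (rule Bolzano[of 0 1 "R x"])
    fix a b c :: real assume R: "R x a b" "R x b c" and abc: "a \<le> b" "b \<le> c"
    obtain \<delta>1 where 1: "\<delta>1 > 0" "\<forall>s t. s \<le> x \<and> x \<le> t \<and> t - s < \<delta>1 \<longrightarrow> (\<exists>k. section_on z f (({s..t} \<times> {a..b}) \<inter> ?Q) k)"
      using R(1) unfolding R_def by blast
    obtain \<delta>2 where 2: "\<delta>2 > 0" "\<forall>s t. s \<le> x \<and> x \<le> t \<and> t - s < \<delta>2 \<longrightarrow> (\<exists>k. section_on z f (({s..t} \<times> {b..c}) \<inter> ?Q) k)"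
      using R(2) unfolding R_def by blast
    have "\<exists>k. section_on z f (({s..t} \<times> {a..c}) \<inter> ?Q) k" if st: "s \<le> x" "x \<le> t" "t - s < min \<delta>1 \<delta>2" for s t
    proof -
      have eq: "{s..t} \<times> {a..c} = {s..t} \<times> {a..b} \<union> {s..t} \<times> {b..c}" using abc by auto
      have "{a..b} \<inter> {b..c} = {b}" using abc by auto
      then have "{s..t} \<times> {a..b} \<inter> {s..t} \<times> {b..c} = {s..t} \<times> {b}" by auto
      then have "convex ({s..t} \<times> {a..b} \<inter> {s..t} \<times> {b..c})" by (simp add: convex_Times)
      then show ?thesis unfolding eq using 1(2) 2(2) st by (intro glue) (auto intro!: closed_Times)
    qed
    then show "R x a c" unfolding R_def using 1(1) 2(1) by (intro exI[of _ "min \<delta>1 \<delta>2"]) auto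
  next
    fix y :: real assume y: "0 \<le> y" "y \<le> 1"
    have xy: "(x, y) \<in> ?Q" using x y by auto
    have "f (x, y) \<in> topspace S" using continuous_map_image_subset_topspace[OF f] xy by auto
    then obtain U j where U: "f (x, y) \<in> U" "valid z U j" using local_valid[OF z] by blast
    obtain N where N: "open N" "(x, y) \<in> N" "\<And>t'. t' \<in> N \<Longrightarrow> t' \<in> ?Q \<Longrightarrow> f t' \<in> U"
      by (rule continuous_nbhd[OF f xy valid_open[OF U(2)] U(1)]) (rule that)
    obtain A B where AB: "open A" "open B" "x \<in> A" "y \<in> B" "A \<times> B \<subseteq> N" using N(1,2) by (rule open_prod_elim) auto
    obtain \<delta>1 where 1: "\<delta>1 > 0" "ball x \<delta>1 \<subseteq> A" using AB by (meson open_contains_ball)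
    obtain \<delta>2 where 2: "\<delta>2 > 0" "ball y \<delta>2 \<subseteq> B" using AB by (meson open_contains_ball)
    have "R x c d" if cd: "c \<le> y" "y \<le> d" "d - c < \<delta>2" for c d
    proof -
      have "\<exists>k. section_on z f (({a..b} \<times> {c..d}) \<inter> ?Q) k" if ab: "a \<le> x" "x \<le> b" "b - a < \<delta>1" for a b
      proof -
        have "{a..b} \<subseteq> ball x \<delta>1" "{c..d} \<subseteq> ball y \<delta>2" using ab cd by (auto simp: dist_real_def abs_if)
        then have "{a..b} \<times> {c..d} \<subseteq> N" using 1(2) 2(2) AB(5) by blast
        then have fU: "f t \<in> U" if "t \<in> ({a..b} \<times> {c..d}) \<inter> ?Q" for t using N(3) that by blast
        show ?thesis by (rule exI, rule section_on_const[OF U(2)], rule fU)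
      qed
      then show ?thesis unfolding R_def using 1(1) by blast
    qed
    then show "\<exists>d>0. \<forall>a b. a \<le> y \<and> y \<le> b \<and> b - a < d \<longrightarrow> R x a b" using 2(1) by blast
  qed simp
  define P where "P a b \<longleftrightarrow> (\<exists>k. section_on z f (({a..b} \<times> {0..1}) \<inter> ?Q) k)" for a b :: real
  have "P 0 1"
  proof (rule Bolzano[of 0 1 P])
    fix a b c :: real assume ab: "P a b" "P b c" "a \<le> b" "b \<le> c"
    have eq: "{a..c} \<times> {0..1} = {a..b} \<times> {0..1} \<union> {b..c} \<times> {0..1::real}" using ab by auto
    have "{a..b} \<inter> {b..c} = {b}" using ab by auto
    then have "{a..b} \<times> {0..1} \<inter> {b..c} \<times> {0..1} = {b} \<times> {0..1::real}" by auto
    then have "convex ({a..b} \<times> {0..1} \<inter> {b..c} \<times> {0..1::real})" by (simp add: convex_Times)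
    then show "P a c" unfolding P_def eq using ab(1,2) unfolding P_def by (intro glue) (auto intro!: closed_Times)
  next
    fix x :: real assume "0 \<le> x" "x \<le> 1"
    from R01[OF this] show "\<exists>d>0. \<forall>a b. a \<le> x \<and> x \<le> b \<and> b - a < d \<longrightarrow> P a b" unfolding R_def P_def .
  qed simp
  then show ?thesis unfolding P_def by simp
qed

text \<open>An arbitrary choice of a sheet above each point, with no continuity in \<open>x\<close>.
  It gives a meaning to the monodromy along paths that are not closed, and so makes it a
  cochain.\<close>

definition gauge_for :: "'a set set \<Rightarrow> ('b \<Rightarrow> 'b \<Rightarrow> bool) \<Rightarrow> bool" where
  "gauge_for z s \<longleftrightarrow> (\<forall>x\<in>topspace S. valid_at z (s x) x)"

lemma gauge_exists: "even_set z \<Longrightarrow> \<exists>s. gauge_for z s"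
proof -
  assume z: "even_set z"
  have "\<forall>x. \<exists>k. x \<in> topspace S \<longrightarrow> valid_at z k x" using local_valid[OF z] unfolding valid_at_def by blast
  then show ?thesis unfolding gauge_for_def by metis
qed

text \<open>True if continuing the chosen sheet at the start along \<open>f\<close> leads to the
  other sheet at the end. It is also true of an \<open>f\<close> along which no section
  exists.\<close>

definition holonomy :: "'a set set \<Rightarrow> ('b \<Rightarrow> 'b \<Rightarrow> bool) \<Rightarrow> (real \<Rightarrow> 'b) \<Rightarrow> bool" where
  "holonomy z s f \<longleftrightarrow> \<not> (\<exists>k. section_on z f {0..1} k \<and> agree (k 0) (s (f 0)) (f 0) \<and> agree (k 1) (s (f 1)) (f 1))"

lemma holonomy_cong:
  assumes "\<And>t. t \<in> {0..1} \<Longrightarrow> f t = f' t"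
  shows "holonomy z s f = holonomy z s f'"
proof -
  have "section_on z f {0..1} k = section_on z f' {0..1} k" for k
    using section_on_cong[of z f "{0..1}" k f'] section_on_cong[of z f' "{0..1}" k f] assms by metis
  then show ?thesis unfolding holonomy_def using assms[of 0] assms[of 1] by simp
qed

text \<open>Negating a section reverses its agreement with the gauge at both ends. Whether the two
  agreements coincide is therefore independent of the section, and any single section computes the
  holonomy.\<close>

lemma holonomy_iff:
  assumes z: "z \<subseteq> E" and f: "continuous_map (top_of_set {0..1}) S f" and k: "section_on z f {0..1} k"
    and s: "gauge_for z s"
  shows "holonomy z s f \<longleftrightarrow> agree (k 0) (s (f 0)) (f 0) \<noteq> agree (k 1) (s (f 1)) (f 1)"
proof -
  have fS: "f t \<in> topspace S" if "t \<in> {0..1}" for t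
    using continuous_map_image_subset_topspace[OF f] that by auto
  have sv: "valid_at z (s (f t)) (f t)" if "t \<in> {0..1}" for t using s fS[OF that] unfolding gauge_for_def by blast
  have two: "agree (k t) (s (f t)) (f t) \<longleftrightarrow> \<not> agree (\<lambda>x. \<not> k t x) (s (f t)) (f t)" if t: "t \<in> {0..1}" for t
  proof -
    have "agree (k t) (s (f t)) (f t) \<or> agree (k t) (\<lambda>x. \<not> s (f t) x) (f t)"
      by (rule agree_or_not[OF z section_valid_at[OF k t] sv[OF t]])
    moreover have "agree (k t) (\<lambda>x. \<not> s (f t) x) (f t) \<longleftrightarrow> agree (\<lambda>x. \<not> k t x) (s (f t)) (f t)"
      using agree_not2[of "k t" "s (f t)" "f t"] agree_not[of "\<lambda>x. \<not> k t x" "s (f t)" "f t"] by auto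
    ultimately show ?thesis using not_agree_both by blast
  qed
  have t01: "(0::real) \<in> {0..1}" "(1::real) \<in> {0..1}" by auto
  show ?thesis
  proof
    assume h: "holonomy z s f"
    show "agree (k 0) (s (f 0)) (f 0) \<noteq> agree (k 1) (s (f 1)) (f 1)"
    proof
      assume eq: "agree (k 0) (s (f 0)) (f 0) = agree (k 1) (s (f 1)) (f 1)"
      show False
      proof (cases "agree (k 0) (s (f 0)) (f 0)")
        case True
        then show False using h eq k unfolding holonomy_def by blast
      next
        case False
        then have "agree (\<lambda>x. \<not> k 0 x) (s (f 0)) (f 0)" "agree (\<lambda>x. \<not> k 1 x) (s (f 1)) (f 1)"
          using two[OF t01(1)] two[OF t01(2)] eq by auto
        then show False using h section_on_not[OF k] unfolding holonomy_def by blast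
      qed
    qed
  next
    assume ne: "agree (k 0) (s (f 0)) (f 0) \<noteq> agree (k 1) (s (f 1)) (f 1)"
    show "holonomy z s f"
      unfolding holonomy_def
    proof
      assume "\<exists>l. section_on z f {0..1} l \<and> agree (l 0) (s (f 0)) (f 0) \<and> agree (l 1) (s (f 1)) (f 1)"
      then obtain l where l: "section_on z f {0..1} l" "agree (l 0) (s (f 0)) (f 0)" "agree (l 1) (s (f 1)) (f 1)" by blast
      have "agree (k 0) (l 0) (f 0) = agree (k 1) (l 1) (f 1)"
        by (rule section_unique[OF z connected_Icc f k l(1) t01])
      moreover have "agree (k 0) (l 0) (f 0) \<longleftrightarrow> agree (k 0) (s (f 0)) (f 0)"
        "agree (k 1) (l 1) (f 1) \<longleftrightarrow> agree (k 1) (s (f 1)) (f 1)"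
        using l(2,3) agree_trans agree_sym by blast+
      ultimately show False using ne by simp
    qed
  qed
qed

end

section \<open>Monodromy and first homology\<close>

definition edge_point :: "real \<Rightarrow> nat \<Rightarrow> real" where
  "edge_point t = (\<lambda>i. if i = 0 then 1 - t else if i = 1 then t else 0)"

text \<open>Collapses the side \<open>fst w = 0\<close> of the square to the first vertex of the
  triangle and maps the other three sides to its edges. Sections over the square can thus be used
  for singular triangles.\<close>

definition triangle_point :: "real \<times> real \<Rightarrow> nat \<Rightarrow> real" where
  "triangle_point w = (\<lambda>i. if i = 0 then 1 - fst w else if i = 1 then fst w * (1 - snd w)
     else if i = 2 then fst w * snd w else 0)"

lemma edge_point_simplex: "t \<in> {0..1} \<Longrightarrow> edge_point t \<in> standard_simplex 1"
  unfolding standard_simplex_def edge_point_def by auto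

lemma triangle_point_simplex:
  assumes "w \<in> {0..1} \<times> {0..1}" shows "triangle_point w \<in> standard_simplex 2"
proof -
  obtain u v where w: "w = (u, v)" "u \<in> {0..1}" "v \<in> {0..1}" using assms by blast
  have "0 \<le> triangle_point w i \<and> triangle_point w i \<le> 1" for i
    using w by (auto simp: triangle_point_def mult_le_one)
  moreover have "(\<Sum>i\<le>2. triangle_point w i) = 1"
    using w by (simp add: triangle_point_def numeral_2_eq_2 algebra_simps)
  moreover have "triangle_point w i = 0" if "i > 2" for i using that by (simp add: triangle_point_def)
  ultimately show ?thesis unfolding standard_simplex_def by blast
qed

lemma continuous_triangle_point:
  "continuous_map (top_of_set ({0..1} \<times> {0..1})) (subtopology (powertop_real UNIV) (standard_simplex 2)) triangle_point"
proof (rule continuous_map_into_subtopology)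
  have "continuous_on ({0..1} \<times> {0..1}) (\<lambda>w. triangle_point w i)" for i
    unfolding triangle_point_def by (cases "i = 0"; cases "i = 1"; cases "i = 2") (auto intro!: continuous_intros)
  then show "continuous_map (top_of_set ({0..1} \<times> {0..1})) (powertop_real UNIV) triangle_point"
    unfolding continuous_map_componentwise_UNIV by simp
  show "triangle_point \<in> topspace (top_of_set ({0..1} \<times> {0..1})) \<rightarrow> standard_simplex 2"
    using triangle_point_simplex by auto
qed

lemma triangle_faces:
  "simplical_face 0 (edge_point t) = triangle_point (1, t)"
  "simplical_face 1 (edge_point t) = triangle_point (t, 1)"
  "simplical_face 2 (edge_point t) = triangle_point (t, 0)"
  unfolding simplical_face_def edge_point_def triangle_point_def by (auto simp: fun_eq_iff)

lemma triangle_point_0: "triangle_point (0, v) = triangle_point (0, 0)"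
  unfolding triangle_point_def by (auto simp: fun_eq_iff)

definition path_simplex :: "(real \<Rightarrow> 'b) \<Rightarrow> (nat \<Rightarrow> real) \<Rightarrow> 'b" where
  "path_simplex g = restrict (\<lambda>x. g (x 1)) (standard_simplex 1)"

lemma path_simplex_edge: "t \<in> {0..1} \<Longrightarrow> path_simplex g (edge_point t) = g t"
  unfolding path_simplex_def using edge_point_simplex by (simp add: edge_point_def)

lemma singular_path_simplex:
  assumes "pathin S g" shows "singular_simplex 1 S (path_simplex g)"
proof -
  have "continuous_map (subtopology (powertop_real UNIV) (standard_simplex 1)) (top_of_set {0..1}) (\<lambda>x. x 1)"
  proof (rule continuous_map_into_subtopology)
    show "continuous_map (subtopology (powertop_real UNIV) (standard_simplex 1)) euclideanreal (\<lambda>x. x 1)"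
      by (intro continuous_map_from_subtopology continuous_map_product_projection) simp
  qed (auto simp: standard_simplex_def)
  from continuous_map_compose[OF this assms[unfolded pathin_def]]
  have "continuous_map (subtopology (powertop_real UNIV) (standard_simplex 1)) S (\<lambda>x. g (x 1))" by (simp add: o_def)
  then have "continuous_map (subtopology (powertop_real UNIV) (standard_simplex 1)) S (path_simplex g)"
    by (rule continuous_map_eq) (simp add: path_simplex_def)
  then show ?thesis unfolding singular_simplex_def path_simplex_def by simp
qed

definition point_simplex :: "'b \<Rightarrow> (nat \<Rightarrow> real) \<Rightarrow> 'b" where
  "point_simplex x = restrict (\<lambda>_. x) (standard_simplex 0)"

lemma path_simplex_boundary:
  "chain_boundary 1 (frag_of (path_simplex g)) = frag_of (point_simplex (g 1)) - frag_of (point_simplex (g 0))"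
proof -
  have e: "simplical_face 0 (\<lambda>j. if j = 0 then 1 else 0) = edge_point 1"
    "simplical_face 1 (\<lambda>j. if j = 0 then 1 else 0) = edge_point 0"
    unfolding simplical_face_def edge_point_def by (auto simp: fun_eq_iff)
  have "singular_face 1 0 (path_simplex g) x = point_simplex (g 1) x" for x
    unfolding singular_face_def point_simplex_def using path_simplex_edge[of 1 g]
    by (cases "x \<in> standard_simplex 0") (auto simp: standard_simplex_0 e)
  moreover have "singular_face 1 1 (path_simplex g) x = point_simplex (g 0) x" for x
    unfolding singular_face_def point_simplex_def using path_simplex_edge[of 0 g]
    by (cases "x \<in> standard_simplex 0") (auto simp: standard_simplex_0 e[unfolded One_nat_def])
  ultimately have "singular_face 1 0 (path_simplex g) = point_simplex (g 1)"
    "singular_face 1 1 (path_simplex g) = point_simplex (g 0)" by blast+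
  moreover have "{..1::nat} = {0, 1}" by auto
  ultimately show ?thesis unfolding chain_boundary_of by simp
qed

text \<open>An additive \<open>H\<close> that is even on boundaries induces a homomorphism from the
  first homology to Z/2, which is determined by its values on \<open>b\<close> generators. The
  cycles \<zeta> represent these generators and are fixed before \<open>H\<close>, so one choice
  serves all edge sets at once.\<close>

lemma homology_parity_basis:
  fixes S :: "'b topology"
  assumes iso: "homology_group 1 S \<cong> free_Abelian_group {..<b::nat}"
  obtains \<zeta> :: "nat \<Rightarrow> 'b chain" where
    "\<And>(H :: 'b chain \<Rightarrow> int) \<xi>. (\<And>x y. H (x - y) = H x - H y) \<Longrightarrow>
      (\<And>d. singular_chain 2 S d \<Longrightarrow> even (H (chain_boundary 2 d))) \<Longrightarrow>
      (\<And>j. j < b \<Longrightarrow> even (H (\<zeta> j))) \<Longrightarrow> singular_chain 1 S \<xi> \<Longrightarrow> chain_boundary 1 \<xi> = 0 \<Longrightarrow> even (H \<xi>)"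
proof -
  let ?F = "free_Abelian_group {..<b}" and ?H = "homology_group 1 S"
  have "group ?H" by simp
  then have "?F \<cong> ?H" using iso group.iso_sym by blast
  then obtain \<psi> where \<psi>: "\<psi> \<in> iso ?F ?H" unfolding is_iso_def by blast
  have hom: "\<psi> \<in> hom ?F ?H" and bij: "bij_betw \<psi> (carrier ?F) (carrier ?H)" using \<psi> unfolding iso_def by auto
  interpret \<psi>: group_hom ?F ?H \<psi> using hom by (simp add: group_hom_def group_hom_axioms_def)
  have carH: "carrier ?H = homologous_rel_set 1 S {} ` singular_relcycle_set 1 S {}"
    using carrier_relative_homology_group[of 1 S "{}"] by simp
  have rep: "\<exists>c. singular_relcycle 1 S {} c \<and> \<psi> a = homologous_rel_set 1 S {} c" if "a \<in> carrier ?F" for a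
  proof -
    have "\<psi> a \<in> carrier ?H" using bij that by (rule bij_betw_apply)
    then show ?thesis unfolding carH by blast
  qed
  have "\<exists>c. singular_relcycle 1 S {} c \<and> \<psi> (frag_of j) = homologous_rel_set 1 S {} c" if "j < b" for j
    using rep[of "frag_of j"] that by simp
  then obtain \<zeta> where \<zeta>: "\<And>j. j < b \<Longrightarrow> singular_relcycle 1 S {} (\<zeta> j) \<and> \<psi> (frag_of j) = homologous_rel_set 1 S {} (\<zeta> j)"
    by metis
  show thesis
  proof (rule that[of \<zeta>])
    fix H :: "'b chain \<Rightarrow> int" and \<xi>
    assume add: "\<And>x y. H (x - y) = H x - H y" and bd: "\<And>d. singular_chain 2 S d \<Longrightarrow> even (H (chain_boundary 2 d))"
      and z: "\<And>j. j < b \<Longrightarrow> even (H (\<zeta> j))" and \<xi>: "singular_chain 1 S \<xi>" "chain_boundary 1 \<xi> = 0"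
    \<comment> \<open>The parity of \<open>H\<close> depends only on the homology class.\<close>
    have same: "even (H c) \<longleftrightarrow> even (H c')" if "homologous_rel_set 1 S {} c = homologous_rel_set 1 S {} c'" for c c'
    proof -
      have "homologous_rel 1 S {} c c'" using that homologous_rel_set_eq[of 1 S "{}" c c'] by simp
      then have "singular_relboundary 1 S {} (c - c')" unfolding homologous_rel_def .
      then have "\<exists>d. singular_chain (Suc 1) S d \<and> chain_boundary (Suc 1) d = c - c'"
        unfolding singular_boundary .
      then obtain d where "singular_chain 2 S d" "chain_boundary 2 d = c - c'"
        unfolding Suc_1 by blast
      then have "even (H (c - c'))" using bd by metis
      then show ?thesis unfolding add by simp
    qed
    define P where "P a \<longleftrightarrow> (\<forall>c. singular_relcycle 1 S {} c \<and> \<psi> a = homologous_rel_set 1 S {} c \<longrightarrow> even (H c))" for a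
    have H0: "H 0 = 0" using add[of 0 0] by simp
    have zero: "homologous_rel_set 1 S {} 0 = \<one>\<^bsub>?H\<^esub>"
    proof -
      have "\<one>\<^bsub>?H\<^esub> = singular_relboundary_set 1 S {}" using one_relative_homology_group[of 1 S "{}"] by simp
      also have "\<dots> = homologous_rel_set 1 S {} 0"
        using homologous_rel_set_eq_relboundary[of 1 S "{}" 0] by simp
      finally show ?thesis by simp
    qed
    have P: "a \<in> carrier ?F \<and> P a" if "Poly_Mapping.keys a \<subseteq> {..<b}" for a
      using that
    proof (induction a rule: frag_induction)
      case zero
      have "P 0" unfolding P_def
      proof (intro allI impI)
        fix c assume "singular_relcycle 1 S {} c \<and> \<psi> 0 = homologous_rel_set 1 S {} c"
        then have "homologous_rel_set 1 S {} c = homologous_rel_set 1 S {} 0"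
          using \<psi>.hom_one \<open>homologous_rel_set 1 S {} 0 = \<one>\<^bsub>?H\<^esub>\<close> by simp
        from same[OF this] show "even (H c)" using H0 by simp
      qed
      then show ?case by simp
    next
      case (one j)
      then have j: "j < b" by simp
      have "P (frag_of j)" unfolding P_def
      proof (intro allI impI)
        fix c assume "singular_relcycle 1 S {} c \<and> \<psi> (frag_of j) = homologous_rel_set 1 S {} c"
        then have "homologous_rel_set 1 S {} c = homologous_rel_set 1 S {} (\<zeta> j)" using \<zeta>[OF j] by simp
        from same[OF this] show "even (H c)" using z[OF j] by simp
      qed
      then show ?case using j by simp
    next
      case (diff a b')
      then have ab: "a \<in> carrier ?F" "b' \<in> carrier ?F" "P a" "P b'" by auto
      obtain ca where ca: "singular_relcycle 1 S {} ca" "\<psi> a = homologous_rel_set 1 S {} ca" using rep[OF ab(1)] by blast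
      obtain cb where cb: "singular_relcycle 1 S {} cb" "\<psi> b' = homologous_rel_set 1 S {} cb" using rep[OF ab(2)] by blast
      have "a - b' \<in> carrier ?F" using ab by (simp add: keys_diff[THEN subset_trans])
      then obtain cd where cd: "singular_relcycle 1 S {} cd" "\<psi> (a - b') = homologous_rel_set 1 S {} cd" using rep by blast
      \<comment> \<open>The product in the homology group is multiplication of cosets of boundaries,
        so it is represented by the sum of cycles.\<close>
      have addset: "homologous_rel_set 1 S {} x \<otimes>\<^bsub>?H\<^esub> homologous_rel_set 1 S {} y = homologous_rel_set 1 S {} (x + y)"
        if "singular_relcycle 1 S {} x" "singular_relcycle 1 S {} y" for x y
      proof -
        let ?R = "relcycle_group 1 S {}" and ?B = "singular_relboundary_set 1 S {}"
        interpret N: normal ?B ?R by (rule normal_subgroup_singular_relboundary_relcycle)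
        have m: "(\<otimes>\<^bsub>?H\<^esub>) = set_mult ?R" by (simp add: relative_homology_group_def FactGroup_def)
        have c: "homologous_rel_set 1 S {} x = ?B #>\<^bsub>?R\<^esub> x" for x
          by (simp add: right_coset_singular_relboundary)
        show ?thesis unfolding m c using N.rcos_sum[of x y] that by simp
      qed
      have "\<psi> a = \<psi> ((a - b') + b')" by simp
      also have "\<dots> = \<psi> (a - b') \<otimes>\<^bsub>?H\<^esub> \<psi> b'"
        using \<psi>.hom_mult[OF \<open>a - b' \<in> carrier ?F\<close> ab(2)] by simp
      finally have "homologous_rel_set 1 S {} ca = homologous_rel_set 1 S {} (cd + cb)"
        using ca(2) cb(2) cd(2) addset[OF cd(1) cb(1)] by simp
      from same[OF this] have "even (H ca) \<longleftrightarrow> even (H (cd + cb))" .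
      moreover have "H (cd + cb) = H cd + H cb" using add[of "cd + cb" cb] by simp
      moreover have "even (H ca)" "even (H cb)" using ab(3,4) ca cb unfolding P_def by blast+
      ultimately have ecd: "even (H cd)" by simp
      have "P (a - b')" unfolding P_def
      proof (intro allI impI)
        fix c assume "singular_relcycle 1 S {} c \<and> \<psi> (a - b') = homologous_rel_set 1 S {} c"
        then have "homologous_rel_set 1 S {} c = homologous_rel_set 1 S {} cd" using cd(2) by simp
        from same[OF this] show "even (H c)" using ecd by simp
      qed
      then show ?case using \<open>a - b' \<in> carrier ?F\<close> by blast
    qed
    have cyc: "singular_relcycle 1 S {} \<xi>" using \<xi> by (simp add: singular_cycle)
    then have "homologous_rel_set 1 S {} \<xi> \<in> \<psi> ` carrier ?F"
      using bij carH unfolding bij_betw_def by blast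
    then obtain a where a: "a \<in> carrier ?F" "\<psi> a = homologous_rel_set 1 S {} \<xi>" by auto
    then have "Poly_Mapping.keys a \<subseteq> {..<b}" by simp
    from P[OF this] show "even (H \<xi>)" using a cyc unfolding P_def by blast
  qed
qed

section \<open>Holonomy as a singular cochain\<close>

context surface_graph
begin

text \<open>The additive extension of holonomy from singular 1-simplices to chains. The free Abelian
  group on the single generator \<open>()\<close> plays the role of the integers, since
  \<open>frag_extend\<close> takes its values in such groups.\<close>

definition cochain :: "'a set set \<Rightarrow> ('b \<Rightarrow> 'b \<Rightarrow> bool) \<Rightarrow> 'b chain \<Rightarrow> int" where
  "cochain z s c = Poly_Mapping.lookup (frag_extend (\<lambda>\<sigma>. if holonomy z s (\<sigma> \<circ> edge_point) then frag_of () else 0) c) ()"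

lemma cochain_diff: "cochain z s (x - y) = cochain z s x - cochain z s y"
  unfolding cochain_def by (simp add: frag_extend_diff lookup_minus)

lemma cochain_add: "cochain z s (x + y) = cochain z s x + cochain z s y"
  unfolding cochain_def by (simp add: frag_extend_add lookup_add)

lemma cochain_of: "cochain z s (frag_of \<sigma>) = (if holonomy z s (\<sigma> \<circ> edge_point) then 1 else 0)"
  unfolding cochain_def by simp

lemma cochain_zero: "cochain z s 0 = 0"
  unfolding cochain_def by simp

text \<open>A section over the square computes the holonomy along all three edges by comparison with
  the gauge at the corners. Each vertex of the triangle occurs in two edges, so the contributions
  cancel modulo 2.\<close>

lemma cochain_triangle:
  assumes z: "even_set z" and s: "gauge_for z s" and \<tau>: "singular_simplex 2 S \<tau>"
  shows "even (cochain z s (chain_boundary 2 (frag_of \<tau>)))"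
proof -
  have zE: "z \<subseteq> E" using z unfolding even_set_def by blast
  have c\<tau>: "continuous_map (subtopology (powertop_real UNIV) (standard_simplex 2)) S \<tau>"
    using \<tau> unfolding singular_simplex_def by blast
  define F where "F = \<tau> \<circ> triangle_point"
  have cF: "continuous_map (top_of_set ({0..1} \<times> {0..1})) S F"
    unfolding F_def by (rule continuous_map_compose[OF continuous_triangle_point c\<tau>])
  obtain k where k: "section_on z F ({0..1} \<times> {0..1}) k" using section_on_square[OF z cF] by blast
  define A where "A w \<longleftrightarrow> agree (k w) (s (F w)) (F w)" for w
  have side: "holonomy z s (F \<circ> g) \<longleftrightarrow> A (g 0) \<noteq> A (g 1)"
    if g: "continuous_on {0..1} g" "\<And>t. t \<in> {0..1} \<Longrightarrow> g t \<in> {0..1} \<times> {0..1}" for g :: "real \<Rightarrow> real \<times> real"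
  proof -
    have cg: "continuous_map (top_of_set {0..1}) (top_of_set ({0..1} \<times> {0..1})) g"
      by (intro continuous_map_into_subtopology) (use g in auto)
    have cFg: "continuous_map (top_of_set {0..1}) S (F \<circ> g)" by (rule continuous_map_compose[OF cg cF])
    have "section_on z (F \<circ> g) {0..1} (k \<circ> g)"
      unfolding section_on_def
    proof
      fix t :: real assume t: "t \<in> {0..1}"
      obtain N W j where N: "open N" "g t \<in> N" "valid z W j" "\<And>t'. t' \<in> N \<Longrightarrow> t' \<in> {0..1} \<times> {0..1} \<Longrightarrow> F t' \<in> W"
        "\<And>t'. t' \<in> N \<Longrightarrow> t' \<in> {0..1} \<times> {0..1} \<Longrightarrow> agree j (k t') (F t')"
        by (rule section_onD[OF k g(2)[OF t]]) (rule that)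
      have "openin (top_of_set {0..1}) ({0..1} \<inter> g -` N)" using g(1) N(1) by (rule continuous_openin_preimage_gen)
      then obtain M where M: "open M" "{0..1} \<inter> g -` N = {0..1} \<inter> M" unfolding openin_open by blast
      have "t \<in> M" using M(2) t N(2) by blast
      moreover have "\<forall>t'\<in>M \<inter> {0..1}. (F \<circ> g) t' \<in> W \<and> agree j ((k \<circ> g) t') ((F \<circ> g) t')"
      proof
        fix t' assume "t' \<in> M \<inter> {0..1}"
        then have "g t' \<in> N" "g t' \<in> {0..1} \<times> {0..1}" using M(2) g(2) by blast+
        then show "(F \<circ> g) t' \<in> W \<and> agree j ((k \<circ> g) t') ((F \<circ> g) t')" using N(4)[of "g t'"] N(5)[of "g t'"] by simp
      qed
      ultimately show "\<exists>N W j. open N \<and> t \<in> N \<and> valid z W j \<and>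
          (\<forall>t'\<in>N \<inter> {0..1}. (F \<circ> g) t' \<in> W \<and> agree j ((k \<circ> g) t') ((F \<circ> g) t'))"
        using M(1) N(3) by blast
    qed
    from holonomy_iff[OF zE cFg this s] show ?thesis unfolding A_def by simp
  qed
  have face: "holonomy z s (singular_face 2 i \<tau> \<circ> edge_point) = holonomy z s (F \<circ> g)"
    if "\<And>t. t \<in> {0..1} \<Longrightarrow> simplical_face i (edge_point t) = triangle_point (g t)" for i g
  proof (rule holonomy_cong)
    fix t :: real assume t: "t \<in> {0..1}"
    then show "(singular_face 2 i \<tau> \<circ> edge_point) t = (F \<circ> g) t"
      using that[OF t] edge_point_simplex[OF t] by (simp add: singular_face_def F_def)
  qed
  have 0: "holonomy z s (singular_face 2 0 \<tau> \<circ> edge_point) \<longleftrightarrow> A (1, 0) \<noteq> A (1, 1)"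
  proof -
    have "continuous_on {0..1} (\<lambda>t::real. (1, t) :: real \<times> real)" by (intro continuous_intros)
    then have "holonomy z s (F \<circ> (\<lambda>t. (1, t))) \<longleftrightarrow> A (1, 0) \<noteq> A (1, 1)"
      by (rule side) auto
    then show ?thesis using face[of 0 "\<lambda>t. (1, t)", OF triangle_faces(1)] by simp
  qed
  have 1: "holonomy z s (singular_face 2 1 \<tau> \<circ> edge_point) \<longleftrightarrow> A (0, 1) \<noteq> A (1, 1)"
  proof -
    have "continuous_on {0..1} (\<lambda>t::real. (t, 1) :: real \<times> real)" by (intro continuous_intros)
    then have "holonomy z s (F \<circ> (\<lambda>t. (t, 1))) \<longleftrightarrow> A (0, 1) \<noteq> A (1, 1)"
      by (rule side) auto
    then show ?thesis using face[of 1 "\<lambda>t. (t, 1)", OF triangle_faces(2)] by simp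
  qed
  have 2: "holonomy z s (singular_face 2 2 \<tau> \<circ> edge_point) \<longleftrightarrow> A (0, 0) \<noteq> A (1, 0)"
  proof -
    have "continuous_on {0..1} (\<lambda>t::real. (t, 0) :: real \<times> real)" by (intro continuous_intros)
    then have "holonomy z s (F \<circ> (\<lambda>t. (t, 0))) \<longleftrightarrow> A (0, 0) \<noteq> A (1, 0)"
      by (rule side) auto
    then show ?thesis using face[of 2 "\<lambda>t. (t, 0)", OF triangle_faces(3)] by simp
  qed
  have F0: "F (0, v) = F (0, 0)" for v unfolding F_def using triangle_point_0[of v] by simp
  \<comment> \<open>Along the collapsed side \<open>F\<close> is constant, so the gauge at this one
    point is itself a section there. Uniqueness of lifts shows that \<open>k\<close> compares with
    it equally at both corners.\<close>
  have 3: "A (0, 0) = A (0, 1)"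
  proof -
    let ?K = "{0} \<times> {0..1} :: (real \<times> real) set"
    have sub: "?K \<subseteq> {0..1} \<times> {0..1}" by auto
    have cK: "continuous_map (top_of_set ?K) S F" by (rule continuous_map_from_subtopology_mono[OF cF sub])
    have kK: "section_on z F ?K k" by (rule section_on_subset[OF k sub])
    have m: "(0, 0) \<in> ?K" "(0, 1) \<in> ?K" by auto
    have "F (0, 0) \<in> topspace S" using continuous_map_image_subset_topspace[OF cK] m(1) by auto
    then obtain W where W: "F (0, 0) \<in> W" "valid z W (s (F (0, 0)))" using s unfolding gauge_for_def valid_at_def by blast
    have lK: "section_on z F ?K (\<lambda>t. s (F (0, 0)))"
    proof (rule section_on_const[OF W(2)])
      fix t assume "t \<in> ?K"
      then obtain v where "t = (0, v)" by blast
      then show "F t \<in> W" using W(1) F0[of v] by metis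
    qed
    have "connected ?K" by (intro connected_Times) auto
    from section_unique[OF zE this cK kK lK m] show ?thesis unfolding A_def F0[of 1] .
  qed
  have "chain_boundary 2 (frag_of \<tau>) = frag_of (singular_face 2 0 \<tau>) - frag_of (singular_face 2 1 \<tau>) + frag_of (singular_face 2 2 \<tau>)"
    by (simp add: chain_boundary_of numeral_2_eq_2)
  then have "cochain z s (chain_boundary 2 (frag_of \<tau>)) =
     cochain z s (frag_of (singular_face 2 0 \<tau>)) - cochain z s (frag_of (singular_face 2 1 \<tau>)) + cochain z s (frag_of (singular_face 2 2 \<tau>))"
    by (simp only: cochain_add cochain_diff)
  then show ?thesis unfolding cochain_of 0 1 2 using 3 by (cases "A (0, 1)"; cases "A (1, 0)"; cases "A (1, 1)") simp_all
qed

lemma cochain_boundary: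
  assumes z: "even_set z" and s: "gauge_for z s" and d: "singular_chain 2 S d"
  shows "even (cochain z s (chain_boundary 2 d))"
  using d[unfolded singular_chain_def]
proof (induction d rule: frag_induction)
  case zero
  then show ?case using cochain_zero by simp
next
  case (one \<tau>)
  then show ?case using cochain_triangle[OF z s] by simp
next
  case (diff a b)
  then show ?case by (simp add: chain_boundary_diff cochain_diff)
qed

end

text \<open>Pigeonhole: some fibre is at least of average size. The product form avoids division of
  natural numbers.\<close>

lemma card_fiber:
  assumes A: "finite A" and B: "finite B" "f ` A \<subseteq> B" "B \<noteq> {}"
  shows "\<exists>y\<in>B. card A \<le> card {x \<in> A. f x = y} * card B"
proof (rule ccontr)
  assume "\<not> ?thesis"
  then have *: "\<And>y. y \<in> B \<Longrightarrow> card {x \<in> A. f x = y} * card B < card A" by force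
  have "A = (\<Union>y\<in>B. {x \<in> A. f x = y})" using B(2) by blast
  then have "card A = (\<Sum>y\<in>B. card {x \<in> A. f x = y})"
    using A B(1) by (subst (1) \<open>A = _\<close>, subst card_UN_disjoint) auto
  then have "card A * card B = (\<Sum>y\<in>B. card {x \<in> A. f x = y} * card B)" by (simp add: sum_distrib_right)
  also have "\<dots> < (\<Sum>y\<in>B. card A)" using * B by (intro sum_strict_mono) auto
  finally show False by simp
qed

lemma card_sym_diff_parity:
  assumes "finite A" "finite B"
  shows "even (card (sym_diff A B)) \<longleftrightarrow> (even (card A) \<longleftrightarrow> even (card B))"
proof -
  have "card A = card (A - B) + card (A \<inter> B)" "card B = card (B - A) + card (A \<inter> B)"
    using card_Int_Diff[OF assms(1), of B] card_Int_Diff[OF assms(2), of A] by (simp_all add: Int_commute)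
  moreover have "card (sym_diff A B) = card (A - B) + card (B - A)"
    using assms by (intro card_Un_disjoint) auto
  ultimately show ?thesis by auto
qed

section \<open>Counting even sets and faces\<close>

context surface_graph
begin

lemma path_connected_S: "x \<in> topspace S \<Longrightarrow> y \<in> topspace S \<Longrightarrow> \<exists>g. pathin S g \<and> g 0 = x \<and> g 1 = y"
proof -
  have "neighbourhood_base_of (path_connectedin S) S"
    unfolding neighbourhood_base_of
  proof (intro allI impI)
    fix W x assume W: "openin S W \<and> x \<in> W"
    then obtain D where "openin S D" "x \<in> D" "D \<subseteq> W" "path_connectedin S D" using disc_nbhd by metis
    then show "\<exists>U V. openin S U \<and> path_connectedin S V \<and> x \<in> U \<and> U \<subseteq> V \<and> V \<subseteq> W" by blast
  qed
  then have "locally_path_connected_space S" unfolding locally_path_connected_space_def .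
  then have "path_connected_space S" using connected_S path_connected_eq_connected_space by blast
  then show "x \<in> topspace S \<Longrightarrow> y \<in> topspace S \<Longrightarrow> \<exists>g. pathin S g \<and> g 0 = x \<and> g 1 = y"
    unfolding path_connected_space_def by blast
qed

text \<open>As long as the path stays in the domain of the sheet at its start, this sheet itself is
  a section, and only the comparison at the end remains.\<close>

lemma holonomy_in_domain:
  assumes z: "z \<subseteq> E" and s: "gauge_for z s" and W: "valid z W (s x)" and g: "pathin S g" "g ` {0..1} \<subseteq> W" "g 0 = x"
  shows "holonomy z s g \<longleftrightarrow> \<not> agree (s x) (s (g 1)) (g 1)"
proof -
  have "section_on z g {0..1} (\<lambda>t. s x)" by (rule section_on_const[OF W]) (use g(2) in blast)
  from holonomy_iff[OF z g(1)[unfolded pathin_def] this s]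
  have "holonomy z s g \<longleftrightarrow> agree (s x) (s x) x \<noteq> agree (s x) (s (g 1)) (g 1)" using g(3) by simp
  moreover have "x \<in> topspace S" using g(1,3) path_start_in_topspace by blast
  ultimately show ?thesis using agree_refl by simp
qed

lemma cochain_path: "cochain z s (frag_of (path_simplex g)) = (if holonomy z s g then 1 else 0)"
proof -
  have "holonomy z s (path_simplex g \<circ> edge_point) = holonomy z s g"
    by (rule holonomy_cong) (simp add: path_simplex_edge)
  then show ?thesis unfolding cochain_of by simp
qed

text \<open>By the hypothesis on the parities, the double cover of the symmetric difference has trivial
  monodromy.\<close>
lemma global_valid:
  assumes z: "even_set z" "even_set z0" and s: "gauge_for z s" "gauge_for z0 s0"
    and eq: "\<And>\<xi>. singular_chain 1 S \<xi> \<Longrightarrow> chain_boundary 1 \<xi> = 0 \<Longrightarrow> even (cochain z s \<xi> + cochain z0 s0 \<xi>)"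
  shows "\<exists>k. valid (sym_diff z z0) (topspace S) k"
proof (cases "topspace S = {}")
  case True
  then have "valid (sym_diff z z0) (topspace S) (\<lambda>x. True)" unfolding valid_def by auto
  then show ?thesis by blast
next
  case False
  then obtain x0 where x0: "x0 \<in> topspace S" by blast
  have zE: "z \<subseteq> E" "z0 \<subseteq> E" using z unfolding even_set_def by blast+
  have "\<forall>x. \<exists>g. x \<in> topspace S \<longrightarrow> pathin S g \<and> g 0 = x0 \<and> g 1 = x" using path_connected_S[OF x0] by blast
  then obtain \<sigma> where \<sigma>: "\<And>x. x \<in> topspace S \<Longrightarrow> pathin S (\<sigma> x) \<and> \<sigma> x 0 = x0 \<and> \<sigma> x 1 = x" by metis
  define d where "d g \<longleftrightarrow> holonomy z s g \<noteq> holonomy z0 s0 g" for g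
  have dev: "even (cochain z s (frag_of (path_simplex g)) + cochain z0 s0 (frag_of (path_simplex g))) \<longleftrightarrow> \<not> d g" for g
    unfolding cochain_path d_def by simp
  \<comment> \<open>The exclusive or of the two gauges at \<open>y\<close> is a sheet for the
    symmetric difference, and the holonomy along the chosen path from \<open>x0\<close> to
    \<open>y\<close> corrects it. So \<open>k\<close> continues a single sheet from
    \<open>x0\<close>, although the paths are chosen without continuity.\<close>
  define k where "k y \<longleftrightarrow> ((s y y \<noteq> s0 y y) \<noteq> d (\<sigma> y))" for y
  have cmp: "\<exists>D b. openin S D \<and> x \<in> D \<and> valid z D (s x) \<and> valid z0 D (s0 x) \<and> (\<forall>y\<in>D - X. k y = ((s x y \<noteq> s0 x y) \<noteq> b))"
    if x: "x \<in> topspace S" for x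
  proof -
    obtain U U0 where U: "x \<in> U" "valid z U (s x)" "x \<in> U0" "valid z0 U0 (s0 x)"
      using s x unfolding gauge_for_def valid_at_def by blast
    have "openin S (U \<inter> U0)" using valid_open U by blast
    then obtain D where D: "openin S D" "x \<in> D" "D \<subseteq> U \<inter> U0" "path_connectedin S D" using disc_nbhd U(1,3) by (metis IntI)
    have v: "valid z D (s x)" "valid z0 D (s0 x)" using valid_subset[OF U(2) D(1)] valid_subset[OF U(4) D(1)] D(3) by blast+
    have "k y = ((s x y \<noteq> s0 x y) \<noteq> d (\<sigma> x))" if y: "y \<in> D - X" for y
    proof -
      obtain \<rho> where \<rho>: "pathin S \<rho>" "\<rho> ` {0..1} \<subseteq> D" "\<rho> 0 = x" "\<rho> 1 = y"
        using D(2,4) y unfolding path_connectedin by blast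
      have yS: "y \<in> topspace S" using y D(1) openin_subset by blast
      let ?c = "\<lambda>g. frag_of (path_simplex g)"
      \<comment> \<open>A loop: out to \<open>x\<close> along its chosen path, across the disc to
        \<open>y\<close>, and back along the chosen path of \<open>y\<close>. That its total
        holonomy is even relates the corrections at \<open>x\<close> and at
        \<open>y\<close>.\<close>
      let ?\<xi> = "?c (\<sigma> x) + ?c \<rho> - ?c (\<sigma> y)"
      have "singular_chain 1 S ?\<xi>"
        using \<sigma>[OF x] \<sigma>[OF yS] \<rho>(1)
        by (intro singular_chain_diff singular_chain_add) (simp_all only: singular_chain_of singular_path_simplex)
      moreover have "chain_boundary 1 ?\<xi> = 0"
        unfolding chain_boundary_diff chain_boundary_add path_simplex_boundary using \<sigma>[OF x] \<sigma>[OF yS] \<rho>(3,4) by simp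
      ultimately have "even (cochain z s ?\<xi> + cochain z0 s0 ?\<xi>)" by (rule eq)
      then have "even ((cochain z s (?c (\<sigma> x)) + cochain z0 s0 (?c (\<sigma> x))) + (cochain z s (?c \<rho>) + cochain z0 s0 (?c \<rho>))
          - (cochain z s (?c (\<sigma> y)) + cochain z0 s0 (?c (\<sigma> y))))"
        unfolding cochain_add cochain_diff by (simp add: algebra_simps)
      then have "d (\<sigma> y) = (d (\<sigma> x) \<noteq> d \<rho>)" using dev by auto
      moreover have "s y y = (s x y \<noteq> holonomy z s \<rho>)" if "z \<subseteq> E" "gauge_for z s" "valid z D (s x)" for z s
      proof -
        have h: "holonomy z s \<rho> \<longleftrightarrow> \<not> agree (s x) (s y) y"
          using holonomy_in_domain[OF that \<rho>(1-3)] \<rho>(4) by simp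
        have "valid_at z (s x) y" using that(3) y unfolding valid_at_def by blast
        moreover have "valid_at z (s y) y" using that(2) yS unfolding gauge_for_def by blast
        ultimately have "agree (s x) (s y) y \<or> agree (s x) (\<lambda>u. \<not> s y u) y" by (rule agree_or_not[OF that(1)])
        then show ?thesis using h agree_val[of "s x" "s y" y] agree_val[of "s x" "\<lambda>u. \<not> s y u" y] y by blast
      qed
      then have "s y y = (s x y \<noteq> holonomy z s \<rho>)" "s0 y y = (s0 x y \<noteq> holonomy z0 s0 \<rho>)"
        using zE s v by blast+
      ultimately show ?thesis unfolding k_def d_def by auto
    qed
    then show ?thesis using D(1,2) v by blast
  qed
  have "valid (sym_diff z z0) (topspace S) k"
    unfolding valid_def
  proof (intro conjI ballI openin_topspace)
    fix q assume q: "q \<in> topspace S - p ` V"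
    then have "q \<in> topspace S" by simp
    from cmp[OF this] obtain D b where D: "openin S D" "q \<in> D" "valid z D (s q)" "valid z0 D (s0 q)"
      "\<forall>y\<in>D - X. k y = ((s q y \<noteq> s0 q y) \<noteq> b)" by (elim exE conjE) (rule that)
    have v: "valid (sym_diff z z0) D (\<lambda>y. s q y \<noteq> s0 q y)" by (rule valid_xor[OF D(3,4) zE])
    have "\<exists>k'. valid (sym_diff z z0) D k' \<and> (\<forall>y\<in>D - X. k y = k' y)"
    proof (cases b)
      case True
      then show ?thesis using valid_not[OF v] D(5) by (intro exI[of _ "\<lambda>y. \<not> (s q y \<noteq> s0 q y)"]) blast
    next
      case False
      then show ?thesis using v D(5) by (intro exI[of _ "\<lambda>y. s q y \<noteq> s0 q y"]) blast
    qed
    then obtain k' where k': "valid (sym_diff z z0) D k'" "\<forall>y\<in>D - X. k y = k' y" by blast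
    have "flat k q = flat k' q" by (rule flat_cong[OF D(1,2)]) (use k'(2) in blast)
    moreover have "flat k' q \<longleftrightarrow> q \<notin> (\<Union>e\<in>sym_diff z z0. inner e)" by (rule valid_flat[OF k'(1) D(2)]) (use q in blast)
    ultimately show "flat k q \<longleftrightarrow> q \<notin> (\<Union>e\<in>sym_diff z z0. inner e)" by simp
  qed
  then show ?thesis by blast
qed

text \<open>The parities of the degrees at all vertices but \<open>v0\<close> take at most
  \<open>2 ^ (card V - 1)\<close> values. The symmetric difference of two edge sets with the same
  parities has even degrees off \<open>v0\<close>, and at \<open>v0\<close> too because the degree
  sum is even. So a large fibre embeds into the even sets.\<close>

lemma even_sets_many: "2 ^ card E \<le> card {z. even_set z} * 2 ^ (card V - 1)"
proof -
  have "V \<noteq> {}" using graph unfolding simple_graph_def by blast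
  then obtain v0 where v0: "v0 \<in> V" by blast
  define par where "par z = {v \<in> V - {v0}. odd (card {e \<in> z. v \<in> e})}" for z :: "'a set set"
  have fin: "finite (Pow E)" "finite (Pow (V - {v0}))" using finite_E finite_V by auto
  have "par ` Pow E \<subseteq> Pow (V - {v0})" unfolding par_def by blast
  from card_fiber[OF fin this]
  obtain y where y: "card (Pow E) \<le> card {z \<in> Pow E. par z = y} * card (Pow (V - {v0}))" by blast
  let ?Fib = "{z \<in> Pow E. par z = y}"
  have cV: "card (Pow (V - {v0})) = 2 ^ (card V - 1)" using v0 finite_V by (simp add: card_Pow)
  have "?Fib \<noteq> {}"
  proof
    assume "?Fib = {}"
    then have "card (Pow E) \<le> 0" using y by (metis card.empty mult_zero_left)
    then show False using finite_E by (simp add: card_Pow)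
  qed
  then obtain z0 where z0: "z0 \<in> ?Fib" by blast
  have ev: "even_set (sym_diff z z0)" if z: "z \<in> ?Fib" for z
  proof -
    let ?w = "sym_diff z z0"
    have wE: "?w \<subseteq> E" using z z0 by blast
    have finw: "finite ?w" using wE finite_E finite_subset by blast
    have deg: "even (card {e \<in> ?w. v \<in> e})" if v: "v \<in> V" "v \<noteq> v0" for v
    proof -
      have "finite {e \<in> z. v \<in> e}" "finite {e \<in> z0. v \<in> e}" using z z0 finite_E by (auto intro: finite_subset)
      note card_sym_diff_parity[OF this]
      moreover have "sym_diff {e \<in> z. v \<in> e} {e \<in> z0. v \<in> e} = {e \<in> ?w. v \<in> e}" by blast
      moreover have "v \<in> par z \<longleftrightarrow> v \<in> par z0" using z z0 by simp
      ultimately show ?thesis using v unfolding par_def by simp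
    qed
    have "(\<Sum>v\<in>V. card {e \<in> ?w. v \<in> e}) = (\<Sum>e\<in>?w. card {v \<in> V. v \<in> e})"
      using sum.swap_restrict[OF finite_V finw, of "\<lambda>_ _. 1::nat" "\<lambda>v e. v \<in> e"] by simp
    also have "\<dots> = (\<Sum>e\<in>?w. 2)"
    proof (rule sum.cong[OF refl])
      fix e assume "e \<in> ?w"
      then have "e \<in> E" using wE by blast
      then have "{v \<in> V. v \<in> e} = e" "card e = 2" using edge_sub edge_card by auto
      then show "card {v \<in> V. v \<in> e} = 2" by simp
    qed
    finally have "even (\<Sum>v\<in>V. card {e \<in> ?w. v \<in> e})" by simp
    moreover have "(\<Sum>v\<in>V. card {e \<in> ?w. v \<in> e}) = card {e \<in> ?w. v0 \<in> e} + (\<Sum>v\<in>V - {v0}. card {e \<in> ?w. v \<in> e})"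
      by (rule sum.remove[OF finite_V v0])
    moreover have "even (\<Sum>v\<in>V - {v0}. card {e \<in> ?w. v \<in> e})" by (rule dvd_sum) (use deg in auto)
    ultimately have "even (card {e \<in> ?w. v0 \<in> e})" by simp
    then show ?thesis unfolding even_set_def using wE deg by metis
  qed
  have "inj_on (\<lambda>z. sym_diff z z0) ?Fib" by (rule inj_onI) blast
  moreover have "(\<lambda>z. sym_diff z z0) ` ?Fib \<subseteq> {z. even_set z}" using ev by blast
  moreover have "finite {z. even_set z}" unfolding even_set_def using finite_E by (simp add: finite_subset[OF _ fin(1)] subset_iff)
  ultimately have "card ?Fib \<le> card {z. even_set z}" by (rule card_inj_on_le)
  then show ?thesis using y cV finite_E by (simp add: card_Pow) (meson le_trans mult_le_mono1)
qed

theorem faces_lower_bound: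
  assumes iso: "homology_group 1 S \<cong> free_Abelian_group {..<b::nat}" and E3: "card E \<ge> 3"
  shows "card E + 2 \<le> card faces + b + card V"
proof (rule homology_parity_basis[OF iso])
  fix \<zeta> :: "nat \<Rightarrow> 'b chain"
  assume \<zeta>: "\<And>(H :: 'b chain \<Rightarrow> int) \<xi>. (\<And>x y. H (x - y) = H x - H y) \<Longrightarrow>
      (\<And>d. singular_chain 2 S d \<Longrightarrow> even (H (chain_boundary 2 d))) \<Longrightarrow>
      (\<And>j. j < b \<Longrightarrow> even (H (\<zeta> j))) \<Longrightarrow> singular_chain 1 S \<xi> \<Longrightarrow> chain_boundary 1 \<xi> = 0 \<Longrightarrow> even (H \<xi>)"
  let ?Z = "{z. even_set z}"
  have finZ: "finite ?Z" using finite_E by (intro finite_subset[of ?Z "Pow E"]) (auto simp: even_set_def)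
  have "\<forall>z. \<exists>s. even_set z \<longrightarrow> gauge_for z s" using gauge_exists by blast
  then obtain s where s: "\<And>z. even_set z \<Longrightarrow> gauge_for z (s z)" by metis
  \<comment> \<open>The values of the monodromy on representatives of the homology generators; equal
    values make the monodromies equal on all cycles.\<close>
  define bits where "bits z = {j \<in> {..<b}. odd (cochain z (s z) (\<zeta> j))}" for z
  have "bits ` ?Z \<subseteq> Pow {..<b}" unfolding bits_def by blast
  moreover have "finite (Pow {..<b})" by simp
  ultimately obtain y where y: "card ?Z \<le> card {z \<in> ?Z. bits z = y} * card (Pow {..<b})"
    using card_fiber[OF finZ, of "Pow {..<b}" bits] by blast
  let ?Fib = "{z \<in> ?Z. bits z = y}"
  have "0 < card ?Z"
  proof -
    have "0 < (2::nat) ^ card E" by simp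
    then show ?thesis using even_sets_many by (metis gr0I leD mult_zero_left)
  qed
  then have "?Fib \<noteq> {}" using y by (metis card.empty leD mult_zero_left)
  then obtain z0 where z0: "z0 \<in> ?Fib" by blast
  have ex: "\<exists>k. valid (sym_diff z z0) (topspace S) k" if z: "z \<in> ?Fib" for z
  proof (rule global_valid)
    show "even_set z" "even_set z0" using z z0 by auto
    then show g: "gauge_for z (s z)" "gauge_for z0 (s z0)" using s by auto
    fix \<xi> assume \<xi>: "singular_chain 1 S \<xi>" "chain_boundary 1 \<xi> = 0"
    show "even (cochain z (s z) \<xi> + cochain z0 (s z0) \<xi>)"
    proof (rule \<zeta>[OF _ _ _ \<xi>])
      show "cochain z (s z) (x - y) + cochain z0 (s z0) (x - y) =
         cochain z (s z) x + cochain z0 (s z0) x - (cochain z (s z) y + cochain z0 (s z0) y)" for x y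
        unfolding cochain_diff by simp
      show "even (cochain z (s z) (chain_boundary 2 d) + cochain z0 (s z0) (chain_boundary 2 d))" if "singular_chain 2 S d" for d
        using cochain_boundary[OF \<open>even_set z\<close> g(1) that] cochain_boundary[OF \<open>even_set z0\<close> g(2) that] by simp
      show "even (cochain z (s z) (\<zeta> j) + cochain z0 (s z0) (\<zeta> j))" if "j < b" for j
      proof -
        have "j \<in> bits z \<longleftrightarrow> j \<in> bits z0" using z z0 by simp
        then show ?thesis using that unfolding bits_def by simp
      qed
    qed
  qed
  then obtain k where k: "\<And>z. z \<in> ?Fib \<Longrightarrow> valid (sym_diff z z0) (topspace S) (k z)" by metis
  have subE: "sym_diff z z0 \<subseteq> E" if "z \<in> ?Fib" for z using that z0 unfolding even_set_def by blast
  \<comment> \<open>The Boolean \<beta> chooses between a two-colouring and its complement. Counting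
    both doubles the number of sets of faces, which improves the bound on the faces by one.\<close>
  define col where "col = (\<lambda>(z, \<beta>). {f \<in> faces. \<exists>x\<in>f. k z x \<noteq> \<beta>})"
  have val: "face x \<in> col (z, \<beta>) \<longleftrightarrow> k z x \<noteq> \<beta>" if "z \<in> ?Fib" "x \<in> topspace S - X" for z x \<beta>
  proof -
    have f: "face x \<in> faces" "x \<in> face x" using that(2) face_self unfolding faces_def by auto
    have "k z y = k z x" if "y \<in> face x" for y
      by (rule valid_const_on_face[OF k[OF \<open>z \<in> ?Fib\<close>] subE[OF \<open>z \<in> ?Fib\<close>] f(1) that f(2)])
    then have "(\<exists>y\<in>face x. k z y \<noteq> \<beta>) \<longleftrightarrow> k z x \<noteq> \<beta>" using f(2) by metis
    moreover have "face x \<in> col (z, \<beta>) \<longleftrightarrow> (\<exists>y\<in>face x. k z y \<noteq> \<beta>)"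
      unfolding col_def prod.case mem_Collect_eq using f(1) by blast
    ultimately show ?thesis by simp
  qed
  have "E \<noteq> {}" using E3 by auto
  then obtain e where e: "e \<in> E" by blast
  have "\<gamma> e (1/2) \<in> topspace S" using inner_S[OF e] inner_nonempty by blast
  then obtain x1 where x1: "x1 \<in> topspace S - X" using nonempty_off_X[of "topspace S"] by blast
  \<comment> \<open>Equal colour classes mean functions that are equal up to negation, hence with
    the same jumps, and these recover the edge set. The value at \<open>x1\<close> then recovers
    \<beta>, so the complement of the drawing must be inhabited.\<close>
  have inj: "inj_on col (?Fib \<times> UNIV)"
  proof (rule inj_onI)
    fix u w assume u: "u \<in> ?Fib \<times> (UNIV::bool set)" and w: "w \<in> ?Fib \<times> (UNIV::bool set)" and eq: "col u = col w"
    obtain z \<beta> where z: "u = (z, \<beta>)" "z \<in> ?Fib" using u by blast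
    obtain z' \<beta>' where z': "w = (z', \<beta>')" "z' \<in> ?Fib" using w by blast
    have kk: "(k z x \<noteq> \<beta>) = (k z' x \<noteq> \<beta>')" if "x \<in> topspace S - X" for x
      using val[OF z(2) that, of \<beta>] val[OF z'(2) that, of \<beta>'] eq z(1) z'(1) by simp
    have "\<exists>k'. valid (sym_diff z' z0) (topspace S) k' \<and> (\<forall>x\<in>topspace S - X. k z x = k' x)"
    proof (cases "\<beta> = \<beta>'")
      case True
      then show ?thesis using k[OF z'(2)] kk by blast
    next
      case False
      then have "\<forall>x\<in>topspace S - X. k z x = (\<not> k z' x)" using kk by blast
      then show ?thesis using valid_not[OF k[OF z'(2)]] by blast
    qed
    then obtain k' where k': "valid (sym_diff z' z0) (topspace S) k'" "\<And>x. x \<in> topspace S - X \<Longrightarrow> k z x = k' x" by blast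
    have "(e \<in> sym_diff z z0) = (e \<in> sym_diff z' z0)" if e: "e \<in> E" for e
    proof -
      let ?q = "\<gamma> e (1/2)"
      have q: "?q \<in> inner e" "?q \<in> topspace S" "?q \<notin> p ` V"
        using inner_nonempty inner_S[OF e] inner_not_p[OF e] by blast+
      have mem: "?q \<in> (\<Union>e\<in>y. inner e) \<longleftrightarrow> e \<in> y" if "y \<subseteq> E" for y
        using q(1) inner_unique[OF e] that by blast
      have "flat (k z) ?q = flat k' ?q" by (rule flat_cong[OF openin_topspace q(2)]) (rule k'(2))
      moreover have "flat (k z) ?q \<longleftrightarrow> e \<notin> sym_diff z z0"
        using valid_flat[OF k[OF z(2)] q(2,3)] unfolding mem[OF subE[OF z(2)]] .
      moreover have "flat k' ?q \<longleftrightarrow> e \<notin> sym_diff z' z0"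
        using valid_flat[OF k'(1) q(2,3)] unfolding mem[OF subE[OF z'(2)]] .
      ultimately show ?thesis by blast
    qed
    then have "sym_diff z z0 = sym_diff z' z0" using subE[OF z(2)] subE[OF z'(2)] by blast
    then have "z = z'" by blast
    moreover have "\<beta> = \<beta>'" using kk[OF x1] \<open>z = z'\<close> by blast
    ultimately show "u = w" using z z' by simp
  qed
  have "col ` (?Fib \<times> UNIV) \<subseteq> Pow faces" unfolding col_def by auto
  from card_inj_on_le[OF inj this] have "card (?Fib \<times> (UNIV :: bool set)) \<le> 2 ^ card faces"
    using finite_faces[OF E3] by (simp add: card_Pow)
  then have F: "2 * card ?Fib \<le> 2 ^ card faces" by (simp add: card_cartesian_product)
  have "2 * 2 ^ card E \<le> 2 * (card ?Z * 2 ^ (card V - 1))" using even_sets_many by simp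
  also have "\<dots> \<le> 2 * ((card ?Fib * 2 ^ b) * 2 ^ (card V - 1))" using y by (simp add: card_Pow)
  also have "\<dots> = (2 * card ?Fib) * 2 ^ b * 2 ^ (card V - 1)" by simp
  also have "\<dots> \<le> 2 ^ card faces * 2 ^ b * 2 ^ (card V - 1)" using F by simp
  finally have "(2::nat) ^ (card E + 1) \<le> 2 ^ (card faces + b + (card V - 1))" by (simp add: power_add)
  then have "card E + 1 \<le> card faces + b + (card V - 1)" by (rule power_le_imp_le_exp[rotated]) simp
  moreover have "card V > 0" using graph unfolding simple_graph_def by (simp add: card_gt_0_iff)
  ultimately show ?thesis by simp
qed

text \<open>Eliminates the number f of faces from e + 2 <= f + b + n and 3 f <= 2 e. With at most
  two edges the claim follows from 2 + 6 <= 3 * 3.\<close>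

theorem edge_bound:
  assumes iso: "homology_group 1 S \<cong> free_Abelian_group {..<b::nat}" and V3: "card V \<ge> 3"
  shows "card E + 6 \<le> 3 * card V + 3 * b"
proof (cases "card E \<ge> 3")
  case True
  then show ?thesis using faces_lower_bound[OF iso True] faces_edges[OF True] by linarith
next
  case False
  then show ?thesis using V3 by linarith
qed

end

section \<open>Edge counts\<close>

definition edges_in :: "'a set set \<Rightarrow> 'a set \<Rightarrow> 'a set set" where
  "edges_in E W = {e \<in> E. e \<subseteq> W}"

definition nbrs :: "'a set set \<Rightarrow> 'a set \<Rightarrow> 'a \<Rightarrow> 'a set" where
  "nbrs E W w = {u \<in> W. {u, w} \<in> E}"

lemma simple_graphD:
  assumes "simple_graph V E"
  shows "finite V" "V \<noteq> {}" "e \<in> E \<Longrightarrow> e \<subseteq> V" "e \<in> E \<Longrightarrow> card e = 2" "finite E"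
proof -
  show *: "finite V" "V \<noteq> {}" "e \<in> E \<Longrightarrow> e \<subseteq> V" "e \<in> E \<Longrightarrow> card e = 2" for e
    using assms unfolding simple_graph_def by auto
  have "E \<subseteq> Pow V" using *(3) by blast
  then show "finite E" using *(1) by (meson finite_Pow_iff finite_subset)
qed

lemma edge_neq: "simple_graph V E \<Longrightarrow> {u, v} \<in> E \<Longrightarrow> u \<noteq> v"
  using simple_graphD(4)[of V E "{u, v}"] by auto

lemma finite_edges_in: "simple_graph V E \<Longrightarrow> finite (edges_in E W)"
  unfolding edges_in_def using simple_graphD(5) by fastforce

lemma card_edges_at:
  assumes G: "simple_graph V E" and w: "w \<in> W"
  shows "card {e \<in> edges_in E W. w \<in> e} = card (nbrs E W w)"
proof -
  have "bij_betw (\<lambda>u. {u, w}) (nbrs E W w) {e \<in> edges_in E W. w \<in> e}"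
    unfolding bij_betw_def
  proof
    show "inj_on (\<lambda>u. {u, w}) (nbrs E W w)" by (rule inj_onI) (metis doubleton_eq_iff)
    show "(\<lambda>u. {u, w}) ` nbrs E W w = {e \<in> edges_in E W. w \<in> e}"
    proof (intro equalityI subsetI)
      fix e assume "e \<in> {e \<in> edges_in E W. w \<in> e}"
      then have e: "e \<in> E" "e \<subseteq> W" "w \<in> e" unfolding edges_in_def by auto
      obtain u where u: "e = {u, w}"
        using simple_graphD(4)[OF G e(1)] e(3) by (metis card_2_iff doubleton_eq_iff insertE singletonD)
      then have "u \<in> nbrs E W w" unfolding nbrs_def using e by auto
      then show "e \<in> (\<lambda>u. {u, w}) ` nbrs E W w" using u by blast
    qed (use w in \<open>auto simp: nbrs_def edges_in_def\<close>)
  qed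
  then show ?thesis by (simp add: bij_betw_same_card)
qed

lemma card_edges_remove:
  assumes G: "simple_graph V E" and w: "w \<in> W"
  shows "card (edges_in E W) = card (edges_in E (W - {w})) + card (nbrs E W w)"
proof -
  have "edges_in E W = edges_in E (W - {w}) \<union> {e \<in> edges_in E W. w \<in> e}" unfolding edges_in_def by blast
  moreover have "edges_in E (W - {w}) \<inter> {e \<in> edges_in E W. w \<in> e} = {}" unfolding edges_in_def by blast
  ultimately have "card (edges_in E W) = card (edges_in E (W - {w})) + card {e \<in> edges_in E W. w \<in> e}"
    using finite_edges_in[OF G] by (metis (no_types, lifting) card_Un_disjoint finite_Un)
  then show ?thesis using card_edges_at[OF G w] by simp
qed

lemma card_nbrs_le:
  assumes "simple_graph V E" "finite W" "w \<in> W" shows "card (nbrs E W w) \<le> card W - 1"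
proof -
  have "nbrs E W w \<subseteq> W - {w}" unfolding nbrs_def using edge_neq[OF assms(1)] by auto
  then have "card (nbrs E W w) \<le> card (W - {w})" using assms(2) by (intro card_mono) auto
  then show ?thesis using assms by simp
qed

lemma edges_in_empty: "simple_graph V E \<Longrightarrow> edges_in E {} = {}"
  unfolding edges_in_def using simple_graphD(4) by fastforce

lemma edges_in_le_complete:
  assumes G: "simple_graph V E" and W: "finite W"
  shows "2 * card (edges_in E W) \<le> card W * (card W - 1)"
  using W
proof (induction W rule: finite_psubset_induct)
  case (psubset W)
  show ?case
  proof (cases "W = {}")
    case True
    then show ?thesis using edges_in_empty[OF G] by simp
  next
    case False
    then obtain w where w: "w \<in> W" by blast
    have IH: "2 * card (edges_in E (W - {w})) \<le> card (W - {w}) * (card (W - {w}) - 1)"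
      using psubset.IH[of "W - {w}"] w by blast
    obtain m where m: "card W = Suc m" "card (W - {w}) = m"
      using w psubset.hyps by (metis card_Suc_Diff1)
    have "card (nbrs E W w) \<le> m" using card_nbrs_le[OF G psubset.hyps w] m by simp
    then have "2 * card (edges_in E W) \<le> m * (m - 1) + 2 * m"
      using IH card_edges_remove[OF G w] m by simp
    also have "\<dots> = Suc m * m" by (cases m) (auto simp: algebra_simps)
    finally show ?thesis using m by simp
  qed
qed

text \<open>A graph in which every nonempty induced subgraph has a vertex of degree at most \<open>t\<close>
  is built up by successively adding vertices with at most \<open>t\<close> edges.\<close>
lemma degenerate_edges:
  assumes G: "simple_graph V E" and W: "finite W" "t \<le> card W"
    and deg: "\<And>U. U \<subseteq> W \<Longrightarrow> U \<noteq> {} \<Longrightarrow> \<exists>w\<in>U. card (nbrs E U w) \<le> t"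
  shows "2 * card (edges_in E W) + t * (t + 1) \<le> 2 * t * card W"
  using W deg
proof (induction W rule: finite_psubset_induct)
  case (psubset W)
  show ?case
  proof (cases "card W = t")
    case True
    \<comment> \<open>The induction starts at t vertices, where the claim is the bound t (t - 1) / 2
      for the edges of a complete graph.\<close>
    then have "2 * card (edges_in E W) \<le> t * (t - 1)" using edges_in_le_complete[OF G psubset.hyps] by simp
    then have "2 * card (edges_in E W) + t * (t + 1) \<le> t * (t - 1) + t * (t + 1)" by simp
    also have "\<dots> = 2 * t * t" by (cases t) (auto simp: algebra_simps)
    finally show ?thesis using True by simp
  next
    case False
    then have lt: "t < card W" using psubset.prems(1) by simp
    then have "W \<noteq> {}" by auto
    then obtain w where w: "w \<in> W" "card (nbrs E W w) \<le> t" using psubset.prems(2)[of W] by blast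
    obtain m where m: "card W = Suc m" "card (W - {w}) = m"
      using w psubset.hyps by (metis card_Suc_Diff1)
    have "2 * card (edges_in E (W - {w})) + t * (t + 1) \<le> 2 * t * card (W - {w})"
    proof (rule psubset.IH)
      show "W - {w} \<subset> W" using w by blast
      show "t \<le> card (W - {w})" using lt m by simp
      show "\<exists>w\<in>U. card (nbrs E U w) \<le> t" if "U \<subseteq> W - {w}" "U \<noteq> {}" for U
        using psubset.prems(2)[of U] that by blast
    qed
    then show ?thesis using card_edges_remove[OF G w(1)] w(2) m by simp
  qed
qed

section \<open>Trees and tree decompositions\<close>

definition walk :: "'a set set \<Rightarrow> 'a list \<Rightarrow> bool" where
  "walk E vs \<longleftrightarrow> (\<forall>i. Suc i < length vs \<longrightarrow> {vs ! i, vs ! Suc i} \<in> E)"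

text \<open>Take a longest walk without repeated vertices. If its first vertex had two neighbours,
  the one that is not next on the walk would either prolong the walk or close a cycle.\<close>

lemma acyclic_low_degree:
  assumes W: "finite W" "W \<noteq> {}" and nl: "\<And>u. {u} \<notin> E" and ac: "\<nexists>vs. is_cycle E vs"
  shows "\<exists>w\<in>W. card (nbrs E W w) \<le> 1"
proof (rule ccontr)
  assume "\<not> ?thesis"
  then have d2: "\<And>w. w \<in> W \<Longrightarrow> 2 \<le> card (nbrs E W w)" by force
  define Q where "Q n \<longleftrightarrow> (\<exists>vs. distinct vs \<and> set vs \<subseteq> W \<and> walk E vs \<and> length vs = n)" for n
  obtain w0 where "w0 \<in> W" using W by blast
  then have Q1: "Q 1" unfolding Q_def walk_def by (intro exI[of _ "[w0]"]) auto
  have bound: "n \<le> card W" if "Q n" for n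
    using that W unfolding Q_def by (metis card_mono distinct_card)
  define n where "n = (GREATEST n. Q n)"
  have Qn: "Q n" unfolding n_def using GreatestI_nat[of Q 1 "card W"] Q1 bound by blast
  have max: "m \<le> n" if "Q m" for m unfolding n_def using Greatest_le_nat[of Q m "card W"] that bound by blast
  have n1: "1 \<le> n" using max Q1 by blast
  obtain vs where vs: "distinct vs" "set vs \<subseteq> W" "walk E vs" "length vs = n" using Qn unfolding Q_def by blast
  have v0: "vs ! 0 \<in> W" using vs n1 by (metis less_le_trans nth_mem subsetD zero_less_one)
  \<comment> \<open>If the walk has only one vertex, \<open>vs ! 1\<close> is an arbitrary value.
    This does no harm, as two neighbours do not fit into any singleton.\<close>
  have "\<not> nbrs E W (vs ! 0) \<subseteq> {vs ! 1}"
  proof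
    assume "nbrs E W (vs ! 0) \<subseteq> {vs ! 1}"
    then have "card (nbrs E W (vs ! 0)) \<le> card {vs ! 1}" by (intro card_mono) auto
    then show False using d2[OF v0] by simp
  qed
  then obtain u where u: "u \<in> W" "{u, vs ! 0} \<in> E" "u \<noteq> vs ! 1" unfolding nbrs_def by blast
  have "u \<noteq> vs ! 0" using u(2) nl by auto
  show False
  proof (cases "u \<in> set vs")
    case False
    have "walk E (u # vs)" unfolding walk_def
    proof (intro allI impI)
      fix i assume "Suc i < length (u # vs)"
      then show "{(u # vs) ! i, (u # vs) ! Suc i} \<in> E" using u(2) vs(3) unfolding walk_def by (cases i) auto
    qed
    then have "Q (Suc n)" unfolding Q_def using False vs u(1) by (intro exI[of _ "u # vs"]) auto
    then show False using max[of "Suc n"] by simp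
  next
    case True
    then obtain j where j: "j < n" "u = vs ! j" using vs(4) by (metis in_set_conv_nth)
    have "j \<noteq> 0" "j \<noteq> 1" using j(2) u(3) \<open>u \<noteq> vs ! 0\<close> by metis+
    then have j2: "2 \<le> j" by linarith
    let ?c = "take (Suc j) vs"
    have len: "length ?c = Suc j" using j vs(4) by simp
    have "is_cycle E ?c" unfolding is_cycle_def len
    proof (intro conjI allI impI)
      show "3 \<le> Suc j" "distinct ?c" using j2 vs(1) by auto
      fix i assume i: "i < Suc j"
      show "{?c ! i, ?c ! (Suc i mod Suc j)} \<in> E"
      proof (cases "i = j")
        case True
        then show ?thesis using u(2) j by simp
      next
        case False
        then have "Suc i < Suc j" using i by simp
        then show ?thesis using vs(3,4) j(1) unfolding walk_def by simp
      qed
    qed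
    then show False using ac by blast
  qed
qed

lemma tree_edges:
  assumes T: "tree V E" and W: "W \<subseteq> V" "W \<noteq> {}"
  shows "card (edges_in E W) + 1 \<le> card W"
proof -
  have G: "simple_graph V E" and ac: "\<nexists>vs. is_cycle E vs" using T unfolding tree_def by auto
  have nl: "{u} \<notin> E" for u using edge_neq[OF G, of u u] by auto
  have finW: "finite W" using simple_graphD(1)[OF G] W(1) finite_subset by blast
  then have "1 \<le> card W" using W(2) by (simp add: Suc_leI card_gt_0_iff)
  moreover have "\<exists>w\<in>U. card (nbrs E U w) \<le> 1" if "U \<subseteq> W" "U \<noteq> {}" for U
    using acyclic_low_degree[OF _ that(2) nl ac] finite_subset[OF that(1) finW] by blast
  ultimately have "2 * card (edges_in E W) + 1 * (1 + 1) \<le> 2 * 1 * card W"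
    by (rule degenerate_edges[OF G finW])
  then show ?thesis by simp
qed

text \<open>The map that sends the leaf \<open>i\<close> to its only neighbour \<open>j\<close> and
  fixes all other vertices turns every walk into one that avoids \<open>i\<close>.\<close>

lemma connected_delete_leaf:
  assumes con: "connected_graph T {e \<in> F. e \<subseteq> T}" and j: "j \<in> T" "j \<noteq> i"
    and leaf: "\<And>a. a \<in> T \<Longrightarrow> {a, i} \<in> F \<Longrightarrow> a = j \<or> a = i"
  shows "connected_graph (T - {i}) {e \<in> F. e \<subseteq> T - {i}}"
  unfolding connected_graph_def
proof (intro conjI ballI)
  show "T - {i} \<noteq> {}" using j by blast
  let ?R = "{(a, b). {a, b} \<in> {e \<in> F. e \<subseteq> T}}" and ?R' = "{(a, b). {a, b} \<in> {e \<in> F. e \<subseteq> T - {i}}}"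
  define \<phi> where "\<phi> a = (if a = i then j else a)" for a
  have step: "(\<phi> a, \<phi> b) \<in> ?R'\<^sup>*" if ab: "(a, b) \<in> ?R" for a b
  proof -
    have e: "{a, b} \<in> F" "a \<in> T" "b \<in> T" using ab by auto
    have e': "{b, a} \<in> F" using e(1) by (simp add: insert_commute)
    consider "a = i" "b = i" | "a = i" "b \<noteq> i" | "a \<noteq> i" "b = i" | "a \<noteq> i" "b \<noteq> i" by blast
    then show ?thesis
    proof cases
      case 2
      then have "b = j" using leaf[OF e(3)] e' by auto
      then show ?thesis using 2 \<phi>_def by simp
    next
      case 3
      then have "a = j" using leaf[OF e(2)] e by auto
      then show ?thesis using 3 \<phi>_def by simp
    next
      case 4
      then have "(a, b) \<in> ?R'" using e by auto
      then show ?thesis using 4 \<phi>_def by (simp add: r_into_rtrancl)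
    qed (simp add: \<phi>_def)
  qed
  have path: "(\<phi> u, \<phi> v) \<in> ?R'\<^sup>*" if "(u, v) \<in> ?R\<^sup>*" for u v
    using that
  proof (induction rule: rtrancl_induct)
    case (step b c)
    then show ?case using \<open>\<And>a b. (a, b) \<in> ?R \<Longrightarrow> (\<phi> a, \<phi> b) \<in> ?R'\<^sup>*\<close>[of b c] by (meson rtrancl_trans)
  qed simp
  fix u v assume uv: "u \<in> T - {i}" "v \<in> T - {i}"
  then have "(u, v) \<in> ?R\<^sup>*" using con unfolding connected_graph_def by blast
  from path[OF this] show "(u, v) \<in> ?R'\<^sup>*" using uv unfolding \<phi>_def by simp
qed

text \<open>Either a leaf bag of the decomposition contains a vertex lying in no other bag, whose
  neighbours all lie in that bag, or the leaf bag can be discarded.\<close>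
lemma decomposition_low_degree:
  fixes B :: "'i \<Rightarrow> 'a set"
  assumes I: "finite I" and nl: "\<And>i. {i} \<notin> F" and ac: "\<nexists>vs. is_cycle F vs"
    and W: "finite W" "W \<noteq> {}" and noloop: "\<And>u. {u} \<notin> E"
    and con: "\<And>w. w \<in> W \<Longrightarrow> connected_graph {i \<in> I. w \<in> B i} {e \<in> F. e \<subseteq> {i \<in> I. w \<in> B i}}"
    and cov: "\<And>u w. u \<in> W \<Longrightarrow> w \<in> W \<Longrightarrow> {u, w} \<in> E \<Longrightarrow> \<exists>i\<in>I. u \<in> B i \<and> w \<in> B i"
    and width: "\<And>i. i \<in> I \<Longrightarrow> finite (B i) \<and> card (B i) \<le> t + 1"
  shows "\<exists>w\<in>W. card (nbrs E W w) \<le> t"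
  using I con cov width
proof (induction I rule: finite_psubset_induct)
  case (psubset I)
  obtain w0 where w0: "w0 \<in> W" using W by blast
  then have "{i \<in> I. w0 \<in> B i} \<noteq> {}" using psubset.prems(1) unfolding connected_graph_def by blast
  then have "I \<noteq> {}" by blast
  \<comment> \<open>A leaf of the decomposition tree. Only \<open>I\<close> shrinks in the
    induction, while \<open>F\<close> stays and is restricted by \<open>nbrs\<close>, so acyclicity
    is inherited at once.\<close>
  from acyclic_low_degree[OF psubset.hyps this nl ac]
  obtain i where i: "i \<in> I" "card (nbrs F I i) \<le> 1" by blast
  have finN: "finite (nbrs F I i)" unfolding nbrs_def using psubset.hyps by simp
  show ?case
  proof (cases "\<exists>w\<in>W \<inter> B i. \<forall>i'\<in>I. w \<in> B i' \<longrightarrow> i' = i")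
    case True
    then obtain w where w: "w \<in> W" "w \<in> B i" "\<And>i'. i' \<in> I \<Longrightarrow> w \<in> B i' \<Longrightarrow> i' = i" by blast
    have "nbrs E W w \<subseteq> B i - {w}"
    proof
      fix u assume "u \<in> nbrs E W w"
      then have u: "u \<in> W" "{u, w} \<in> E" unfolding nbrs_def by auto
      then obtain i' where "i' \<in> I" "u \<in> B i'" "w \<in> B i'" using psubset.prems(2) w(1) by blast
      then have "u \<in> B i" using w(3) by blast
      moreover have "u \<noteq> w" using u(2) noloop by auto
      ultimately show "u \<in> B i - {w}" by blast
    qed
    then have "card (nbrs E W w) \<le> card (B i - {w})" using psubset.prems(3)[OF i(1)] by (intro card_mono) auto
    also have "card (B i - {w}) = card (B i) - 1" using w(2) by simp
    also have "\<dots> \<le> t" using psubset.prems(3)[OF i(1)] by linarith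
    finally show ?thesis using w(1) by blast
  next
    case False
    have other: "\<exists>j. j \<in> I \<and> j \<noteq> i \<and> w \<in> B j \<and> {j, i} \<in> F" if w: "w \<in> W" "w \<in> B i" for w
    proof -
      let ?T = "{i \<in> I. w \<in> B i}"
      let ?R = "{(a, b). {a, b} \<in> {e \<in> F. e \<subseteq> ?T}}"
      obtain i' where i': "i' \<in> I" "w \<in> B i'" "i' \<noteq> i" using False w by blast
      note con = psubset.prems(1)[OF w(1), unfolded connected_graph_def]
      have "i \<in> ?T" "i' \<in> ?T" using i' i(1) w(2) by auto
      then have "(i, i') \<in> ?R\<^sup>*" by (rule conjunct2[OF con, THEN bspec, THEN bspec])
      then obtain j where "(i, j) \<in> ?R" by (rule converse_rtranclE) (use i'(3) in simp, rule that)
      then have "{i, j} \<in> F" "j \<in> I" "w \<in> B j" by auto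
      moreover have "j \<noteq> i" using \<open>{i, j} \<in> F\<close> nl[of i] by auto
      ultimately show ?thesis by (auto simp: insert_commute)
    qed
    have uniq: "j = j'" if "j \<in> nbrs F I i" "j' \<in> nbrs F I i" for j j'
      using that i(2) finN card_le_Suc0_iff_eq[OF finN] by auto
    show ?thesis
    proof (rule psubset.IH[of "I - {i}"])
      show "I - {i} \<subset> I" using i by blast
      show "finite (B i') \<and> card (B i') \<le> t + 1" if "i' \<in> I - {i}" for i' using psubset.prems(3) that by blast
      show "\<exists>i'\<in>I - {i}. u \<in> B i' \<and> w \<in> B i'" if uw: "u \<in> W" "w \<in> W" "{u, w} \<in> E" for u w
      proof -
        obtain i' where i': "i' \<in> I" "u \<in> B i'" "w \<in> B i'" using psubset.prems(2)[OF uw] by blast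
        show ?thesis
        proof (cases "i' = i")
          case False
          then show ?thesis using i' by blast
        next
          case True
          obtain j where j: "j \<in> I" "j \<noteq> i" "u \<in> B j" "{j, i} \<in> F" using other[OF uw(1)] i' True by blast
          obtain j' where j': "j' \<in> I" "j' \<noteq> i" "w \<in> B j'" "{j', i} \<in> F" using other[OF uw(2)] i' True by blast
          have "j = j'" using uniq j j' unfolding nbrs_def by blast
          then show ?thesis using j j' by blast
        qed
      qed
      fix w assume w: "w \<in> W"
      let ?T = "{i \<in> I. w \<in> B i}"
      have eq: "{i' \<in> I - {i}. w \<in> B i'} = ?T - {i}" by blast
      show "connected_graph {i' \<in> I - {i}. w \<in> B i'} {e \<in> F. e \<subseteq> {i' \<in> I - {i}. w \<in> B i'}}"
      proof (cases "w \<in> B i")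
        case False
        then have "?T - {i} = ?T" by blast
        then show ?thesis unfolding eq using psubset.prems(1)[OF w] by simp
      next
        case True
        obtain j where j: "j \<in> I" "j \<noteq> i" "w \<in> B j" "{j, i} \<in> F" using other[OF w True] by blast
        show ?thesis unfolding eq
        proof (rule connected_delete_leaf[OF psubset.prems(1)[OF w], of j])
          show "j \<in> ?T" "j \<noteq> i" using j by auto
          show "a = j \<or> a = i" if "a \<in> ?T" "{a, i} \<in> F" for a
            using uniq[of a j] that j unfolding nbrs_def by blast
        qed
      qed
    qed
  qed
qed

text \<open>The least width is attained because the decomposition with the single bag
  \<open>V\<close> provides some width to begin with.\<close>

lemma tree_width_attained:
  assumes G: "simple_graph V E"
  shows "\<exists>I F B. tree_decomposition V E I F B \<and> (\<forall>i\<in>I. card (B i) \<le> tree_width V E + 1)"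
  unfolding tree_width_def
proof (rule LeastI_ex)
  have "tree {0::nat} {}" unfolding tree_def simple_graph_def connected_graph_def is_cycle_def
    by (auto intro!: exI[of _ 0])
  then have "tree_decomposition V E {0} {} (\<lambda>_. V)"
    unfolding tree_decomposition_def connected_graph_def using simple_graphD(3)[OF G] by auto
  then show "\<exists>w I F B. tree_decomposition V E I F B \<and> (\<forall>i\<in>I. card (B i) \<le> w + 1)"
    by (intro exI[of _ "card V"] exI[of _ "{0}"] exI[of _ "{}"] exI[of _ "\<lambda>_. V"]) auto
qed

lemma tree_width_edges:
  assumes G: "simple_graph V E" and tw: "tree_width V E \<le> t" and W: "W \<subseteq> V" "t \<le> card W"
  shows "2 * card (edges_in E W) + t * (t + 1) \<le> 2 * t * card W"
proof (rule degenerate_edges[OF G _ W(2)])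
  have finV: "finite V" by (rule simple_graphD(1)[OF G])
  then show "finite W" using W(1) finite_subset by blast
  fix U assume U: "U \<subseteq> W" "U \<noteq> {}"
  obtain I F B where D: "tree_decomposition V E I F B" and wd: "\<forall>i\<in>I. card (B i) \<le> tree_width V E + 1"
    using tree_width_attained[OF G] by blast
  have T: "tree I F" and un: "(\<Union>i\<in>I. B i) = V" and cov: "\<forall>e\<in>E. \<exists>i\<in>I. e \<subseteq> B i"
    and con: "\<forall>v\<in>V. connected_graph {i \<in> I. v \<in> B i} {e \<in> F. e \<subseteq> {i \<in> I. v \<in> B i}}"
    using D unfolding tree_decomposition_def by auto
  have GT: "simple_graph I F" and ac: "\<nexists>vs. is_cycle F vs" using T unfolding tree_def by auto
  show "\<exists>w\<in>U. card (nbrs E U w) \<le> t"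
  proof (rule decomposition_low_degree[where B = B])
    show "finite I" by (rule simple_graphD(1)[OF GT])
    show "{i} \<notin> F" for i using edge_neq[OF GT, of i i] by auto
    show "{u} \<notin> E" for u using edge_neq[OF G, of u u] by auto
    show "\<nexists>vs. is_cycle F vs" by (rule ac)
    have UV: "U \<subseteq> V" using U(1) W(1) by (rule subset_trans)
    show "finite U" by (rule finite_subset[OF UV finV])
    show "U \<noteq> {}" by (rule U(2))
    show "connected_graph {i \<in> I. w \<in> B i} {e \<in> F. e \<subseteq> {i \<in> I. w \<in> B i}}" if "w \<in> U" for w
      using con[rule_format, OF subsetD[OF UV that]] .
    show "\<exists>i\<in>I. u \<in> B i \<and> w \<in> B i" if uw: "{u, w} \<in> E" for u w
    proof -
      obtain i where "i \<in> I" "{u, w} \<subseteq> B i" using bspec[OF cov uw] by (rule bexE)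
      then show ?thesis by auto
    qed
    show "finite (B i) \<and> card (B i) \<le> t + 1" if i: "i \<in> I" for i
    proof
      have "B i \<subseteq> V" using un i by blast
      then show "finite (B i)" using finV finite_subset by blast
      show "card (B i) \<le> t + 1" using wd i tw by fastforce
    qed
  qed
qed

lemma degree_nbrs: "simple_graph V E \<Longrightarrow> v \<in> V \<Longrightarrow> degree E v = card (nbrs E V v)"
proof -
  assume G: "simple_graph V E" "v \<in> V"
  have "edges_in E V = E" unfolding edges_in_def using simple_graphD(3)[OF G(1)] by blast
  then show ?thesis using card_edges_at[OF G] unfolding degree_def by simp
qed

lemma degree_le_max: "simple_graph V E \<Longrightarrow> v \<in> V \<Longrightarrow> degree E v \<le> max_degree V E"
  unfolding max_degree_def using simple_graphD(1) by (intro Max_ge) auto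

lemma max_degree_attained: "simple_graph V E \<Longrightarrow> \<exists>v\<in>V. degree E v = max_degree V E"
proof -
  assume "simple_graph V E"
  then have "max_degree V E \<in> degree E ` V"
    unfolding max_degree_def using simple_graphD(1,2) by (intro Max_in) auto
  then show ?thesis by force
qed

lemma max_degree_less: "simple_graph V E \<Longrightarrow> max_degree V E < card V"
proof -
  assume G: "simple_graph V E"
  obtain v where v: "v \<in> V" "degree E v = max_degree V E" using max_degree_attained[OF G] by blast
  have "degree E v \<le> card V - 1"
    using card_nbrs_le[OF G simple_graphD(1)[OF G] v(1)] degree_nbrs[OF G v(1)] by simp
  moreover have "card V > 0" using v(1) simple_graphD(1)[OF G] by (auto simp: card_gt_0_iff)
  ultimately show ?thesis using v(2) by linarith
qed

section \<open>The largest eigenvalue\<close>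

definition quad :: "'a set \<Rightarrow> 'a set set \<Rightarrow> ('a \<Rightarrow> real) \<Rightarrow> ('a \<Rightarrow> real) \<Rightarrow> real" where
  "quad V E x y = (\<Sum>u\<in>V. \<Sum>v\<in>V. adj_entry E u v * x u * y v)"

lemma adj_entry_sym: "adj_entry E u v = adj_entry E v u"
  unfolding adj_entry_def by (simp add: insert_commute)

lemma adj_entry_nonneg: "0 \<le> adj_entry E u v"
  unfolding adj_entry_def by simp

lemma quad_sym: "quad V E x y = quad V E y x"
proof -
  have "quad V E x y = (\<Sum>v\<in>V. \<Sum>u\<in>V. adj_entry E u v * x u * y v)" unfolding quad_def by (rule sum.swap)
  also have "\<dots> = quad V E y x" unfolding quad_def
    by (intro sum.cong refl) (simp add: adj_entry_sym mult.commute mult.left_commute)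
  finally show ?thesis .
qed

lemma quad_eigen:
  assumes "\<forall>u\<in>V. (\<Sum>v\<in>V. adj_entry E u v * x v) = \<mu> * x u"
  shows "quad V E y x = \<mu> * (\<Sum>u\<in>V. y u * x u)"
proof -
  have "quad V E y x = (\<Sum>u\<in>V. y u * (\<Sum>v\<in>V. adj_entry E u v * x v))"
    unfolding quad_def sum_distrib_left by (intro sum.cong refl) (simp add: mult.commute mult.left_commute)
  also have "\<dots> = (\<Sum>u\<in>V. y u * (\<mu> * x u))" using assms by (intro sum.cong) auto
  also have "\<dots> = \<mu> * (\<Sum>u\<in>V. y u * x u)" unfolding sum_distrib_left by (intro sum.cong refl) (simp add: mult.left_commute)
  finally show ?thesis .
qed

lemma eigenvectors_orthogonal:
  assumes "\<forall>u\<in>V. (\<Sum>v\<in>V. adj_entry E u v * x v) = \<mu> * x u"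
    "\<forall>u\<in>V. (\<Sum>v\<in>V. adj_entry E u v * y v) = \<nu> * y u" "\<mu> \<noteq> \<nu>"
  shows "(\<Sum>u\<in>V. x u * y u) = 0"
proof -
  have "\<nu> * (\<Sum>u\<in>V. x u * y u) = quad V E x y" using quad_eigen[OF assms(2)] by simp
  also have "\<dots> = quad V E y x" by (rule quad_sym)
  also have "\<dots> = \<mu> * (\<Sum>u\<in>V. y u * x u)" by (rule quad_eigen[OF assms(1)])
  finally have "(\<nu> - \<mu>) * (\<Sum>u\<in>V. x u * y u) = 0" by (simp add: mult.commute algebra_simps)
  then show ?thesis using assms(3) by simp
qed

text \<open>Bessel's inequality for the unit vectors bounds the size of an orthonormal system.\<close>
lemma orthonormal_card_le:
  fixes y :: "'i \<Rightarrow> 'a \<Rightarrow> real"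
  assumes V: "finite V" and I: "finite I"
    and o: "\<And>i j. i \<in> I \<Longrightarrow> j \<in> I \<Longrightarrow> (\<Sum>v\<in>V. y i v * y j v) = (if i = j then 1 else 0)"
  shows "card I \<le> card V"
proof -
  have bessel: "(\<Sum>i\<in>I. (y i v)\<^sup>2) \<le> 1" if v: "v \<in> V" for v
  proof -
    define P where "P w = (\<Sum>i\<in>I. y i v * y i w)" for w
    have 1: "(\<Sum>w\<in>V. (if w = v then 1 else 0) * P w) = P v"
      using V v by (subst sum.cong[OF refl, of V _ "\<lambda>w. if w = v then P w else 0"]) auto
    have 2: "(\<Sum>w\<in>V. (if w = v then 1 else 0 :: real)) = 1" using V v by simp
    have 3: "(\<Sum>w\<in>V. (P w)\<^sup>2) = P v"
    proof -
      have "(\<Sum>w\<in>V. (P w)\<^sup>2) = (\<Sum>w\<in>V. \<Sum>i\<in>I. \<Sum>j\<in>I. (y i v * y j v) * (y i w * y j w))"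
        unfolding P_def power2_eq_square sum_product by (intro sum.cong refl) (simp add: ac_simps)
      also have "\<dots> = (\<Sum>i\<in>I. \<Sum>w\<in>V. \<Sum>j\<in>I. (y i v * y j v) * (y i w * y j w))" by (rule sum.swap)
      also have "\<dots> = (\<Sum>i\<in>I. \<Sum>j\<in>I. \<Sum>w\<in>V. (y i v * y j v) * (y i w * y j w))" by (intro sum.cong refl sum.swap)
      also have "\<dots> = (\<Sum>i\<in>I. \<Sum>j\<in>I. (y i v * y j v) * (if i = j then 1 else 0))"
        unfolding sum_distrib_left[symmetric] using o by (intro sum.cong refl) simp
      also have "\<dots> = (\<Sum>i\<in>I. y i v * y i v)"
      proof (rule sum.cong[OF refl])
        fix i assume "i \<in> I"
        then show "(\<Sum>j\<in>I. (y i v * y j v) * (if i = j then 1 else 0)) = y i v * y i v"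
          using I by (subst sum.cong[OF refl, of I _ "\<lambda>j. if j = i then y i v * y i v else 0"]) auto
      qed
      finally show ?thesis unfolding P_def .
    qed
    have "0 \<le> (\<Sum>w\<in>V. ((if w = v then 1 else 0) - P w)\<^sup>2)" by (intro sum_nonneg) simp
    also have "\<dots> = (\<Sum>w\<in>V. (if w = v then 1 else 0) - 2 * ((if w = v then 1 else 0) * P w) + (P w)\<^sup>2)"
      by (intro sum.cong refl) (auto simp: power2_eq_square algebra_simps)
    also have "\<dots> = 1 - P v" using 1 2 3 by (simp add: sum.distrib sum_subtractf flip: sum_distrib_left)
    finally show ?thesis unfolding P_def by (simp add: power2_eq_square)
  qed
  have "real (card I) = (\<Sum>i\<in>I. \<Sum>v\<in>V. y i v * y i v)" using o by simp
  also have "\<dots> = (\<Sum>v\<in>V. \<Sum>i\<in>I. (y i v)\<^sup>2)" unfolding power2_eq_square by (rule sum.swap)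
  also have "\<dots> \<le> (\<Sum>v\<in>V. 1)" using bessel by (intro sum_mono)
  finally show ?thesis by simp
qed

lemma sum_squares_pos:
  assumes "finite V" "\<exists>v\<in>V. x v \<noteq> (0::real)" shows "0 < (\<Sum>v\<in>V. (x v)\<^sup>2)"
proof -
  obtain v where v: "v \<in> V" "x v \<noteq> 0" using assms by blast
  have "0 < (x v)\<^sup>2" using v by simp
  also have "\<dots> \<le> (\<Sum>v\<in>V. (x v)\<^sup>2)" using member_le_sum[of v V "\<lambda>v. (x v)\<^sup>2"] v assms by simp
  finally show ?thesis .
qed

text \<open>Ensures that \<open>Max\<close> in the definition of the largest eigenvalue is
  meaningful. Normalised eigenvectors for different eigenvalues form an orthonormal system, which
  has at most as many members as \<open>V\<close>.\<close>

lemma finite_eigenvalues: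
  assumes V: "finite V" shows "finite {\<mu>. adj_eigenvalue V E \<mu>}"
proof (rule ccontr)
  assume "\<not> ?thesis"
  then obtain I where I: "finite I" "card I = Suc (card V)" "I \<subseteq> {\<mu>. adj_eigenvalue V E \<mu>}"
    using infinite_arbitrarily_large by blast
  have "\<forall>\<mu>. \<exists>x. \<mu> \<in> I \<longrightarrow> (\<exists>v\<in>V. x v \<noteq> 0) \<and> (\<forall>u\<in>V. (\<Sum>v\<in>V. adj_entry E u v * x v) = \<mu> * x u)"
    using I(3) unfolding adj_eigenvalue_def by blast
  then obtain x where x: "\<And>\<mu>. \<mu> \<in> I \<Longrightarrow> (\<exists>v\<in>V. x \<mu> v \<noteq> 0) \<and> (\<forall>u\<in>V. (\<Sum>v\<in>V. adj_entry E u v * x \<mu> v) = \<mu> * x \<mu> u)"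
    by metis
  define y where "y \<mu> v = x \<mu> v / sqrt (\<Sum>v\<in>V. (x \<mu> v)\<^sup>2)" for \<mu> v
  have "(\<Sum>v\<in>V. y i v * y j v) = (if i = j then 1 else 0)" if ij: "i \<in> I" "j \<in> I" for i j
  proof -
    have "(\<Sum>v\<in>V. y i v * y j v) = (\<Sum>v\<in>V. x i v * x j v) / (sqrt (\<Sum>v\<in>V. (x i v)\<^sup>2) * sqrt (\<Sum>v\<in>V. (x j v)\<^sup>2))"
      unfolding y_def by (simp add: sum_divide_distrib)
    moreover have "0 < (\<Sum>v\<in>V. (x i v)\<^sup>2)" using sum_squares_pos[OF V] x[OF ij(1)] by blast
    moreover have "(\<Sum>v\<in>V. x i v * x j v) = 0" if "i \<noteq> j"
      using eigenvectors_orthogonal[of V E "x i" i "x j" j] x ij that by blast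
    moreover have "(\<Sum>v\<in>V. x i v * x i v) / (sqrt (\<Sum>v\<in>V. (x i v)\<^sup>2) * sqrt (\<Sum>v\<in>V. (x i v)\<^sup>2)) = 1"
      using \<open>0 < (\<Sum>v\<in>V. (x i v)\<^sup>2)\<close> unfolding power2_eq_square by simp
    ultimately show ?thesis by (cases "i = j") simp_all
  qed
  from orthonormal_card_le[OF V I(1) this] show False using I(2) by simp
qed

lemma quad_add_scaled: "quad V E (\<lambda>v. x v + t * h v) (\<lambda>v. x v + t * h v) =
  quad V E x x + 2 * t * quad V E h x + t\<^sup>2 * quad V E h h"
proof -
  have "quad V E (\<lambda>v. x v + t * h v) (\<lambda>v. x v + t * h v) =
      quad V E x x + t * quad V E x h + t * quad V E h x + t\<^sup>2 * quad V E h h"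
    unfolding quad_def sum_distrib_left sum.distrib[symmetric]
    by (intro sum.cong refl) (simp add: power2_eq_square algebra_simps)
  then show ?thesis using quad_sym[of V E x h] by simp
qed

lemma linear_coefficient_zero:
  fixes b c :: real
  assumes "\<And>t. 2 * t * b + t\<^sup>2 * c \<le> 0"
  shows "b = 0"
proof (rule ccontr)
  assume b: "b \<noteq> 0"
  \<comment> \<open>At \<open>t = b / m\<close> the quadratic term is smaller in absolute value than
    the linear one, since m exceeds the absolute value of \<open>c\<close>; the sum is then
    positive.\<close>
  define m where "m = \<bar>c\<bar> + 1"
  have m: "m > 0" "c < m" "- m < c" unfolding m_def by linarith+
  have "2 * (b / m) * b + (b / m)\<^sup>2 * c = b\<^sup>2 / m * (2 + c / m)"
    using m by (simp add: power2_eq_square field_simps)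
  moreover have "c / m > - 1" using m by (simp add: field_simps)
  then have "b\<^sup>2 / m * (2 + c / m) > 0" using b m by (intro mult_pos_pos) auto
  ultimately show False using assms[of "b / m"] by linarith
qed

text \<open>A maximiser of the Rayleigh quotient is an eigenvector.\<close>
lemma eigenvalue_exists:
  assumes V: "finite V" "V \<noteq> {}" shows "\<exists>\<mu>. adj_eigenvalue V E \<mu>"
proof -
  \<comment> \<open>The unit sphere, with coordinates outside \<open>V\<close> pinned to 0. As a
    closed subset of a product of compact sets it is compact by Tychonoff's theorem, whatever the
    type of vertices.\<close>
  define K where "K = {x :: 'a \<Rightarrow> real. x \<in> (\<Pi>\<^sub>E v\<in>UNIV. if v \<in> V then {-1..1} else {0}) \<and> (\<Sum>v\<in>V. (x v)\<^sup>2) = 1}"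
  have cont: "continuous_on A (\<lambda>x :: 'a \<Rightarrow> real. x v)" for v A
    by (rule continuous_on_subset[OF continuous_on_product_coordinates]) simp
  have "compactin (product_topology (\<lambda>_. euclidean) UNIV) (\<Pi>\<^sub>E v\<in>UNIV. if v \<in> V then {-1..1::real} else {0})"
    unfolding compactin_PiE by auto
  then have "compact (\<Pi>\<^sub>E v\<in>UNIV. if v \<in> V then {-1..1::real} else {0})"
    by (simp add: euclidean_product_topology)
  moreover have "closed {x :: 'a \<Rightarrow> real. (\<Sum>v\<in>V. (x v)\<^sup>2) = 1}"
    by (intro closed_Collect_eq continuous_intros cont)
  ultimately have cK: "compact K" unfolding K_def Collect_conj_eq Collect_mem_eq by (rule compact_Int_closed)
  obtain v0 where v0: "v0 \<in> V" using V by blast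
  have "(\<lambda>v. if v = v0 then 1 else 0) \<in> K"
  proof -
    have "(\<Sum>v\<in>V. (if v = v0 then 1 else 0 :: real)\<^sup>2) = (\<Sum>v\<in>V. if v = v0 then 1 else 0)"
      by (intro sum.cong) auto
    also have "\<dots> = 1" using V v0 by simp
    finally show ?thesis unfolding K_def using v0 by auto
  qed
  then have nK: "K \<noteq> {}" by blast
  have cq: "continuous_on K (\<lambda>x. quad V E x x)"
    unfolding quad_def by (intro continuous_intros cont)
  obtain x where x: "x \<in> K" "\<And>y. y \<in> K \<Longrightarrow> quad V E y y \<le> quad V E x x"
    using continuous_attains_sup[OF cK nK cq] by blast
  define \<mu> where "\<mu> = quad V E x x"
  have x1: "(\<Sum>v\<in>V. (x v)\<^sup>2) = 1" using x(1) unfolding K_def by blast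
  have max: "quad V E y y \<le> \<mu> * (\<Sum>v\<in>V. (y v)\<^sup>2)" for y
  proof (cases "\<exists>v\<in>V. y v \<noteq> 0")
    case False
    then have "quad V E y y = 0" "(\<Sum>v\<in>V. (y v)\<^sup>2) = 0" unfolding quad_def by auto
    then show ?thesis by simp
  next
    case True
    define r where "r = sqrt (\<Sum>v\<in>V. (y v)\<^sup>2)"
    have r: "r > 0" "r\<^sup>2 = (\<Sum>v\<in>V. (y v)\<^sup>2)" using sum_squares_pos[OF V(1) True] unfolding r_def by simp_all
    define w where "w v = (if v \<in> V then y v / r else 0)" for v
    have "(\<Sum>v\<in>V. (w v)\<^sup>2) = (\<Sum>v\<in>V. (y v)\<^sup>2) / r\<^sup>2" unfolding w_def by (simp add: power_divide sum_divide_distrib)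
    then have w1: "(\<Sum>v\<in>V. (w v)\<^sup>2) = 1" unfolding r(2)[symmetric] using r(1) by simp
    have "\<bar>w v\<bar> \<le> 1" if "v \<in> V" for v
    proof -
      have "(w v)\<^sup>2 \<le> 1" using member_le_sum[of v V "\<lambda>v. (w v)\<^sup>2"] that V(1) w1 by simp
      then show ?thesis by (simp add: abs_square_le_1)
    qed
    then have "w v \<in> (if v \<in> V then {-1..1} else {0})" for v
      by (cases "v \<in> V") (simp_all add: abs_le_iff, simp_all add: w_def)
    then have "w \<in> (\<Pi>\<^sub>E v\<in>UNIV. if v \<in> V then {-1..1} else {0})" by (intro PiE_I) auto
    then have "w \<in> K" unfolding K_def using w1 by simp
    then have "quad V E w w \<le> \<mu>" using x(2) unfolding \<mu>_def by blast
    moreover have "quad V E w w = quad V E y y / r\<^sup>2"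
      unfolding quad_def sum_divide_distrib by (intro sum.cong refl) (simp add: w_def power2_eq_square)
    ultimately have "quad V E y y / r\<^sup>2 \<le> \<mu>" by simp
    then have "quad V E y y \<le> \<mu> * r\<^sup>2" using r(1) by (simp add: pos_divide_le_eq)
    then show ?thesis unfolding r(2) .
  qed
  have "(\<Sum>v\<in>V. adj_entry E u v * x v) = \<mu> * x u" if u: "u \<in> V" for u
  proof -
    \<comment> \<open>Variation in the direction of the unit vector at \<open>u\<close>: the
      first-order condition at the maximum is the eigenvalue equation at \<open>u\<close>.\<close>
    define h where "h v = (if v = u then 1 else 0 :: real)" for v
    have q: "quad V E h x = (\<Sum>v\<in>V. adj_entry E u v * x v)"
    proof -
      have "quad V E h x = (\<Sum>w\<in>V. if w = u then (\<Sum>v\<in>V. adj_entry E u v * x v) else 0)"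
        unfolding quad_def by (intro sum.cong refl) (auto simp: h_def)
      then show ?thesis using u V by simp
    qed
    have hx: "(\<Sum>v\<in>V. h v * x v) = x u"
      using u V by (subst sum.cong[OF refl, of V _ "\<lambda>v. if v = u then x u else 0"]) (auto simp: h_def)
    have "2 * t * (quad V E h x - \<mu> * x u) + t\<^sup>2 * (quad V E h h - \<mu> * (\<Sum>v\<in>V. (h v)\<^sup>2)) \<le> 0" for t
    proof -
      have "(\<Sum>v\<in>V. (x v + t * h v)\<^sup>2) = (\<Sum>v\<in>V. (x v)\<^sup>2 + 2 * t * (h v * x v) + t\<^sup>2 * (h v)\<^sup>2)"
        by (intro sum.cong refl) (simp add: power2_eq_square algebra_simps)
      also have "\<dots> = 1 + 2 * t * x u + t\<^sup>2 * (\<Sum>v\<in>V. (h v)\<^sup>2)"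
        unfolding sum.distrib sum_distrib_left[symmetric] x1 hx by simp
      finally have "quad V E x x + 2 * t * quad V E h x + t\<^sup>2 * quad V E h h \<le> \<mu> * (1 + 2 * t * x u + t\<^sup>2 * (\<Sum>v\<in>V. (h v)\<^sup>2))"
        using max[of "\<lambda>v. x v + t * h v"] unfolding quad_add_scaled by simp
      then show ?thesis unfolding \<mu>_def by (simp add: algebra_simps)
    qed
    then have "quad V E h x - \<mu> * x u = 0" by (rule linear_coefficient_zero)
    then show ?thesis using q by simp
  qed
  moreover have "\<exists>v\<in>V. x v \<noteq> 0"
  proof (rule ccontr)
    assume "\<not> ?thesis"
    then have "(\<Sum>v\<in>V. (x v)\<^sup>2) = 0" by simp
    then show False using x1 by simp
  qed
  ultimately show ?thesis unfolding adj_eigenvalue_def by blast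
qed

lemma max_eigenvalue:
  assumes "finite V" "V \<noteq> {}"
  shows "adj_eigenvalue V E (max_eigenvalue V E)" "adj_eigenvalue V E \<mu> \<Longrightarrow> \<mu> \<le> max_eigenvalue V E"
  unfolding max_eigenvalue_def
  using Max_in[OF finite_eigenvalues[OF assms(1), of E]] eigenvalue_exists[OF assms, of E]
    Max_ge[OF finite_eigenvalues[OF assms(1), of E]] by auto

section \<open>Density bound for the largest eigenvalue\<close>

lemma adj_row_sum:
  assumes G: "simple_graph V E" and u: "u \<in> W" and W: "finite W"
  shows "(\<Sum>v\<in>W. adj_entry E u v) = real (card (nbrs E W u))"
proof -
  have "(\<Sum>v\<in>W. adj_entry E u v) = (\<Sum>v\<in>{v \<in> W. {u, v} \<in> E}. 1)"
    unfolding adj_entry_def using W by (simp add: sum.If_cases Int_def)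
  then show ?thesis unfolding nbrs_def by (simp add: insert_commute)
qed

lemma adj_total:
  assumes G: "simple_graph V E" and W: "finite W"
  shows "(\<Sum>u\<in>W. \<Sum>v\<in>W. adj_entry E u v) = 2 * real (card (edges_in E W))"
proof -
  have fE: "finite (edges_in E W)" by (rule finite_edges_in[OF G])
  have "(\<Sum>u\<in>W. \<Sum>v\<in>W. adj_entry E u v) = (\<Sum>u\<in>W. real (card {e \<in> edges_in E W. u \<in> e}))"
    using adj_row_sum[OF G _ W] card_edges_at[OF G] by (intro sum.cong) auto
  also have "\<dots> = real (\<Sum>u\<in>W. card {e \<in> edges_in E W. u \<in> e})" by simp
  also have "(\<Sum>u\<in>W. card {e \<in> edges_in E W. u \<in> e}) = (\<Sum>e\<in>edges_in E W. card {u \<in> W. u \<in> e})"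
    using sum.swap_restrict[OF W fE, of "\<lambda>_ _. 1::nat" "\<lambda>u e. u \<in> e"] by simp
  also have "\<dots> = (\<Sum>e\<in>edges_in E W. 2)"
  proof (rule sum.cong[OF refl])
    fix e assume "e \<in> edges_in E W"
    then have "{u \<in> W. u \<in> e} = e" "card e = 2" unfolding edges_in_def using simple_graphD(4)[OF G] by auto
    then show "card {u \<in> W. u \<in> e} = 2" by simp
  qed
  finally show ?thesis by simp
qed

text \<open>Layer-cake argument: peel off the superlevel sets of \<open>y\<close> one at a time.\<close>
lemma sum_min_le:
  assumes V: "finite V" and y: "\<And>v. v \<in> V \<Longrightarrow> 0 \<le> y v"
    and dens: "\<And>H. H \<subseteq> V \<Longrightarrow> (\<Sum>u\<in>H. \<Sum>v\<in>H. a u v) \<le> c * real (card H)"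
  shows "(\<Sum>u\<in>V. \<Sum>v\<in>V. a u v * min (y u) (y v)) \<le> c * (\<Sum>v\<in>V. y v :: real)"
  using y
proof (induction "card {v \<in> V. 0 < y v}" arbitrary: y rule: less_induct)
  case less
  let ?H = "{v \<in> V. 0 < y v}"
  have finH: "finite ?H" using V by simp
  show ?case
  proof (cases "?H = {}")
    case True
    then have "y v = 0" if "v \<in> V" for v using less.prems that by force
    then show ?thesis by simp
  next
    case False
    \<comment> \<open>The least positive value. Subtracting it on the support lowers each minimum by
      \<open>m\<close> exactly if both ends lie in the support, and it shrinks the support, on which
      the induction runs.\<close>
    define m where "m = Min (y ` ?H)"
    have "m \<in> y ` ?H" unfolding m_def using finH False by (intro Min_in) auto
    then obtain w where w: "w \<in> ?H" "y w = m" by auto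
    have mle: "m \<le> y v" if "v \<in> ?H" for v unfolding m_def using finH that by (intro Min_le) auto
    have m0: "0 < m" using w by simp
    define y' where "y' v = (if v \<in> ?H then y v - m else y v)" for v
    have y'0: "0 \<le> y' v" if "v \<in> V" for v using mle less.prems that unfolding y'_def by simp
    have "{v \<in> V. 0 < y' v} \<subset> ?H"
    proof
      show "{v \<in> V. 0 < y' v} \<subseteq> ?H" unfolding y'_def by auto
      show "{v \<in> V. 0 < y' v} \<noteq> ?H" using w unfolding y'_def by force
    qed
    then have "card {v \<in> V. 0 < y' v} < card ?H" using finH by (rule psubset_card_mono[rotated])
    from less.hyps[OF this y'0]
    have IH: "(\<Sum>u\<in>V. \<Sum>v\<in>V. a u v * min (y' u) (y' v)) \<le> c * (\<Sum>v\<in>V. y' v)" .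
    have min: "min (y u) (y v) = min (y' u) (y' v) + (if u \<in> ?H \<and> v \<in> ?H then m else 0)" if uv: "u \<in> V" "v \<in> V" for u v
    proof -
      have z: "y x = 0" "y' x = 0" if x: "x \<in> V" "x \<notin> ?H" for x
      proof -
        show "y x = 0" using less.prems[OF x(1)] x by force
        then show "y' x = 0" unfolding y'_def if_not_P[OF x(2)] .
      qed
      consider "u \<in> ?H" "v \<in> ?H" | "u \<notin> ?H" | "v \<notin> ?H" by blast
      then show ?thesis
      proof cases
        case 1
        then show ?thesis unfolding y'_def by (simp add: min_def)
      next
        case 2
        then show ?thesis using z[OF uv(1) 2] less.prems[OF uv(2)] y'0[OF uv(2)] by (auto simp: min_def)
      next
        case 3
        then show ?thesis using z[OF uv(2) 3] less.prems[OF uv(1)] y'0[OF uv(1)] by (auto simp: min_def)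
      qed
    qed
    have sub: "(\<Sum>u\<in>V. \<Sum>v\<in>V. if u \<in> ?H \<and> v \<in> ?H then a u v * m else 0) = m * (\<Sum>u\<in>?H. \<Sum>v\<in>?H. a u v)"
    proof -
      have "(\<Sum>u\<in>V. \<Sum>v\<in>V. if u \<in> ?H \<and> v \<in> ?H then a u v * m else 0) =
          (\<Sum>u\<in>V. if u \<in> ?H then (\<Sum>v\<in>V. if v \<in> ?H then a u v * m else 0) else 0)"
        by (intro sum.cong refl) auto
      also have "\<dots> = (\<Sum>u\<in>?H. \<Sum>v\<in>?H. a u v * m)"
        using V by (simp add: sum.If_cases Int_def conj_commute cong: conj_cong)
      finally show ?thesis by (simp add: sum_distrib_left mult.commute)
    qed
    have "(\<Sum>u\<in>V. \<Sum>v\<in>V. a u v * min (y u) (y v)) =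
        (\<Sum>u\<in>V. \<Sum>v\<in>V. a u v * min (y' u) (y' v) + (if u \<in> ?H \<and> v \<in> ?H then a u v * m else 0))"
      using min by (intro sum.cong refl) (simp add: distrib_left)
    also have "\<dots> = (\<Sum>u\<in>V. \<Sum>v\<in>V. a u v * min (y' u) (y' v)) + m * (\<Sum>u\<in>?H. \<Sum>v\<in>?H. a u v)"
      unfolding sum.distrib sub ..
    also have "\<dots> \<le> c * (\<Sum>v\<in>V. y' v) + m * (c * real (card ?H))"
      using IH dens[of ?H] m0 by (intro add_mono mult_left_mono) auto
    also have "\<dots> = c * (\<Sum>v\<in>V. y v)"
    proof -
      have "(\<Sum>v\<in>V. y v) = (\<Sum>v\<in>V. y' v + (if v \<in> ?H then m else 0))" unfolding y'_def by (intro sum.cong refl) simp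
      also have "\<dots> = (\<Sum>v\<in>V. y' v) + real (card ?H) * m"
        using V by (simp add: sum.distrib sum.If_cases Int_def conj_commute cong: conj_cong)
      finally show ?thesis by (simp add: algebra_simps)
    qed
    finally show ?thesis .
  qed
qed

text \<open>The eigenvalue equation is read at an entry of largest absolute value.\<close>

lemma eigenvalue_le_max_degree:
  assumes G: "simple_graph V E" and ev: "adj_eigenvalue V E \<mu>" and deg: "\<And>v. v \<in> V \<Longrightarrow> real (degree E v) \<le> \<Delta>"
  shows "\<mu> \<le> \<Delta>"
proof -
  note V = simple_graphD(1,2)[OF G]
  obtain x where x: "\<exists>v\<in>V. x v \<noteq> 0" "\<forall>u\<in>V. (\<Sum>v\<in>V. adj_entry E u v * x v) = \<mu> * x u"
    using ev unfolding adj_eigenvalue_def by blast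
  have "Max ((\<lambda>v. \<bar>x v\<bar>) ` V) \<in> (\<lambda>v. \<bar>x v\<bar>) ` V" using V by (intro Max_in) auto
  then obtain u where u: "u \<in> V" "\<bar>x u\<bar> = Max ((\<lambda>v. \<bar>x v\<bar>) ` V)" by force
  have mx: "\<bar>x v\<bar> \<le> \<bar>x u\<bar>" if "v \<in> V" for v unfolding u(2) using V that by (intro Max_ge) auto
  have pos: "0 < \<bar>x u\<bar>" using x(1) mx by force
  have "\<mu> * \<bar>x u\<bar> \<le> \<bar>\<mu> * x u\<bar>" by (simp add: abs_mult mult_right_mono)
  also have "\<dots> = \<bar>\<Sum>v\<in>V. adj_entry E u v * x v\<bar>" using x(2) u(1) by simp
  also have "\<dots> \<le> (\<Sum>v\<in>V. \<bar>adj_entry E u v * x v\<bar>)" by (rule sum_abs)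
  also have "\<dots> \<le> (\<Sum>v\<in>V. adj_entry E u v * \<bar>x u\<bar>)"
    using mx adj_entry_nonneg[of E] by (intro sum_mono) (simp add: abs_mult mult_left_mono)
  also have "\<dots> = real (degree E u) * \<bar>x u\<bar>"
    unfolding sum_distrib_right[symmetric] adj_row_sum[OF G u(1) V(1)] degree_nbrs[OF G u(1)] ..
  also have "\<dots> \<le> \<Delta> * \<bar>x u\<bar>" using deg[OF u(1)] by (intro mult_right_mono) auto
  finally show ?thesis using pos by simp
qed

text \<open>With m and M the smaller and larger square, this is 2 sqrt(m M) <= \<alpha> m + M /
  \<alpha>, rewritten in terms of m and m + M. The first is summed by the edge density, the second
  by the degrees.\<close>

lemma two_mult_le_min:
  fixes p q \<alpha> :: real assumes "0 < \<alpha>"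
  shows "2 * \<bar>p\<bar> * \<bar>q\<bar> \<le> (\<alpha> - 1 / \<alpha>) * min (p\<^sup>2) (q\<^sup>2) + (p\<^sup>2 + q\<^sup>2) / \<alpha>"
proof -
  have *: "2 * \<bar>p\<bar> * \<bar>q\<bar> \<le> (\<alpha> - 1 / \<alpha>) * p\<^sup>2 + (p\<^sup>2 + q\<^sup>2) / \<alpha>" for p q :: real
  proof -
    have "0 \<le> (\<alpha> * \<bar>p\<bar> - \<bar>q\<bar>)\<^sup>2 / \<alpha>" using assms by simp
    also have "\<dots> = \<alpha> * p\<^sup>2 + q\<^sup>2 / \<alpha> - 2 * \<bar>p\<bar> * \<bar>q\<bar>"
      using assms by (simp add: power2_eq_square field_simps)
    finally have "2 * \<bar>p\<bar> * \<bar>q\<bar> \<le> \<alpha> * p\<^sup>2 + q\<^sup>2 / \<alpha>" by simp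
    also have "\<dots> = (\<alpha> - 1 / \<alpha>) * p\<^sup>2 + (p\<^sup>2 + q\<^sup>2) / \<alpha>" using assms by (simp add: field_simps)
    finally show ?thesis .
  qed
  show ?thesis using *[of p q] *[of q p] by (cases "p\<^sup>2 \<le> q\<^sup>2") (simp_all add: min_def add.commute mult.commute mult.left_commute)
qed

theorem eigenvalue_density_bound:
  assumes G: "simple_graph V E" and ev: "adj_eigenvalue V E \<mu>"
    and deg: "\<And>v. v \<in> V \<Longrightarrow> real (degree E v) \<le> \<Delta>"
    and k: "0 \<le> k" "2 * k \<le> \<Delta>"
    and dens: "\<And>H. H \<subseteq> V \<Longrightarrow> H \<noteq> {} \<Longrightarrow> real (card (edges_in E H)) \<le> k * real (card H)"
  shows "\<mu> \<le> 2 * sqrt (k * (\<Delta> - k))"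
proof -
  note V = simple_graphD(1,2)[OF G]
  have dens': "(\<Sum>u\<in>H. \<Sum>v\<in>H. adj_entry E u v) \<le> (2 * k) * real (card H)" if "H \<subseteq> V" for H
  proof (cases "H = {}")
    case False
    have "finite H" using that V finite_subset by blast
    from adj_total[OF G this] show ?thesis using dens[OF that False] by simp
  qed simp
  obtain x where x: "\<exists>v\<in>V. x v \<noteq> 0" "\<forall>u\<in>V. (\<Sum>v\<in>V. adj_entry E u v * x v) = \<mu> * x u"
    using ev unfolding adj_eigenvalue_def by blast
  define Y where "Y = (\<Sum>v\<in>V. (x v)\<^sup>2)"
  have Y: "0 < Y" unfolding Y_def by (rule sum_squares_pos[OF V(1) x(1)])
  show ?thesis
  \<comment> \<open>With density 0 there are no edges at all, and the parameter \<alpha> below would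
    involve a division by 0.\<close>
  proof (cases "k = 0")
    case True
    have "real (degree E v) \<le> 0" if v: "v \<in> V" for v
    proof -
      have "edges_in E V = E" unfolding edges_in_def using simple_graphD(3)[OF G] by blast
      then have "card E = 0" using dens[of V] V True by simp
      then have "E = {}" using simple_graphD(5)[OF G] by simp
      then show ?thesis unfolding degree_def by simp
    qed
    from eigenvalue_le_max_degree[OF G ev this] show ?thesis using True by simp
  next
    case False
    then have k0: "0 < k" using k by simp
    \<comment> \<open>The minimiser of \<alpha> k + (\<Delta> - k) / \<alpha>, at which both terms
      are equal. It is at least 1 because 2 k <= \<Delta>, so the coefficient \<alpha> - 1 /
      \<alpha> of the density estimate is nonnegative.\<close>
    define \<alpha> where "\<alpha> = sqrt ((\<Delta> - k) / k)"
    have dk: "0 < \<Delta> - k" "k \<le> \<Delta> - k" using k k0 by linarith+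
    have a1: "1 \<le> \<alpha>" unfolding \<alpha>_def using dk k0 by (simp add: le_divide_eq)
    then have a0: "0 < \<alpha>" by linarith
    have a2: "\<alpha> * \<alpha> = (\<Delta> - k) / k" unfolding \<alpha>_def using dk k0 by simp
    have ainv: "1 / \<alpha> \<le> \<alpha>" using a1 a0 by (simp add: divide_le_eq) (metis mult_mono' mult_1 zero_le_one)
    have ak: "\<alpha> * k = sqrt (k * (\<Delta> - k))"
    proof -
      have "(\<alpha> * k)\<^sup>2 = (\<alpha> * \<alpha>) * k * k" by (simp add: power2_eq_square)
      also have "\<dots> = k * (\<Delta> - k)" unfolding a2 using k0 by simp
      finally have "(\<alpha> * k)\<^sup>2 = k * (\<Delta> - k)" .
      then show ?thesis using a0 k0 by (metis mult_nonneg_nonneg less_imp_le real_sqrt_unique)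
    qed
    have dka: "(\<Delta> - k) / \<alpha> = \<alpha> * k" using a2 a0 k0 by (simp add: field_simps)
    have "2 * (\<mu> * Y) = 2 * quad V E x x"
      unfolding quad_eigen[OF x(2)] Y_def by (simp add: power2_eq_square)
    also have "\<dots> = (\<Sum>u\<in>V. \<Sum>v\<in>V. adj_entry E u v * (2 * (x u * x v)))"
      unfolding quad_def sum_distrib_left by (intro sum.cong refl) simp
    also have "\<dots> \<le> (\<Sum>u\<in>V. \<Sum>v\<in>V. adj_entry E u v * ((\<alpha> - 1 / \<alpha>) * min ((x u)\<^sup>2) ((x v)\<^sup>2) + ((x u)\<^sup>2 + (x v)\<^sup>2) / \<alpha>))"
    proof (intro sum_mono mult_left_mono adj_entry_nonneg)
      fix u v
      have "2 * (x u * x v) \<le> 2 * \<bar>x u\<bar> * \<bar>x v\<bar>" using abs_ge_self[of "x u * x v"] by (simp add: abs_mult)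
      also have "\<dots> \<le> (\<alpha> - 1 / \<alpha>) * min ((x u)\<^sup>2) ((x v)\<^sup>2) + ((x u)\<^sup>2 + (x v)\<^sup>2) / \<alpha>"
        by (rule two_mult_le_min[OF a0])
      finally show "2 * (x u * x v) \<le> (\<alpha> - 1 / \<alpha>) * min ((x u)\<^sup>2) ((x v)\<^sup>2) + ((x u)\<^sup>2 + (x v)\<^sup>2) / \<alpha>" .
    qed
    also have "\<dots> = (\<alpha> - 1 / \<alpha>) * (\<Sum>u\<in>V. \<Sum>v\<in>V. adj_entry E u v * min ((x u)\<^sup>2) ((x v)\<^sup>2))
        + (\<Sum>u\<in>V. \<Sum>v\<in>V. adj_entry E u v * ((x u)\<^sup>2 + (x v)\<^sup>2)) / \<alpha>"
      unfolding sum_distrib_left sum_divide_distrib sum.distrib[symmetric]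
      by (intro sum.cong refl) (simp add: distrib_left mult.left_commute)
    also have "\<dots> \<le> (\<alpha> - 1 / \<alpha>) * ((2 * k) * Y) + (2 * \<Delta> * Y) / \<alpha>"
    proof (intro add_mono mult_left_mono divide_right_mono)
      show "(\<Sum>u\<in>V. \<Sum>v\<in>V. adj_entry E u v * min ((x u)\<^sup>2) ((x v)\<^sup>2)) \<le> (2 * k) * Y"
        unfolding Y_def by (rule sum_min_le[OF V(1) _ dens']) simp_all
      have *: "(\<Sum>u\<in>V. \<Sum>v\<in>V. adj_entry E u v * (x u)\<^sup>2) \<le> \<Delta> * Y"
      proof -
        have "(\<Sum>u\<in>V. \<Sum>v\<in>V. adj_entry E u v * (x u)\<^sup>2) = (\<Sum>u\<in>V. real (degree E u) * (x u)\<^sup>2)"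
          using adj_row_sum[OF G _ V(1)] degree_nbrs[OF G] by (intro sum.cong refl) (simp flip: sum_distrib_right)
        also have "\<dots> \<le> (\<Sum>u\<in>V. \<Delta> * (x u)\<^sup>2)" using deg by (intro sum_mono mult_right_mono) auto
        finally show ?thesis unfolding Y_def by (simp add: sum_distrib_left)
      qed
      have "(\<Sum>u\<in>V. \<Sum>v\<in>V. adj_entry E u v * (x v)\<^sup>2) = (\<Sum>v\<in>V. \<Sum>u\<in>V. adj_entry E v u * (x v)\<^sup>2)"
        by (rule trans[OF sum.swap]) (intro sum.cong refl arg_cong2[where f = "(*)"] adj_entry_sym)
      then have "(\<Sum>u\<in>V. \<Sum>v\<in>V. adj_entry E u v * (x v)\<^sup>2) \<le> \<Delta> * Y" using * by simp
      then show "(\<Sum>u\<in>V. \<Sum>v\<in>V. adj_entry E u v * ((x u)\<^sup>2 + (x v)\<^sup>2)) \<le> 2 * \<Delta> * Y"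
        using * unfolding distrib_left sum.distrib by simp
    qed (use ainv a0 in auto)
    also have "\<dots> = 2 * ((\<alpha> * k + (\<Delta> - k) / \<alpha>) * Y)" using a0 by (simp add: field_simps)
    finally have "\<mu> * Y \<le> (2 * (\<alpha> * k)) * Y" unfolding dka by (simp add: algebra_simps)
    then show ?thesis using Y unfolding ak by simp
  qed
qed

lemma regular_eigenvalue:
  assumes G: "simple_graph V E" and d: "\<And>v. v \<in> V \<Longrightarrow> degree E v = d"
  shows "max_eigenvalue V E = real d"
proof (rule antisym)
  note V = simple_graphD(1,2)[OF G]
  show "max_eigenvalue V E \<le> real d"
    by (rule eigenvalue_le_max_degree[OF G max_eigenvalue(1)[OF V]]) (simp add: d)
  have "adj_eigenvalue V E (real d)" unfolding adj_eigenvalue_def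
    using V adj_row_sum[OF G _ V(1)] degree_nbrs[OF G] d by (intro exI[of _ "\<lambda>_. 1"]) auto
  then show "real d \<le> max_eigenvalue V E" by (rule max_eigenvalue(2)[OF V])
qed

section \<open>Spectral gap of nonregular graphs\<close>

lemma distinct_path:
  assumes "(u, v) \<in> {(a, b). {a, b} \<in> E}\<^sup>*"
  shows "\<exists>vs. vs \<noteq> [] \<and> distinct vs \<and> hd vs = u \<and> last vs = v \<and> walk E vs"
  using assms
proof (induction rule: rtrancl_induct)
  case base
  show ?case by (intro exI[of _ "[u]"]) (simp add: walk_def)
next
  case (step y z)
  then obtain vs where vs: "vs \<noteq> []" "distinct vs" "hd vs = u" "last vs = y" "walk E vs" by blast
  have yz: "{y, z} \<in> E" using step by simp
  show ?case
  proof (cases "z \<in> set vs")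
    case True
    then obtain i where i: "i < length vs" "vs ! i = z" by (metis in_set_conv_nth)
    \<comment> \<open>The walk has returned to an earlier vertex and is cut back to that
      visit.\<close>
    let ?ws = "take (Suc i) vs"
    have "last ?ws = z" using i by (simp add: take_Suc_conv_app_nth)
    moreover have "walk E ?ws" using vs(5) unfolding walk_def by simp
    moreover have "hd ?ws = u" using vs(1,3) by (simp add: hd_take)
    ultimately show ?thesis using vs(1,2) by (intro exI[of _ ?ws]) simp
  next
    case False
    have "walk E (vs @ [z])" unfolding walk_def
    proof (intro allI impI)
      fix i assume i: "Suc i < length (vs @ [z])"
      show "{(vs @ [z]) ! i, (vs @ [z]) ! Suc i} \<in> E"
      proof (cases "Suc i < length vs")
        case True
        then show ?thesis using vs(5) unfolding walk_def by (simp add: nth_append)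
      next
        case F: False
        then have "i = length vs - 1" using i by simp
        then show ?thesis using yz vs(1,4) by (simp add: nth_append last_conv_nth)
      qed
    qed
    then show ?thesis using vs False by (intro exI[of _ "vs @ [z]"]) auto
  qed
qed

text \<open>The right-hand side runs over ordered pairs, so each edge of the path occurs in it in
  both orders. As the vertices of the path are distinct, all these ordered pairs are
  different.\<close>

lemma sum_diff_squares_path:
  fixes x :: "'a \<Rightarrow> real"
  assumes V: "finite V" and vs: "distinct vs" "set vs \<subseteq> V" "walk E vs"
  shows "2 * (\<Sum>i<length vs - 1. (x (vs ! i) - x (vs ! Suc i))\<^sup>2) \<le> (\<Sum>u\<in>V. \<Sum>v\<in>V. adj_entry E u v * (x u - x v)\<^sup>2)"
proof -
  let ?n = "length vs - 1"
  define f where "f i = (vs ! i, vs ! Suc i)" for i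
  define g where "g i = (vs ! Suc i, vs ! i)" for i
  define F where "F = (\<lambda>(u, v). adj_entry E u v * (x u - x v)\<^sup>2)"
  have nth: "vs ! i = vs ! j \<longleftrightarrow> i = j" if "i \<le> ?n" "j \<le> ?n" "vs \<noteq> []" for i j
    using vs(1) that by (simp add: nth_eq_iff_index_eq Suc_leI le_less_trans)
  have ne: "vs \<noteq> []" if "i < ?n" for i using that by auto
  have inj: "inj_on f {..<?n}" "inj_on g {..<?n}" unfolding f_def g_def inj_on_def using nth ne by auto
  have dis: "f ` {..<?n} \<inter> g ` {..<?n} = {}"
  proof (rule ccontr)
    assume "f ` {..<?n} \<inter> g ` {..<?n} \<noteq> {}"
    then obtain i j where ij: "i < ?n" "j < ?n" "f i = g j" by blast
    then have "vs ! i = vs ! Suc j" "vs ! Suc i = vs ! j" unfolding f_def g_def by auto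
    then have "i = Suc j" "Suc i = j" using nth[of i "Suc j"] nth[of "Suc i" j] ij ne by auto
    then show False by simp
  qed
  have val: "F (f i) = (x (vs ! i) - x (vs ! Suc i))\<^sup>2" "F (g i) = (x (vs ! i) - x (vs ! Suc i))\<^sup>2" if "i < ?n" for i
    using vs(3) that unfolding walk_def F_def f_def g_def adj_entry_def
    by (auto simp: insert_commute power2_commute)
  have "2 * (\<Sum>i<?n. (x (vs ! i) - x (vs ! Suc i))\<^sup>2) = (\<Sum>i<?n. F (f i)) + (\<Sum>i<?n. F (g i))"
    using val by simp
  also have "\<dots> = sum F (f ` {..<?n}) + sum F (g ` {..<?n})"
    using inj by (simp add: sum.reindex)
  also have "\<dots> = sum F (f ` {..<?n} \<union> g ` {..<?n})" using dis by (intro sum.union_disjoint[symmetric]) auto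
  also have "\<dots> \<le> sum F (V \<times> V)"
  proof (rule sum_mono2)
    show "finite (V \<times> V)" using V by simp
    have "vs ! i \<in> V" if "i \<le> ?n" "vs \<noteq> []" for i using vs(2) that by (metis Suc_pred' le_imp_less_Suc length_greater_0_conv nth_mem subsetD)
    then show "f ` {..<?n} \<union> g ` {..<?n} \<subseteq> V \<times> V" unfolding f_def g_def using ne by auto
    show "0 \<le> F b" for b unfolding F_def using adj_entry_nonneg[of E] by (cases b) simp
  qed
  also have "\<dots> = (\<Sum>u\<in>V. \<Sum>v\<in>V. adj_entry E u v * (x u - x v)\<^sup>2)"
    unfolding F_def by (simp add: sum.cartesian_product)
  finally show ?thesis .
qed

text \<open>With Y the sum of the squares, \<open>(real d - \<mu>) * Y\<close> is a sum of degree
  defects times squares plus the sum of squared differences over the edges. The first contains the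
  square at \<open>u0\<close>, the second the increments along a path to a maximal entry, whose
  square is at least Y / n. Cauchy-Schwarz loses another factor n.\<close>

theorem nonregular_gap:
  assumes G: "simple_graph V E" and con: "connected_graph V E" and ev: "adj_eigenvalue V E \<mu>"
    and deg: "\<And>v. v \<in> V \<Longrightarrow> degree E v \<le> d" and u0: "u0 \<in> V" "degree E u0 < d"
  shows "\<mu> \<le> real d - 1 / (real (card V))\<^sup>2"
proof -
  note V = simple_graphD(1,2)[OF G]
  let ?n = "real (card V)"
  have n0: "0 < ?n" using V by (simp add: card_gt_0_iff)
  obtain x where x: "\<exists>v\<in>V. x v \<noteq> 0" "\<forall>u\<in>V. (\<Sum>v\<in>V. adj_entry E u v * x v) = \<mu> * x u"
    using ev unfolding adj_eigenvalue_def by blast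
  define Y where "Y = (\<Sum>v\<in>V. (x v)\<^sup>2)"
  have Y: "0 < Y" unfolding Y_def by (rule sum_squares_pos[OF V(1) x(1)])
  define Q where "Q = (\<Sum>u\<in>V. \<Sum>v\<in>V. adj_entry E u v * (x u - x v)\<^sup>2)"
  have "Max ((\<lambda>v. (x v)\<^sup>2) ` V) \<in> (\<lambda>v. (x v)\<^sup>2) ` V" using V by (intro Max_in) auto
  then obtain w where w: "w \<in> V" "(x w)\<^sup>2 = Max ((\<lambda>v. (x v)\<^sup>2) ` V)" by force
  have mx: "(x v)\<^sup>2 \<le> (x w)\<^sup>2" if "v \<in> V" for v unfolding w(2) using V that by (intro Max_ge) auto
  have Yw: "Y \<le> ?n * (x w)\<^sup>2" unfolding Y_def using sum_mono[of V "\<lambda>v. (x v)\<^sup>2" "\<lambda>_. (x w)\<^sup>2"] mx by simp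
  have D1: "(\<Sum>u\<in>V. \<Sum>v\<in>V. adj_entry E u v * (x u)\<^sup>2) = (\<Sum>u\<in>V. real (degree E u) * (x u)\<^sup>2)"
    using adj_row_sum[OF G _ V(1)] degree_nbrs[OF G] by (intro sum.cong refl) (simp flip: sum_distrib_right)
  have D2: "(\<Sum>u\<in>V. \<Sum>v\<in>V. adj_entry E u v * (x v)\<^sup>2) = (\<Sum>u\<in>V. real (degree E u) * (x u)\<^sup>2)"
  proof -
    have "(\<Sum>u\<in>V. \<Sum>v\<in>V. adj_entry E u v * (x v)\<^sup>2) = (\<Sum>v\<in>V. \<Sum>u\<in>V. adj_entry E u v * (x v)\<^sup>2)"
      by (rule sum.swap)
    also have "\<dots> = (\<Sum>v\<in>V. \<Sum>u\<in>V. adj_entry E v u * (x v)\<^sup>2)"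
      by (intro sum.cong refl arg_cong2[where f = "(*)"] adj_entry_sym)
    finally show ?thesis unfolding D1 .
  qed
  have "Q = (\<Sum>u\<in>V. \<Sum>v\<in>V. adj_entry E u v * (x u)\<^sup>2 + adj_entry E u v * (x v)\<^sup>2 - 2 * (adj_entry E u v * x u * x v))"
    unfolding Q_def by (intro sum.cong refl) (simp add: power2_eq_square algebra_simps)
  also have "\<dots> = 2 * (\<Sum>u\<in>V. real (degree E u) * (x u)\<^sup>2) - 2 * quad V E x x"
    unfolding sum_subtractf sum.distrib D1 D2 sum_distrib_left[symmetric] quad_def by simp
  also have "quad V E x x = \<mu> * Y" unfolding quad_eigen[OF x(2)] Y_def by (simp add: power2_eq_square)
  finally have Q: "Q = 2 * (\<Sum>u\<in>V. real (degree E u) * (x u)\<^sup>2) - 2 * (\<mu> * Y)" by simp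
  have gap: "(real d - \<mu>) * Y = (\<Sum>u\<in>V. (real d - real (degree E u)) * (x u)\<^sup>2) + Q / 2"
  proof -
    have "(\<Sum>u\<in>V. (real d - real (degree E u)) * (x u)\<^sup>2) = real d * Y - (\<Sum>u\<in>V. real (degree E u) * (x u)\<^sup>2)"
      unfolding Y_def by (simp add: left_diff_distrib sum_subtractf sum_distrib_left)
    moreover have "(real d - \<mu>) * Y = real d * Y - \<mu> * Y" by (rule left_diff_distrib)
    ultimately show ?thesis using Q by linarith
  qed
  have "(x u0)\<^sup>2 \<le> (real d - real (degree E u0)) * (x u0)\<^sup>2"
    using u0(2) mult_right_mono[of 1 "real d - real (degree E u0)" "(x u0)\<^sup>2"] by simp
  also have "\<dots> \<le> (\<Sum>u\<in>V. (real d - real (degree E u)) * (x u)\<^sup>2)"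
    using member_le_sum[of u0 V "\<lambda>u. (real d - real (degree E u)) * (x u)\<^sup>2"] u0(1) V deg by simp
  finally have low: "(x u0)\<^sup>2 + Q / 2 \<le> (real d - \<mu>) * Y" unfolding gap by simp
  have "(u0, w) \<in> {(a, b). {a, b} \<in> E}\<^sup>*" using con u0(1) w(1) unfolding connected_graph_def by blast
  from distinct_path[OF this] obtain vs where vs: "vs \<noteq> []" "distinct vs" "hd vs = u0" "last vs = w" "walk E vs" by blast
  have vsV: "set vs \<subseteq> V"
  proof
    fix a assume "a \<in> set vs"
    then obtain i where i: "i < length vs" "a = vs ! i" by (metis in_set_conv_nth)
    show "a \<in> V"
    proof (cases i)
      case 0
      then show ?thesis using i vs(1,3) u0(1) by (simp add: hd_conv_nth)
    next
      case (Suc j)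
      then have "{vs ! j, a} \<in> E" using vs(5) i unfolding walk_def by blast
      then show ?thesis using simple_graphD(3)[OF G] by blast
    qed
  qed
  define m where "m = length vs - 1"
  have len: "length vs = Suc m" using vs(1) unfolding m_def by simp
  have mn: "real (Suc m) \<le> ?n" using card_mono[OF V(1) vsV] distinct_card[OF vs(2)] len by simp
  \<comment> \<open>The value at \<open>u0\<close> is put in front of the increments, so that the
    sum telescopes to the value at \<open>w\<close>. There are as many terms as vertices on the
    path, hence at most n.\<close>
  define b where "b i = (case i of 0 \<Rightarrow> x u0 | Suc j \<Rightarrow> x (vs ! Suc j) - x (vs ! j))" for i
  have tel: "(\<Sum>i\<le>j. b i) = x (vs ! j)" for j
    by (induction j) (use vs(1,3) in \<open>auto simp: b_def hd_conv_nth\<close>)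
  have "vs ! m = w" using vs(1,4) len by (simp add: last_conv_nth)
  then have "(x w)\<^sup>2 = (\<Sum>i\<le>m. b i)\<^sup>2" using tel by simp
  also have "\<dots> \<le> (\<Sum>i\<le>m. (b i)\<^sup>2) * real (card {..m})"
    using sum_squared_le_sum_of_squares[of b "{..m}"] by (simp add: mult.commute)
  also have "(\<Sum>i\<le>m. (b i)\<^sup>2) = (x u0)\<^sup>2 + (\<Sum>i<m. (x (vs ! Suc i) - x (vs ! i))\<^sup>2)"
    unfolding sum.atMost_shift by (simp add: b_def)
  also have "(\<Sum>i<m. (x (vs ! Suc i) - x (vs ! i))\<^sup>2) = (\<Sum>i<m. (x (vs ! i) - x (vs ! Suc i))\<^sup>2)"
    by (intro sum.cong refl) (simp add: power2_commute)
  also have "((x u0)\<^sup>2 + (\<Sum>i<m. (x (vs ! i) - x (vs ! Suc i))\<^sup>2)) * real (card {..m}) \<le> ((real d - \<mu>) * Y) * ?n"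
  proof (rule mult_mono)
    show "(x u0)\<^sup>2 + (\<Sum>i<m. (x (vs ! i) - x (vs ! Suc i))\<^sup>2) \<le> (real d - \<mu>) * Y"
      using sum_diff_squares_path[OF V(1) vs(2) vsV vs(5), of x] low unfolding Q_def m_def by simp
    have "0 \<le> Q" unfolding Q_def using adj_entry_nonneg[of E] by (intro sum_nonneg) simp
    then show "0 \<le> (real d - \<mu>) * Y" using low by (meson add_nonneg_nonneg order_trans zero_le_power2 divide_nonneg_nonneg zero_le_numeral)
  qed (use mn in auto)
  finally have "Y \<le> ?n * (((real d - \<mu>) * Y) * ?n)" using Yw n0 by (meson mult_left_mono less_imp_le order_trans)
  then have "1 * Y \<le> ((real d - \<mu>) * ?n\<^sup>2) * Y" by (simp add: power2_eq_square algebra_simps)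
  then have "1 \<le> (real d - \<mu>) * ?n\<^sup>2" using Y by (simp only: mult_le_cancel_right_pos)
  then have "1 / ?n\<^sup>2 \<le> real d - \<mu>" using n0 by (simp add: field_simps)
  then show ?thesis by simp
qed

section \<open>Planar regular graphs\<close>

text \<open>Twice the signed area of the triangle, 0 exactly for collinear points. Integer
  coordinates allow all conditions on a drawing to be checked by evaluation.\<close>

definition turn :: "int \<times> int \<Rightarrow> int \<times> int \<Rightarrow> int \<times> int \<Rightarrow> int" where
  "turn a b c = (fst b - fst a) * (snd c - snd a) - (snd b - snd a) * (fst c - fst a)"

text \<open>One of the two segments lies strictly on one side of the line through the other.\<close>

definition separated :: "(int \<times> int) \<Rightarrow> (int \<times> int) \<Rightarrow> (int \<times> int) \<Rightarrow> (int \<times> int) \<Rightarrow> bool" where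
  "separated a b c d \<longleftrightarrow> turn a b c * turn a b d > 0 \<or> turn c d a * turn c d b > 0"

text \<open>A straight-line drawing with integer coordinates in general position: vertex \<open>i\<close> is
  drawn at \<open>ps ! i\<close>, and the edges are the pairs in \<open>es\<close>.\<close>
definition drawing :: "(int \<times> int) list \<Rightarrow> (nat \<times> nat) list \<Rightarrow> nat \<Rightarrow> bool" where
  "drawing ps es d \<longleftrightarrow> ps \<noteq> [] \<and> distinct ps \<and> distinct es \<and>
     list_all (\<lambda>(i, j). i < j \<and> j < length ps) es \<and>
     list_all (\<lambda>a. list_all (\<lambda>b. a = b \<or> list_all (\<lambda>c. c = a \<or> c = b \<or> turn a b c \<noteq> 0) ps) ps) ps \<and>
     list_all (\<lambda>(i, j). list_all (\<lambda>(k, l). i = k \<or> i = l \<or> j = k \<or> j = l \<or>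
        separated (ps ! i) (ps ! j) (ps ! k) (ps ! l)) es) es \<and>
     list_all (\<lambda>v. length (filter (\<lambda>(i, j). i = v \<or> j = v) es) = d) [0..<length ps]"

definition cpoint :: "int \<times> int \<Rightarrow> complex" where
  "cpoint a = Complex (real_of_int (fst a)) (real_of_int (snd a))"

definition rturn :: "complex \<Rightarrow> complex \<Rightarrow> complex \<Rightarrow> real" where
  "rturn a b z = (Re b - Re a) * (Im z - Im a) - (Im b - Im a) * (Re z - Re a)"

lemma rturn_cpoint: "rturn (cpoint a) (cpoint b) (cpoint c) = real_of_int (turn a b c)"
  unfolding rturn_def turn_def cpoint_def by simp

lemma rturn_linepath: "rturn a b (linepath c d t) = (1 - t) * rturn a b c + t * rturn a b d"
  unfolding rturn_def linepath_def by (simp add: algebra_simps)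

lemma rturn_ends: "rturn a b a = 0" "rturn a b b = 0"
  unfolding rturn_def by (simp_all add: algebra_simps)

lemma same_side_nonzero:
  fixes p q t :: real
  assumes "p * q > 0" "0 \<le> t" "t \<le> 1" shows "(1 - t) * p + t * q \<noteq> 0"
proof -
  consider "p > 0" "q > 0" | "p < 0" "q < 0" using assms(1) by (auto simp: zero_less_mult_iff)
  then show ?thesis
  proof cases
    case 1
    have "(1 - t) * p \<ge> 0" "t * q \<ge> 0" using 1 assms by simp_all
    moreover have "(1 - t) * p > 0 \<or> t * q > 0" using 1 assms(2,3) by (cases "t = 0") auto
    ultimately show ?thesis by linarith
  next
    case 2
    have "(1 - t) * p \<le> 0" "t * q \<le> 0" using 2 assms by (simp_all add: mult_nonneg_nonpos)
    moreover have "(1 - t) * p < 0 \<or> t * q < 0" using 2 assms(2,3) by (cases "t = 0") (auto simp: mult_pos_neg)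
    ultimately show ?thesis by linarith
  qed
qed

lemma segment_avoids:
  assumes t: "0 < t" "t < 1" and ne: "cpoint a \<noteq> cpoint b"
    and gp: "turn a b c \<noteq> 0 \<or> c = a \<or> c = b"
  shows "linepath (cpoint a) (cpoint b) t \<noteq> cpoint c"
proof
  assume eq: "linepath (cpoint a) (cpoint b) t = cpoint c"
  have "rturn (cpoint a) (cpoint b) (cpoint c) = 0"
    unfolding eq[symmetric] rturn_linepath rturn_ends by simp
  then have "c = a \<or> c = b" using gp unfolding rturn_cpoint by simp
  moreover have "linepath (cpoint a) (cpoint b) t \<noteq> linepath (cpoint a) (cpoint b) 0"
    "linepath (cpoint a) (cpoint b) t \<noteq> linepath (cpoint a) (cpoint b) 1"
    using inj_onD[OF inj_on_linepath[OF ne], of t 0] inj_onD[OF inj_on_linepath[OF ne], of t 1] t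
    by (metis atLeastAtMost_iff less_eq_real_def less_irrefl order_refl zero_le_one)+
  ultimately show False using eq by (auto simp: linepath_def)
qed

text \<open>A common point lies on both lines, and \<open>turn\<close> is affine along a segment, so
  it cannot have the same sign at both ends. If the segments share an end, a further common point
  would put the other end on the same line, against general position.\<close>

lemma segments_disjoint:
  assumes t: "0 < t" "t < 1" "0 < s" "s < 1"
    and gp: "\<And>x. x \<in> {c, d} \<Longrightarrow> x \<notin> {a, b} \<Longrightarrow> turn a b x \<noteq> 0" and ne: "c \<noteq> d" "{a, b} \<noteq> {c, d}"
    and sep: "{a, b} \<inter> {c, d} = {} \<Longrightarrow> separated a b c d"
  shows "linepath (cpoint a) (cpoint b) t \<noteq> linepath (cpoint c) (cpoint d) s"
proof
  let ?z = "linepath (cpoint a) (cpoint b) t"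
  assume eq: "?z = linepath (cpoint c) (cpoint d) s"
  have "rturn (cpoint a) (cpoint b) ?z = 0" unfolding rturn_linepath rturn_ends by simp
  moreover have "rturn (cpoint c) (cpoint d) ?z = 0" unfolding eq rturn_linepath rturn_ends by simp
  ultimately have 1: "rturn (cpoint a) (cpoint b) ?z = 0" "rturn (cpoint c) (cpoint d) ?z = 0" .
  have 2: "(1 - s) * turn a b c + s * turn a b d = 0"
    using 1(1) unfolding eq rturn_linepath rturn_cpoint by simp
  have 3: "(1 - t) * turn c d a + t * turn c d b = 0"
    using 1(2) unfolding rturn_linepath rturn_cpoint by simp
  consider "{a, b} \<inter> {c, d} = {}" | "c \<in> {a, b}" | "d \<in> {a, b}" by auto
  then show False
  proof cases
    case 1
    from sep[OF this] show False unfolding separated_def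
    proof
      assume "turn a b c * turn a b d > 0"
      then have "real_of_int (turn a b c) * real_of_int (turn a b d) > 0" by (metis of_int_0_less_iff of_int_mult)
      then show False using same_side_nonzero[of _ _ s] t 2 by force
    next
      assume "turn c d a * turn c d b > 0"
      then have "real_of_int (turn c d a) * real_of_int (turn c d b) > 0" by (metis of_int_0_less_iff of_int_mult)
      then show False using same_side_nonzero[of _ _ t] t 3 by force
    qed
  next
    case 2
    then have "d \<notin> {a, b}" using ne by auto
    then have "turn a b d \<noteq> 0" using gp by blast
    moreover have "turn a b c = 0" using 2 by (auto simp: turn_def algebra_simps)
    ultimately show False using \<open>(1 - s) * turn a b c + s * turn a b d = 0\<close> t by simp
  next
    case 3
    then have "c \<notin> {a, b}" using ne by auto
    then have "turn a b c \<noteq> 0" using gp by blast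
    moreover have "turn a b d = 0" using 3 by (auto simp: turn_def algebra_simps)
    ultimately show False using \<open>(1 - s) * turn a b c + s * turn a b d = 0\<close> t by simp
  qed
qed

lemma planar_regular_example:
  assumes D: "drawing ps es d"
  shows "\<exists>(W :: nat set) F. simple_graph W F \<and> planar W F \<and> max_degree W F = d \<and> max_eigenvalue W F = real d"
proof -
  let ?n = "length ps"
  define W where "W = {..<?n}"
  define h where "h = (\<lambda>(i::nat, j). {i, j})"
  define F where "F = h ` set es"
  have ps: "ps \<noteq> []" "distinct ps" "distinct es" using D unfolding drawing_def by auto
  have es: "i < j" "j < ?n" if "(i, j) \<in> set es" for i j
    using D that unfolding drawing_def list_all_iff by auto
  have gp: "turn (ps ! i) (ps ! j) (ps ! k) \<noteq> 0" if "i < ?n" "j < ?n" "k < ?n" "i \<noteq> j" "k \<noteq> i" "k \<noteq> j" for i j k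
  proof -
    have "\<forall>a\<in>set ps. \<forall>b\<in>set ps. a = b \<or> (\<forall>c\<in>set ps. c = a \<or> c = b \<or> turn a b c \<noteq> 0)"
      using D unfolding drawing_def list_all_iff by (elim conjE)
    moreover have "ps ! i \<in> set ps" "ps ! j \<in> set ps" "ps ! k \<in> set ps" using that by auto
    moreover have "ps ! i \<noteq> ps ! j" "ps ! k \<noteq> ps ! i" "ps ! k \<noteq> ps ! j"
      using that nth_eq_iff_index_eq[OF ps(2)] by auto
    ultimately show ?thesis by blast
  qed
  have sep: "separated (ps ! i) (ps ! j) (ps ! k) (ps ! l)" if "(i, j) \<in> set es" "(k, l) \<in> set es" "{i, j} \<inter> {k, l} = {}" for i j k l
  proof -
    have "list_all (\<lambda>(i, j). list_all (\<lambda>(k, l). i = k \<or> i = l \<or> j = k \<or> j = l \<or>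
       separated (ps ! i) (ps ! j) (ps ! k) (ps ! l)) es) es"
      using D unfolding drawing_def by (elim conjE)
    from this[unfolded list_all_iff, THEN bspec, OF that(1), simplified, THEN bspec, OF that(2)]
    show ?thesis using that(3) by simp
  qed
  have hinj: "inj_on h (set es)"
  proof (rule inj_onI)
    fix x y assume "x \<in> set es" "y \<in> set es" "h x = h y"
    moreover obtain i j k l where "x = (i, j)" "y = (k, l)" by (cases x; cases y)
    ultimately show "x = y" using es[of i j] es[of k l] unfolding h_def by (auto simp: doubleton_eq_iff)
  qed
  have G: "simple_graph W F"
  proof -
    have "e \<subseteq> W \<and> card e = 2" if "e \<in> F" for e
    proof -
      obtain i j where ij: "(i, j) \<in> set es" "e = {i, j}" using \<open>e \<in> F\<close> unfolding F_def h_def by auto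
      show ?thesis using es[OF ij(1)] unfolding ij(2) W_def by (simp add: card_2_iff')
    qed
    then show ?thesis unfolding simple_graph_def using ps(1) by (simp add: W_def lessThan_empty_iff)
  qed
  have deg: "degree F v = d" if v: "v \<in> W" for v
  proof -
    have "{e \<in> F. v \<in> e} = h ` set (filter (\<lambda>(i, j). i = v \<or> j = v) es)"
      unfolding F_def h_def by auto
    moreover have "inj_on h (set (filter (\<lambda>(i, j). i = v \<or> j = v) es))"
      using hinj by (rule inj_on_subset) auto
    ultimately have "degree F v = card (set (filter (\<lambda>(i, j). i = v \<or> j = v) es))"
      unfolding degree_def by (simp add: card_image)
    also have "\<dots> = length (filter (\<lambda>(i, j). i = v \<or> j = v) es)" using ps(3) by (intro distinct_card) simp
    also have "\<dots> = d" using D v unfolding drawing_def list_all_iff W_def by auto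
    finally show ?thesis .
  qed
  have "degree F ` W = {d}" using deg simple_graphD(2)[OF G] by auto
  then have "max_degree W F = d" unfolding max_degree_def by simp
  moreover have "max_eigenvalue W F = real d" by (rule regular_eigenvalue[OF G deg])
  moreover have "planar W F"
  proof -
    define p where "p i = cpoint (ps ! i)" for i
    \<comment> \<open>An edge is an unordered pair of indices, so its minimum and maximum serve to
      orient it.\<close>
    define \<gamma> where "\<gamma> e = linepath (p (Min e)) (p (Max e))" for e :: "nat set"
    have cinj: "cpoint a = cpoint b \<longleftrightarrow> a = b" for a b
      unfolding cpoint_def by (auto simp: prod_eq_iff)
    have pinj: "p i = p j \<longleftrightarrow> i = j" if "i < ?n" "j < ?n" for i j
      unfolding p_def cinj using nth_eq_iff_index_eq[OF ps(2)] that by simp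
    have edge: "\<exists>i j. (i, j) \<in> set es \<and> e = {i, j} \<and> i < j \<and> i < ?n \<and> j < ?n \<and> \<gamma> e = linepath (p i) (p j)" if "e \<in> F" for e
    proof -
      obtain i j where ij: "(i, j) \<in> set es" "e = {i, j}" using \<open>e \<in> F\<close> unfolding F_def h_def by auto
      have "i < j" "j < ?n" using es[OF ij(1)] by auto
      then show ?thesis using ij unfolding \<gamma>_def by (intro exI[of _ i] exI[of _ j]) (auto simp: min_def max_def)
    qed
    show ?thesis unfolding planar_def embeds_in_def
    proof (rule exI[of _ p], rule exI[of _ \<gamma>], intro conjI ballI impI)
      show "inj_on p W" unfolding inj_on_def W_def using pinj by auto
      show "p ` W \<subseteq> topspace euclidean" by simp
      fix e assume e: "e \<in> F"
      obtain i j where ij: "(i, j) \<in> set es" "e = {i, j}" "i < j" "i < ?n" "j < ?n" "\<gamma> e = linepath (p i) (p j)"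
        using edge[OF e] by blast
      have pne: "p i \<noteq> p j" using pinj ij by simp
      show "pathin euclidean (\<gamma> e)" unfolding ij(6) pathin_def by (simp add: continuous_on_linepath)
      show "inj_on (\<gamma> e) {0..1}" unfolding ij(6) by (rule inj_on_linepath[OF pne])
      show "{\<gamma> e 0, \<gamma> e 1} = p ` e"
      proof -
        have "p ` e = {p i, p j}" unfolding ij(2) by simp
        then show ?thesis unfolding ij(6) by (simp add: linepath_def)
      qed
      show "\<gamma> e ` {0<..<1} \<inter> p ` W = {}"
      proof (rule ccontr)
        assume "\<gamma> e ` {0<..<1} \<inter> p ` W \<noteq> {}"
        then obtain t v where tv: "0 < t" "t < 1" "v < ?n" "\<gamma> e t = p v" unfolding W_def by auto
        have "turn (ps ! i) (ps ! j) (ps ! v) \<noteq> 0 \<or> ps ! v = ps ! i \<or> ps ! v = ps ! j"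
          using gp[of i j v] ij tv(3) by auto
        from segment_avoids[OF tv(1,2) _ this] show False using pne tv(4) unfolding ij(6) p_def by blast
      qed
      fix e' assume e': "e' \<in> F" "e' \<noteq> e"
      obtain k l where kl: "(k, l) \<in> set es" "e' = {k, l}" "k < l" "k < ?n" "l < ?n" "\<gamma> e' = linepath (p k) (p l)"
        using edge[OF e'(1)] by blast
      have idx: "ps ! x = ps ! y \<longleftrightarrow> x = y" if "x < ?n" "y < ?n" for x y
        using nth_eq_iff_index_eq[OF ps(2)] that by simp
      show "\<gamma> e ` {0<..<1} \<inter> \<gamma> e' ` {0<..<1} = {}"
      proof (rule ccontr)
        assume "\<gamma> e ` {0<..<1} \<inter> \<gamma> e' ` {0<..<1} \<noteq> {}"
        then obtain t s where ts: "0 < t" "t < 1" "0 < s" "s < 1" "\<gamma> e t = \<gamma> e' s" by auto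
        have "linepath (cpoint (ps ! i)) (cpoint (ps ! j)) t \<noteq> linepath (cpoint (ps ! k)) (cpoint (ps ! l)) s"
        proof (rule segments_disjoint[OF ts(1-4)])
          show "ps ! k \<noteq> ps ! l" using idx kl by simp
          show "{ps ! i, ps ! j} \<noteq> {ps ! k, ps ! l}"
            using e'(2) ij(2-5) kl(2-5) idx by (auto simp: doubleton_eq_iff)
          show "turn (ps ! i) (ps ! j) x \<noteq> 0" if "x \<in> {ps ! k, ps ! l}" "x \<notin> {ps ! i, ps ! j}" for x
            using that gp[of i j k] gp[of i j l] ij(3-5) kl(3-5) by auto
          assume "{ps ! i, ps ! j} \<inter> {ps ! k, ps ! l} = {}"
          then have "{i, j} \<inter> {k, l} = {}" by auto
          then show "separated (ps ! i) (ps ! j) (ps ! k) (ps ! l)" by (rule sep[OF ij(1) kl(1)])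
        qed
        then show False using ts(5) unfolding ij(6) kl(6) p_def by simp
      qed
    qed
  qed
  ultimately show ?thesis using G by blast
qed

text \<open>Planar graphs that are regular of degree 0 to 5: complete graphs on one to four
  vertices, the octahedron and the icosahedron. Regularity makes the largest eigenvalue equal to the
  degree. The coordinates are chosen with no three points on a line.\<close>

lemma drawing_K1: "drawing [(0, 0)] [] 0" by code_simp
lemma drawing_K2: "drawing [(0, 0), (1, 0)] [(0, 1)] 1" by code_simp
lemma drawing_K3: "drawing [(0, 0), (1, 0), (0, 1)] [(0, 1), (0, 2), (1, 2)] 2" by code_simp
lemma drawing_K4:
  "drawing [(0, 3), (-3, -2), (3, -2), (0, 0)] [(0, 1), (0, 2), (0, 3), (1, 2), (1, 3), (2, 3)] 3"
  by code_simp
lemma drawing_octahedron: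
  "drawing [(-4, 4), (-2, 3), (0, -3), (0, -1), (3, 4), (2, 3)] [(0, 1), (0, 2), (0, 4), (0, 5), (1, 2), (1, 3), (1, 5), (2, 3), (2, 4), (3, 4), (3, 5), (4, 5)] 4"
  by code_simp
lemma drawing_icosahedron:
  "drawing [(1, 9), (-9, -6), (8, -4), (3, 1), (-1, 2), (-3, 2), (-1, -3), (2, -2), (1, 0), (0, 0), (-2, -2), (0, -1)]
     [(0, 1), (0, 2), (0, 3), (0, 4), (0, 5), (1, 2), (1, 5), (1, 6), (1, 10), (2, 3), (2, 6), (2, 7),
      (3, 4), (3, 7), (3, 8), (4, 5), (4, 8), (4, 9), (5, 9), (5, 10), (6, 7), (6, 10), (6, 11), (7, 8),
      (7, 11), (8, 9), (8, 11), (9, 10), (9, 11), (10, 11)] 5"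
  by code_simp

lemma planar_examples:
  assumes "d \<le> 5"
  shows "\<exists>(W :: nat set) F. simple_graph W F \<and> planar W F \<and> max_degree W F = d \<and> max_eigenvalue W F = real d"
proof -
  have "d = 0 \<or> d = 1 \<or> d = 2 \<or> d = 3 \<or> d = 4 \<or> d = 5" using assms by linarith
  then show ?thesis
    using planar_regular_example[OF drawing_K1] planar_regular_example[OF drawing_K2]
      planar_regular_example[OF drawing_K3] planar_regular_example[OF drawing_K4]
      planar_regular_example[OF drawing_octahedron] planar_regular_example[OF drawing_icosahedron]
    by (elim disjE) (simp_all only:)
qed

section \<open>The bounds\<close>

text \<open>Induced subgraphs inherit the embedding. The edge bound is needed for all of them, since
  the spectral estimate is about the density of every vertex set.\<close>

lemma embeds_in_edges_le:
  fixes S :: "'b topology"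
  assumes S: "surface S" and iso: "homology_group 1 S \<cong> free_Abelian_group {..<b::nat}"
    and G: "simple_graph V E" and emb: "embeds_in V E S" and H: "H \<subseteq> V" "card H \<ge> 3"
  shows "card (edges_in E H) + 6 \<le> 3 * card H + 3 * b"
proof -
  obtain p \<gamma> where p: "inj_on p V" "p ` V \<subseteq> topspace S" and
    \<gamma>: "\<forall>e\<in>E. pathin S (\<gamma> e) \<and> inj_on (\<gamma> e) {0..1} \<and> {\<gamma> e 0, \<gamma> e 1} = p ` e \<and>
           \<gamma> e ` {0<..<1} \<inter> p ` V = {} \<and>
           (\<forall>e'\<in>E. e' \<noteq> e \<longrightarrow> \<gamma> e ` {0<..<1} \<inter> \<gamma> e' ` {0<..<1} = {})"
    using emb unfolding embeds_in_def by (elim exE conjE) (rule that)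
  have sub: "e \<in> E" "e \<subseteq> H" if "e \<in> edges_in E H" for e using that unfolding edges_in_def by auto
  have "H \<noteq> {}" "finite H" using H(2) card_ge_0_finite[of H] by auto
  then have GH: "simple_graph H (edges_in E H)"
    using sub simple_graphD(4)[OF G] unfolding simple_graph_def by simp
  interpret surface S by (rule S)
  have "surface_graph S H (edges_in E H) p \<gamma>"
  proof unfold_locales
    show "simple_graph H (edges_in E H)" by (rule GH)
    show "inj_on p H" by (rule inj_on_subset[OF p(1) H(1)])
    show "p ` H \<subseteq> topspace S" using p(2) H(1) by (meson image_mono subset_trans)
    fix e assume e: "e \<in> edges_in E H"
    note \<gamma>e = \<gamma>[rule_format, OF sub(1)[OF e]]
    show "pathin S (\<gamma> e)" "inj_on (\<gamma> e) {0..1}" "{\<gamma> e 0, \<gamma> e 1} = p ` e" using \<gamma>e by auto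
    have "\<gamma> e ` {0<..<1} \<inter> p ` V = {}" using \<gamma>e by (elim conjE)
    then show "\<gamma> e ` {0<..<1} \<inter> p ` H = {}" using image_mono[OF H(1), of p] by blast
    fix e' assume e': "e' \<in> edges_in E H" "e' \<noteq> e"
    show "\<gamma> e ` {0<..<1} \<inter> \<gamma> e' ` {0<..<1} = {}" using \<gamma>e sub(1)[OF e'(1)] e'(2) by simp
  qed
  then show ?thesis by (rule surface_graph.edge_bound[OF _ iso H(2)])
qed

section \<open>The plane as a surface with trivial first homology\<close>

lemma surface_plane: "surface (euclidean :: complex topology)"
proof
  show "connected_space (euclidean :: complex topology)" by (metis connectedin_iff_connected connectedin_topspace connected_UNIV topspace_euclidean)
  show "Hausdorff_space (euclidean :: complex topology)" by (rule Hausdorff_space_euclidean)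
  show "\<exists>U. openin euclidean U \<and> x \<in> U \<and> subtopology euclidean U homeomorphic_space (euclidean :: complex topology)"
    for x :: complex
    by (rule exI[of _ UNIV]) (simp add: homeomorphic_space_refl)
qed

lemma trivial_groups_iso:
  assumes "trivial_group G" "trivial_group H" shows "G \<cong> H"
proof -
  have G: "Group.group G" "carrier G = {\<one>\<^bsub>G\<^esub>}" and H: "Group.group H" "carrier H = {\<one>\<^bsub>H\<^esub>}"
    using assms unfolding trivial_group_def by auto
  have "(\<lambda>_. \<one>\<^bsub>H\<^esub>) \<in> iso G H" unfolding iso_def hom_def
    using group.is_monoid[OF H(1)] unfolding G(2) H(2) by (auto simp: bij_betw_def monoid.l_one)
  then show ?thesis unfolding is_iso_def by blast
qed

lemma homology_plane: "homology_group 1 (euclidean :: complex topology) \<cong> free_Abelian_group {..<0::nat}"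
proof (rule trivial_groups_iso)
  show "trivial_group (free_Abelian_group {..<0::nat})"
  proof -
    have "carrier (free_Abelian_group {..<0::nat}) = {\<one>\<^bsub>free_Abelian_group {..<0::nat}\<^esub>}"
      by (simp add: free_Abelian_group_def)
    then show ?thesis unfolding trivial_group_def by simp
  qed
  have "contractible_space (euclidean :: complex topology)"
    by (metis contractible_UNIV contractible_space_top_of_set subtopology_UNIV)
  then have "trivial_group (reduced_homology_group 1 (euclidean :: complex topology))"
    by (rule trivial_reduced_homology_group_contractible_space)
  then show "trivial_group (homology_group 1 (euclidean :: complex topology))"
    by (simp add: un_reduced_homology_group)
qed

lemma planar_edges_le:
  "simple_graph V E \<Longrightarrow> planar V E \<Longrightarrow> H \<subseteq> V \<Longrightarrow> card H \<ge> 3 \<Longrightarrow> card (edges_in E H) + 6 \<le> 3 * card H"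
  using embeds_in_edges_le[OF surface_plane homology_plane] unfolding planar_def by simp

lemma genus_edges_le:
  assumes "surface_of_genus g S" "simple_graph V E" "embeds_in V E S" "H \<subseteq> V" "card H \<ge> 3"
  shows "card (edges_in E H) + 6 \<le> 3 * card H + 6 * g"
proof -
  have "surface S" using assms(1)
    unfolding surface_of_genus_def orientable_surface_def closed_surface_def surface_def by blast
  moreover have "homology_group 1 S \<cong> free_Abelian_group {..<2 * g}"
    using assms(1) unfolding surface_of_genus_def by blast
  ultimately show ?thesis using embeds_in_edges_le[OF _ _ assms(2-5)] by force
qed

text \<open>Under the first root stands P - Q - \<epsilon> squared, and sqrt(P) (2 - Q / P) is the
  tangent bound for 2 sqrt(P - Q). Strictness comes from the square of \<epsilon>.\<close>

lemma sqrt_less_shifted: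
  fixes t \<epsilon> \<Delta> :: real
  assumes "0 < \<epsilon>" "\<epsilon> \<le> t" "2 * t \<le> \<Delta>"
  shows "2 * sqrt ((t - \<epsilon>) * (\<Delta> - t + \<epsilon>)) < sqrt (t * (\<Delta> - t)) * (2 - \<epsilon> * (\<Delta> - 2 * t) / (t * (\<Delta> - t)))"
proof -
  define P where "P = t * (\<Delta> - t)"
  define Q where "Q = \<epsilon> * (\<Delta> - 2 * t)"
  have t: "0 < t" "0 < \<Delta> - t" using assms by linarith+
  have P: "0 < P" unfolding P_def using t by simp
  have "Q \<le> t * (\<Delta> - 2 * t)" unfolding Q_def using assms by (intro mult_right_mono) auto
  also have "\<dots> < 2 * P" unfolding P_def using t by (simp add: algebra_simps)
  finally have "Q < 2 * P" .
  then have R: "0 < 2 - Q / P" using P by (simp add: field_simps)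
  have "4 * ((t - \<epsilon>) * (\<Delta> - t + \<epsilon>)) = 4 * P - 4 * Q - 4 * \<epsilon>\<^sup>2"
    unfolding P_def Q_def by (simp add: algebra_simps power2_eq_square)
  also have "\<dots> < 4 * P - 4 * Q + Q\<^sup>2 / P"
  proof -
    have "0 < \<epsilon>\<^sup>2" "0 \<le> Q\<^sup>2 / P" using assms(1) P by simp_all
    then show ?thesis by linarith
  qed
  also have "\<dots> = P * (2 - Q / P)\<^sup>2" using P by (simp add: field_simps power2_eq_square)
  finally have "sqrt (4 * ((t - \<epsilon>) * (\<Delta> - t + \<epsilon>))) < sqrt (P * (2 - Q / P)\<^sup>2)" by (rule real_sqrt_less_mono)
  then show ?thesis using R unfolding real_sqrt_mult P_def[symmetric] Q_def[symmetric] by simp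
qed

text \<open>For \<Delta> = 2 t the term of first order in \<epsilon> vanishes, so the gain is of
  second order.\<close>

lemma sqrt_less_balanced:
  fixes t \<epsilon> :: real
  assumes "0 < \<epsilon>" "\<epsilon> \<le> t"
  shows "2 * sqrt ((t - \<epsilon>) * (2 * t - t + \<epsilon>)) < 2 * t - \<epsilon>\<^sup>2 / t"
proof -
  have t: "0 < t" using assms by linarith
  have "\<epsilon>\<^sup>2 \<le> t\<^sup>2" using assms by simp
  also have "\<dots> < 2 * t * t" using t by (simp add: power2_eq_square)
  finally have R: "0 < 2 * t - \<epsilon>\<^sup>2 / t" using t by (simp add: field_simps)
  have "4 * ((t - \<epsilon>) * (2 * t - t + \<epsilon>)) = 4 * t\<^sup>2 - 4 * \<epsilon>\<^sup>2"
    by (simp add: algebra_simps power2_eq_square)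
  also have "\<dots> < 4 * t\<^sup>2 - 4 * \<epsilon>\<^sup>2 + (\<epsilon>\<^sup>2 / t)\<^sup>2" using assms t by simp
  also have "\<dots> = (2 * t - \<epsilon>\<^sup>2 / t)\<^sup>2" using t by (simp add: field_simps power2_eq_square)
  finally have "sqrt (4 * ((t - \<epsilon>) * (2 * t - t + \<epsilon>))) < sqrt ((2 * t - \<epsilon>\<^sup>2 / t)\<^sup>2)" by (rule real_sqrt_less_mono)
  then show ?thesis using R unfolding real_sqrt_mult by simp
qed

lemma connected_boundary_edge:
  assumes con: "connected_graph V E" and H: "H \<subseteq> V" "H \<noteq> {}" "H \<noteq> V"
  shows "\<exists>a\<in>H. \<exists>b. b \<notin> H \<and> {a, b} \<in> E"
proof (rule ccontr)
  assume neg: "\<not> ?thesis"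
  obtain a b where ab: "a \<in> H" "b \<in> V" "b \<notin> H" using H by blast
  have "(a, b) \<in> {(a, b). {a, b} \<in> E}\<^sup>*" using con ab H(1) unfolding connected_graph_def by blast
  then have "b \<in> H" using ab(1) by (induction rule: rtrancl_induct) (use neg in auto)
  then show False using ab(3) by blast
qed

lemma sum_nbrs:
  assumes G: "simple_graph V E" and W: "finite W"
  shows "(\<Sum>u\<in>W. card (nbrs E W u)) = 2 * card (edges_in E W)"
proof -
  have "real (\<Sum>u\<in>W. card (nbrs E W u)) = (\<Sum>u\<in>W. \<Sum>v\<in>W. adj_entry E u v)"
    using adj_row_sum[OF G _ W] by simp
  also have "\<dots> = real (2 * card (edges_in E W))" unfolding adj_total[OF G W] by simp
  finally show ?thesis by (simp only: of_nat_eq_iff)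
qed

text \<open>Degrees within \<open>H\<close> are at most \<open>d\<close>, and one of them is
  smaller: that of \<open>u\<close> if \<open>H\<close> is everything, otherwise that of a vertex
  with an edge leaving \<open>H\<close>, which exists by connectedness.\<close>

lemma nonregular_edges_less:
  assumes G: "simple_graph V E" and con: "connected_graph V E" and deg: "\<And>v. v \<in> V \<Longrightarrow> degree E v \<le> d"
    and u: "u \<in> V" "degree E u < d" and H: "H \<subseteq> V" "H \<noteq> {}"
  shows "2 * card (edges_in E H) < d * card H"
proof -
  have fin: "finite V" "finite H" using simple_graphD(1)[OF G] H(1) finite_subset by auto
  have sub: "nbrs E H v \<subseteq> nbrs E V v" for v using H(1) unfolding nbrs_def by auto
  have finN: "finite (nbrs E V v)" for v using fin(1) unfolding nbrs_def by simp
  have le: "card (nbrs E H v) \<le> d" if "v \<in> H" for v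
    using card_mono[OF finN sub, of v] deg[of v] degree_nbrs[OF G, of v] that H(1) by force
  have "\<exists>a\<in>H. card (nbrs E H a) < d"
  proof (cases "H = V")
    case True
    then show ?thesis using u degree_nbrs[OF G] by auto
  next
    case False
    obtain a b where ab: "a \<in> H" "b \<notin> H" "{a, b} \<in> E" using connected_boundary_edge[OF con H False] by blast
    have "b \<in> nbrs E V a" using ab(3) simple_graphD(3)[OF G ab(3)] unfolding nbrs_def by (simp add: insert_commute)
    moreover have "b \<notin> nbrs E H a" using ab(2) unfolding nbrs_def by simp
    ultimately have "nbrs E H a \<subset> nbrs E V a" using sub by blast
    then have "card (nbrs E H a) < card (nbrs E V a)" by (rule psubset_card_mono[OF finN])
    moreover have "card (nbrs E V a) \<le> d" using deg[of a] degree_nbrs[OF G, of a] ab(1) H(1) by auto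
    ultimately show ?thesis using ab(1) by (intro bexI[of _ a]) auto
  qed
  then have "(\<Sum>u\<in>H. card (nbrs E H u)) < (\<Sum>u\<in>H. d)" using le by (intro sum_strict_mono_ex1 fin) auto
  then show ?thesis unfolding sum_nbrs[OF G fin(2)] by (simp add: mult.commute)
qed

lemma nonregular_eigenvalue_le:
  assumes G: "simple_graph V E" and con: "connected_graph V E" and nr: "\<not> regular V E"
    and n: "n = real (card V)" and D: "\<Delta> = real (max_degree V E)"
  shows "2 \<le> \<Delta>" "max_eigenvalue V E \<le> sqrt (\<Delta>\<^sup>2 - 4 / n\<^sup>2)"
proof -
  note V = simple_graphD(1,2)[OF G]
  let ?d = "max_degree V E"
  note le = degree_le_max[OF G]
  obtain u where u: "u \<in> V" "degree E u < ?d" using nr le unfolding regular_def by (metis le_neq_implies_less)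
  have ev: "adj_eigenvalue V E (max_eigenvalue V E)" by (rule max_eigenvalue(1)[OF V])
  have c: "card V \<ge> 2" using max_degree_less[OF G] u(2) by linarith
  have n1: "n \<ge> 2" using c n by simp
  have ne: "{u} \<noteq> V" using c by auto
  obtain b where "{u, b} \<in> E" using connected_boundary_edge[OF con _ _ ne] u(1) by blast
  then have "degree E u > 0" using simple_graphD(5)[OF G] unfolding degree_def by (auto simp: card_gt_0_iff)
  then have d2: "?d \<ge> 2" using u(2) by linarith
  then show "2 \<le> \<Delta>" using D by simp
  show "max_eigenvalue V E \<le> sqrt (\<Delta>\<^sup>2 - 4 / n\<^sup>2)"
  proof (cases "?d = 2")
    case True
    \<comment> \<open>For maximum degree 2 every vertex set spans fewer edges than it has vertices,
      as in a tree, and the resulting bound is exactly the claimed one.\<close>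
    have "max_eigenvalue V E \<le> 2 * sqrt ((1 - 1 / n) * (\<Delta> - (1 - 1 / n)))"
    proof (rule eigenvalue_density_bound[OF G ev])
      fix H assume H: "H \<subseteq> V" "H \<noteq> {}"
      have "2 * card (edges_in E H) < ?d * card H" by (rule nonregular_edges_less[OF G con le u H])
      then have "card (edges_in E H) + 1 \<le> card H" unfolding True by linarith
      then have "real (card (edges_in E H)) \<le> real (card H) - 1" by simp
      also have "\<dots> \<le> (1 - 1 / n) * real (card H)"
        using card_mono[OF V(1) H(1)] n1 n by (simp add: field_simps)
      finally show "real (card (edges_in E H)) \<le> (1 - 1 / n) * real (card H)" .
    qed (use le D True n1 in \<open>auto simp: field_simps\<close>)
    also have "\<dots> = sqrt (4 * ((1 - 1 / n) * (\<Delta> - (1 - 1 / n))))" unfolding real_sqrt_mult by simp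
    also have "4 * ((1 - 1 / n) * (\<Delta> - (1 - 1 / n))) = \<Delta>\<^sup>2 - 4 / n\<^sup>2"
      using True D n1 by (simp add: field_simps power2_eq_square)
    finally show ?thesis .
  next
    case False
    have D3: "\<Delta> \<ge> 3" using False d2 D by simp
    have "max_eigenvalue V E \<le> \<Delta> - 1 / n\<^sup>2" using nonregular_gap[OF G con ev le u] D n by simp
    also have "\<dots> \<le> sqrt (\<Delta>\<^sup>2 - 4 / n\<^sup>2)"
    proof (rule real_le_rsqrt)
      define y where "y = 1 / n\<^sup>2"
      have y: "0 \<le> y" "y \<le> 1" using n1 unfolding y_def by simp_all
      \<comment> \<open>After squaring, the comparison amounts to y + 4 <= 2 \<Delta>. For \<Delta>
        = 2 this would fail, hence the separate treatment of that case.\<close>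
      have "y * (y + 4 - 2 * \<Delta>) \<le> 0" using y D3 by (intro mult_nonneg_nonpos) auto
      then have "(\<Delta> - y)\<^sup>2 \<le> \<Delta>\<^sup>2 - 4 * y" by (simp add: algebra_simps power2_eq_square)
      then show "(\<Delta> - 1 / n\<^sup>2)\<^sup>2 \<le> \<Delta>\<^sup>2 - 4 / n\<^sup>2" unfolding y_def by simp
    qed
    finally show ?thesis .
  qed
qed

lemma nonregular_bound_less:
  fixes \<Delta> n :: real
  assumes "2 \<le> \<Delta>" "1 \<le> n"
  shows "sqrt (\<Delta>\<^sup>2 - 4 / n\<^sup>2) < \<Delta> - 2 / (\<Delta> * n\<^sup>2)"
proof -
  \<comment> \<open>Chosen so that 2 \<Delta> y = 4 / \<open>n\<^sup>2\<close>; completing the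
    square then adds the square of y, which gives strictness.\<close>
  define y where "y = 2 / (\<Delta> * n\<^sup>2)"
  have "1 \<le> n\<^sup>2" using assms(2) by simp
  then have "2 * 1 \<le> \<Delta> * n\<^sup>2" using assms(1) by (intro mult_mono) auto
  then have y: "0 < y" "y \<le> 1" unfolding y_def by simp_all
  have "\<Delta>\<^sup>2 - 4 / n\<^sup>2 = \<Delta>\<^sup>2 - 2 * \<Delta> * y" unfolding y_def using assms by simp
  also have "\<dots> < (\<Delta> - y)\<^sup>2" using y by (simp add: power2_diff)
  finally have "sqrt (\<Delta>\<^sup>2 - 4 / n\<^sup>2) < sqrt ((\<Delta> - y)\<^sup>2)" by (rule real_sqrt_less_mono)
  then show ?thesis using y assms unfolding y_def by simp
qed

lemma tree_eigenvalue_le: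
  assumes T: "tree V E" and n: "n = real (card V)" and D: "\<Delta> = real (max_degree V E)" and D2: "2 \<le> \<Delta>"
  shows "max_eigenvalue V E \<le> 2 * sqrt ((1 - 1 / n) * (\<Delta> - 1 + 1 / n))"
proof -
  have G: "simple_graph V E" using T unfolding tree_def by blast
  note V = simple_graphD(1,2)[OF G]
  have n1: "n \<ge> 1" using V n by (simp add: card_gt_0_iff Suc_le_eq)
  have "max_eigenvalue V E \<le> 2 * sqrt ((1 - 1 / n) * (\<Delta> - (1 - 1 / n)))"
  proof (rule eigenvalue_density_bound[OF G max_eigenvalue(1)[OF V]])
    fix H assume H: "H \<subseteq> V" "H \<noteq> {}"
    have "real (card (edges_in E H)) \<le> real (card H) - 1" using tree_edges[OF T H] by simp
    \<comment> \<open>As \<open>H\<close> has at most n vertices, the one missing edge lowers the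
      density by at least 1 / n.\<close>
    also have "\<dots> \<le> (1 - 1 / n) * real (card H)"
      using card_mono[OF V(1) H(1)] n1 n by (simp add: field_simps)
    finally show "real (card (edges_in E H)) \<le> (1 - 1 / n) * real (card H)" .
  next
    show "0 \<le> 1 - 1 / n" using n1 by simp
    have "2 * (1 - 1 / n) \<le> 2 * 1" using n1 by (intro mult_left_mono) auto
    then show "2 * (1 - 1 / n) \<le> \<Delta>" using D2 by (simp only: mult_1_right order_trans)
    show "real (degree E v) \<le> \<Delta>" if "v \<in> V" for v using degree_le_max[OF G that] D by simp
  qed
  then show ?thesis by (simp add: algebra_simps)
qed

text \<open>A connected graph of maximum degree at most 1 is a single vertex or a single edge, hence
  regular.\<close>

lemma tree_small_eigenvalue:
  assumes T: "tree V E" and D: "max_degree V E < 2"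
  shows "max_eigenvalue V E = real (max_degree V E)"
proof -
  have G: "simple_graph V E" and con: "connected_graph V E" using T unfolding tree_def by auto
  show ?thesis
  proof (rule regular_eigenvalue[OF G])
    fix v assume v: "v \<in> V"
    show "degree E v = max_degree V E"
    proof (cases "max_degree V E = 0")
      case True
      then show ?thesis using degree_le_max[OF G v] by simp
    next
      case False
      then have "card V \<ge> 2" using max_degree_less[OF G] by linarith
      then have ne: "{v} \<noteq> V" by auto
      obtain b where "{v, b} \<in> E" using connected_boundary_edge[OF con _ _ ne] v by blast
      then have "degree E v > 0" using simple_graphD(5)[OF G] unfolding degree_def by (auto simp: card_gt_0_iff)
      then show ?thesis using degree_le_max[OF G v] D by linarith
    qed
  qed
qed

lemma edges_in_le_choose:
  assumes "simple_graph V E" "finite H" "H \<noteq> {}"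
  shows "2 * real (card (edges_in E H)) \<le> real (card H) * (real (card H) - 1)"
proof -
  obtain m where m: "card H = Suc m" using assms(2,3) by (metis card_eq_0_iff not0_implies_Suc)
  have "real (2 * card (edges_in E H)) \<le> real (card H * (card H - 1))"
    using edges_in_le_complete[OF assms(1,2)] by (simp only: of_nat_le_iff)
  then show ?thesis unfolding m by (simp add: algebra_simps)
qed

lemma tree_width_eigenvalue_le:
  fixes t :: nat
  assumes G: "simple_graph V E" and tw: "tree_width V E \<le> t"
    and n: "n = real (card V)" and D: "\<Delta> = real (max_degree V E)" and D2: "2 * real t \<le> \<Delta>"
  shows "2 * real t + 1 \<le> n"
    "max_eigenvalue V E \<le> 2 * sqrt ((real t - real t * (real t + 1) / (2 * n))
                     * (\<Delta> - real t + real t * (real t + 1) / (2 * n)))"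
proof -
  note V = simple_graphD(1,2)[OF G]
  show nt: "2 * real t + 1 \<le> n" using max_degree_less[OF G] D2 n D by linarith
  then have n0: "n > 0" by linarith
  \<comment> \<open>The deficit of t (t + 1) / 2 edges spread over all n vertices; the full vertex
    set is the worst case among those with at least t vertices.\<close>
  define \<epsilon> where "\<epsilon> = real t * (real t + 1) / (2 * n)"
  have "real t * (real t + 1) \<le> real t * n" using nt by (intro mult_left_mono) auto
  then have e: "0 \<le> \<epsilon>" "2 * \<epsilon> \<le> real t" unfolding \<epsilon>_def using n0 by (simp_all add: field_simps)
  have "max_eigenvalue V E \<le> 2 * sqrt ((real t - \<epsilon>) * (\<Delta> - (real t - \<epsilon>)))"
  proof (rule eigenvalue_density_bound[OF G max_eigenvalue(1)[OF V]])
    fix H assume H: "H \<subseteq> V" "H \<noteq> {}"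
    have hn: "real (card H) \<le> n" using card_mono[OF V(1) H(1)] n by simp
    have finH: "finite H" using V(1) H(1) finite_subset by blast
    show "real (card (edges_in E H)) \<le> (real t - \<epsilon>) * real (card H)"
    proof (cases "t \<le> card H")
      case True
      have "2 * real (card (edges_in E H)) + real t * (real t + 1) \<le> 2 * real t * real (card H)"
        using of_nat_mono[OF tree_width_edges[OF G tw H(1) True], where 'a = real] by (simp add: algebra_simps)
      moreover have "2 * \<epsilon> * real (card H) \<le> 2 * \<epsilon> * n" using hn e by (intro mult_left_mono) auto
      moreover have "2 * \<epsilon> * n = real t * (real t + 1)" unfolding \<epsilon>_def using n0 by simp
      ultimately show ?thesis by (simp add: algebra_simps)
    next
      case False
      have "real (card H) \<le> real t" using False by simp
      \<comment> \<open>Fewer than t vertices are too few for the edge count of bounded tree-width,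
        but even a complete graph on them is sparse enough, because \<epsilon> is at most t /
        2.\<close>
      then have "real (card H) - 1 \<le> 2 * (real t - \<epsilon>)" using e by simp
      then have "real (card H) * (real (card H) - 1) \<le> real (card H) * (2 * (real t - \<epsilon>))"
        by (intro mult_left_mono) auto
      moreover have "2 * real (card (edges_in E H)) \<le> real (card H) * (real (card H) - 1)"
        by (rule edges_in_le_choose[OF G finH H(2)])
      ultimately show ?thesis by (simp add: algebra_simps)
    qed
  qed (use degree_le_max[OF G] D D2 e in auto)
  then show "max_eigenvalue V E \<le> 2 * sqrt ((real t - real t * (real t + 1) / (2 * n))
                     * (\<Delta> - real t + real t * (real t + 1) / (2 * n)))"
    unfolding \<epsilon>_def by (simp add: algebra_simps)
qed

lemma planar_eigenvalue_le:
  assumes G: "simple_graph V E" and P: "planar V E"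
    and n: "n = real (card V)" and D: "\<Delta> = real (max_degree V E)" and D6: "6 \<le> \<Delta>"
  shows "7 \<le> n" "max_eigenvalue V E \<le> 2 * sqrt ((3 - 6 / n) * (\<Delta> - 3 + 6 / n))"
proof -
  note V = simple_graphD(1,2)[OF G]
  show n7: "7 \<le> n" using max_degree_less[OF G] D6 n D by linarith
  \<comment> \<open>The deficit of 6 edges spread over n vertices. A vertex of degree 6 forces n to
    be at least 7, so the density bound stays above 2, which also covers sets of at most two
    vertices.\<close>
  define \<epsilon> where "\<epsilon> = 6 / n"
  have e: "0 \<le> \<epsilon>" "\<epsilon> \<le> 1" "\<epsilon> * n = 6" unfolding \<epsilon>_def using n7 by simp_all
  have "max_eigenvalue V E \<le> 2 * sqrt ((3 - \<epsilon>) * (\<Delta> - (3 - \<epsilon>)))"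
  proof (rule eigenvalue_density_bound[OF G max_eigenvalue(1)[OF V]])
    fix H assume H: "H \<subseteq> V" "H \<noteq> {}"
    have hn: "real (card H) \<le> n" using card_mono[OF V(1) H(1)] n by simp
    have finH: "finite H" using V(1) H(1) finite_subset by blast
    show "real (card (edges_in E H)) \<le> (3 - \<epsilon>) * real (card H)"
    proof (cases "card H \<ge> 3")
      case True
      have "real (card (edges_in E H)) \<le> 3 * real (card H) - 6"
        using planar_edges_le[OF G P H(1) True] by linarith
      moreover have "\<epsilon> * real (card H) \<le> \<epsilon> * n" using hn e by (intro mult_left_mono) auto
      ultimately show ?thesis using e by (simp add: algebra_simps)
    next
      case False
      have "card H * (card H - 1) \<le> card H * 1" using False by (intro mult_left_mono) auto
      then have "card (edges_in E H) \<le> card H" using edges_in_le_complete[OF G finH] by linarith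
      moreover have "1 * real (card H) \<le> (3 - \<epsilon>) * real (card H)" using e by (intro mult_right_mono) auto
      ultimately show ?thesis by linarith
    qed
  qed (use degree_le_max[OF G] D D6 e in auto)
  then show "max_eigenvalue V E \<le> 2 * sqrt ((3 - 6 / n) * (\<Delta> - 3 + 6 / n))"
    unfolding \<epsilon>_def by (simp add: algebra_simps)
qed

text \<open>On h vertices a complete graph has density (h - 1) / 2, while the surface allows at most
  3 + 6 (g - 1) / h. The first grows with h, the second does not, and they are equal at
  \<open>h = heawood g\<close>. So the larger of their values at the floor and at the ceiling bounds
  the density for every integer h.\<close>

lemma genus_eigenvalue_le:
  assumes G: "simple_graph V E" and g: "g > 0" and S: "surface_of_genus g S" and emb: "embeds_in V E S"
    and D: "\<Delta> = real (max_degree V E)" and Dk: "2 * genus_kappa g \<le> \<Delta>"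
  shows "max_eigenvalue V E \<le> 2 * sqrt (genus_kappa g * (\<Delta> - genus_kappa g))"
proof -
  note V = simple_graphD(1,2)[OF G]
  have "7 / 2 = sqrt ((7 / 2)\<^sup>2)" by simp
  also have "\<dots> \<le> sqrt (12 * real g + 1 / 4)"
    using g by (intro real_sqrt_le_mono) (simp add: power2_eq_square)
  finally have h7: "heawood g \<ge> 7" unfolding heawood_def by linarith
  let ?f = "real_of_int \<lfloor>heawood g\<rfloor>" and ?c = "real_of_int \<lceil>heawood g\<rceil>"
  have c7: "?c \<ge> 7" using h7 le_of_int_ceiling[of "heawood g"] by linarith
  have k1: "(?f - 1) / 2 \<le> genus_kappa g" and k2: "3 + 6 * (real g - 1) / ?c \<le> genus_kappa g"
    unfolding genus_kappa_def by simp_all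
  have "0 \<le> 6 * (real g - 1) / ?c" using g c7 by (intro divide_nonneg_nonneg) auto
  then have k0: "0 \<le> genus_kappa g" using k2 by linarith
  show ?thesis
  proof (rule eigenvalue_density_bound[OF G max_eigenvalue(1)[OF V] _ k0 Dk])
    show "real (degree E v) \<le> \<Delta>" if "v \<in> V" for v using degree_le_max[OF G that] D by simp
    fix H assume H: "H \<subseteq> V" "H \<noteq> {}"
    have finH: "finite H" using V(1) H(1) finite_subset by blast
    show "real (card (edges_in E H)) \<le> genus_kappa g * real (card H)"
    proof (cases "int (card H) \<le> \<lfloor>heawood g\<rfloor>")
      case True
      then have "real (card H) \<le> ?f" by (metis of_int_le_iff of_int_of_nat_eq)
      then have "(real (card H) - 1) / 2 \<le> genus_kappa g" using k1 by simp
      then have "(real (card H) - 1) / 2 * real (card H) \<le> genus_kappa g * real (card H)"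
        by (intro mult_right_mono) auto
      moreover have "2 * real (card (edges_in E H)) \<le> real (card H) * (real (card H) - 1)"
        by (rule edges_in_le_choose[OF G finH H(2)])
      ultimately show ?thesis by (simp add: algebra_simps)
    next
      case False
      \<comment> \<open>An integer above the floor is at least the ceiling, where the surface bound
        takes over.\<close>
      then have "\<lceil>heawood g\<rceil> \<le> int (card H)" by linarith
      then have ch: "?c \<le> real (card H)" by (metis of_int_le_iff of_int_of_nat_eq)
      then have "card H \<ge> 3" using c7 by linarith
      from genus_edges_le[OF S G emb H(1) this]
      have "real (card (edges_in E H)) \<le> 3 * real (card H) + 6 * (real g - 1)" by simp
      also have "6 * (real g - 1) = 6 * (real g - 1) / ?c * ?c"
      proof -
        have "?c \<noteq> 0" using c7 by linarith
        then show ?thesis by (rule nonzero_eq_divide_eq[THEN iffD1, OF _ refl, symmetric])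
      qed
      also have "\<dots> \<le> 6 * (real g - 1) / ?c * real (card H)"
        using ch g c7 by (intro mult_left_mono divide_nonneg_nonneg) auto
      also have "3 * real (card H) + 6 * (real g - 1) / ?c * real (card H) = (3 + 6 * (real g - 1) / ?c) * real (card H)"
        by (simp add: distrib_right)
      also have "\<dots> \<le> genus_kappa g * real (card H)" using k2 by (intro mult_right_mono) auto
      finally show ?thesis by simp
    qed
  qed
qed

theorem corollary49:
  fixes V :: "'a set" and E :: "'a set set" and n \<Delta> lam :: real
  assumes G: "simple_graph V E"
    and n: "n = real (card V)"
    and D: "\<Delta> = real (max_degree V E)"
    and L: "lam = max_eigenvalue V E"
  shows
    "(connected_graph V E \<and> \<not> regular V E \<longrightarrow>
        lam \<le> sqrt (\<Delta>\<^sup>2 - 4 / n\<^sup>2) \<and>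
        sqrt (\<Delta>\<^sup>2 - 4 / n\<^sup>2) < \<Delta> - 2 / (\<Delta> * n\<^sup>2)) \<and>

     (tree V E \<longrightarrow>
        (\<Delta> \<ge> 2 \<longrightarrow>
           lam \<le> 2 * sqrt ((1 - 1 / n) * (\<Delta> - 1 + 1 / n)) \<and>
           2 * sqrt ((1 - 1 / n) * (\<Delta> - 1 + 1 / n))
             < sqrt (\<Delta> - 1) * (2 - (\<Delta> - 2) / ((\<Delta> - 1) * n))) \<and>
        (\<Delta> = 2 \<longrightarrow> lam < 2 - 1 / n\<^sup>2) \<and>
        (\<Delta> < 2 \<longrightarrow> lam = \<Delta>)) \<and>

     (\<forall>t::nat. tree_width V E \<le> t \<and> \<Delta> \<ge> 2 * real t \<longrightarrow>
        lam \<le> 2 * sqrt ((real t - real t * (real t + 1) / (2 * n))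
                     * (\<Delta> - real t + real t * (real t + 1) / (2 * n))) \<and>
        (t \<ge> 1 \<longrightarrow>
           2 * sqrt ((real t - real t * (real t + 1) / (2 * n))
                     * (\<Delta> - real t + real t * (real t + 1) / (2 * n)))
             < sqrt (real t * (\<Delta> - real t))
               * (2 - (real t + 1) * (\<Delta> - 2 * real t) / (2 * (\<Delta> - real t) * n))) \<and>
        (t \<ge> 1 \<and> \<Delta> = 2 * real t \<longrightarrow>
           lam < 2 * real t - real t * (real t + 1)\<^sup>2 / (4 * n\<^sup>2))) \<and>

     (planar V E \<longrightarrow>
        (\<Delta> \<ge> 6 \<longrightarrow>
           lam \<le> 2 * sqrt ((3 - 6 / n) * (\<Delta> - 3 + 6 / n)) \<and>
           2 * sqrt ((3 - 6 / n) * (\<Delta> - 3 + 6 / n))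
             < 2 * sqrt (3 * (\<Delta> - 3)) * (1 - (\<Delta> - 6) / ((\<Delta> - 3) * n))) \<and>
        (\<Delta> = 6 \<longrightarrow> lam \<le> 6 - 12 / n\<^sup>2) \<and>
        (\<Delta> \<le> 5 \<longrightarrow> lam \<le> \<Delta>)) \<and>
     (\<forall>d::nat. d \<le> 5 \<longrightarrow>
        (\<exists>(W :: nat set) F. simple_graph W F \<and> planar W F \<and>
            max_degree W F = d \<and> max_eigenvalue W F = real d)) \<and>

     (\<forall>(g::nat) (S :: 'b topology).
        g > 0 \<and> surface_of_genus g S \<and> embeds_in V E S \<and> \<Delta> \<ge> 2 * genus_kappa g \<longrightarrow>
        lam \<le> 2 * sqrt (genus_kappa g * (\<Delta> - genus_kappa g)))"
proof (intro conjI allI impI)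
  note V = simple_graphD(1,2)[OF G]
  have n1: "n \<ge> 1" using V n by (simp add: card_gt_0_iff Suc_le_eq)
  {
    assume "connected_graph V E \<and> \<not> regular V E"
    then have c: "connected_graph V E" "\<not> regular V E" by auto
    note nr = nonregular_eigenvalue_le[OF G c n D]
    show "lam \<le> sqrt (\<Delta>\<^sup>2 - 4 / n\<^sup>2)" using nr(2) L by simp
    show "sqrt (\<Delta>\<^sup>2 - 4 / n\<^sup>2) < \<Delta> - 2 / (\<Delta> * n\<^sup>2)" by (rule nonregular_bound_less[OF nr(1) n1])
  next
    assume T: "tree V E"
    note le = tree_eigenvalue_le[OF T n D, folded L]
    {
      assume D2: "2 \<le> \<Delta>"
      show "lam \<le> 2 * sqrt ((1 - 1 / n) * (\<Delta> - 1 + 1 / n))" by (rule le[OF D2])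
      show "2 * sqrt ((1 - 1 / n) * (\<Delta> - 1 + 1 / n)) < sqrt (\<Delta> - 1) * (2 - (\<Delta> - 2) / ((\<Delta> - 1) * n))"
        using sqrt_less_shifted[of "1 / n" 1 \<Delta>] n1 D2 by (simp add: mult.commute)
    next
      assume D2: "\<Delta> = 2"
      show "lam < 2 - 1 / n\<^sup>2"
        using le sqrt_less_balanced[of "1 / n" 1] n1 D2 by (simp add: power_divide)
    next
      assume "\<Delta> < 2"
      then show "lam = \<Delta>" using tree_small_eigenvalue[OF T] D L by simp
    }
  next
    fix t :: nat
    assume "tree_width V E \<le> t \<and> 2 * real t \<le> \<Delta>"
    then have t: "tree_width V E \<le> t" "2 * real t \<le> \<Delta>" by auto
    note le = tree_width_eigenvalue_le[OF G t(1) n D t(2), folded L]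
    define \<epsilon> where "\<epsilon> = real t * (real t + 1) / (2 * n)"
    have e: "0 < \<epsilon>" "\<epsilon> \<le> real t" if "1 \<le> t"
    proof -
      show "0 < \<epsilon>" unfolding \<epsilon>_def using that n1 by simp
      have "real t * (real t + 1) \<le> real t * (2 * n)" using le(1) by (intro mult_left_mono) auto
      then show "\<epsilon> \<le> real t" unfolding \<epsilon>_def using n1 by (simp add: divide_le_eq)
    qed
    show 1: "lam \<le> 2 * sqrt ((real t - real t * (real t + 1) / (2 * n))
                     * (\<Delta> - real t + real t * (real t + 1) / (2 * n)))" by (rule le(2))
    {
      assume t1: "1 \<le> t"
      have "real t * (real t + 1) / (2 * n) * (\<Delta> - 2 * real t) / (real t * (\<Delta> - real t))
        = (real t + 1) * (\<Delta> - 2 * real t) / (2 * (\<Delta> - real t) * n)"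
        using t1 t(2) n1 by (simp add: field_simps)
      then show "2 * sqrt ((real t - real t * (real t + 1) / (2 * n))
                     * (\<Delta> - real t + real t * (real t + 1) / (2 * n)))
             < sqrt (real t * (\<Delta> - real t))
               * (2 - (real t + 1) * (\<Delta> - 2 * real t) / (2 * (\<Delta> - real t) * n))"
        using sqrt_less_shifted[OF e[OF t1] t(2)] unfolding \<epsilon>_def by simp
    next
      assume "1 \<le> t \<and> \<Delta> = 2 * real t"
      then have t1: "1 \<le> t" "\<Delta> = 2 * real t" by auto
      have "\<epsilon>\<^sup>2 / real t = real t * (real t + 1)\<^sup>2 / (4 * n\<^sup>2)"
        unfolding \<epsilon>_def using t1(1) by (simp add: power_divide power_mult_distrib power2_eq_square)
      then show "lam < 2 * real t - real t * (real t + 1)\<^sup>2 / (4 * n\<^sup>2)"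
        using 1 sqrt_less_balanced[OF e[OF t1(1)]] unfolding \<epsilon>_def[symmetric] t1(2) by linarith
    }
  next
    assume P: "planar V E"
    note le = planar_eigenvalue_le[OF G P n D, folded L]
    {
      assume D6: "6 \<le> \<Delta>"
      show "lam \<le> 2 * sqrt ((3 - 6 / n) * (\<Delta> - 3 + 6 / n))" by (rule le(2)[OF D6])
      have "6 / n \<le> 3" using le(1)[OF D6] by (simp add: divide_le_eq)
      then have "2 * sqrt ((3 - 6 / n) * (\<Delta> - 3 + 6 / n))
          < sqrt (3 * (\<Delta> - 3)) * (2 - 6 / n * (\<Delta> - 2 * 3) / (3 * (\<Delta> - 3)))"
        using n1 D6 by (intro sqrt_less_shifted) auto
      also have "6 / n * (\<Delta> - 2 * 3) / (3 * (\<Delta> - 3)) = 2 * ((\<Delta> - 6) / ((\<Delta> - 3) * n))"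
        using n1 D6 by (simp add: field_simps)
      also have "sqrt (3 * (\<Delta> - 3)) * (2 - 2 * ((\<Delta> - 6) / ((\<Delta> - 3) * n)))
        = 2 * sqrt (3 * (\<Delta> - 3)) * (1 - (\<Delta> - 6) / ((\<Delta> - 3) * n))"
        by (simp only: right_diff_distrib mult.assoc mult.left_commute mult_1_right mult.commute)
      finally show "2 * sqrt ((3 - 6 / n) * (\<Delta> - 3 + 6 / n))
             < 2 * sqrt (3 * (\<Delta> - 3)) * (1 - (\<Delta> - 6) / ((\<Delta> - 3) * n))" .
    next
      assume D6: "\<Delta> = 6"
      have "6 / n \<le> 3" using le(1) D6 by (simp add: divide_le_eq)
      then show "lam \<le> 6 - 12 / n\<^sup>2"
        using le(2) sqrt_less_balanced[of "6 / n" 3] n1 D6 by (simp add: power_divide)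
    next
      show "lam \<le> \<Delta>"
        using eigenvalue_le_max_degree[OF G max_eigenvalue(1)[OF V]] degree_le_max[OF G] L D by simp
    }
  next
    fix d :: nat assume "d \<le> 5"
    then show "\<exists>(W :: nat set) F. simple_graph W F \<and> planar W F \<and>
            max_degree W F = d \<and> max_eigenvalue W F = real d" by (rule planar_examples)
  next
    fix g :: nat and S :: "'b topology"
    assume "g > 0 \<and> surface_of_genus g S \<and> embeds_in V E S \<and> \<Delta> \<ge> 2 * genus_kappa g"
    then show "lam \<le> 2 * sqrt (genus_kappa g * (\<Delta> - genus_kappa g))"
      using genus_eigenvalue_le[OF G _ _ _ D] L by blast
  }
qed

end
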